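(* Let $q\in(0,1)$ and let $n\ge 1$ be an integer. The $C^*$-algebra $C(B^{2n}_q)$ is isomorphic with the $C^*$-algebra $C^*(z_1,\ldots,z_n)$, universal (with respect to representations in bounded operators) for the relations $$z_iz_j=q^{1/2}z_jz_i\quad\text{for } i<j,$$ $$z_iz_j^*=q^{-1/2}z_j^*z_i\quad\text{for } i<j,$$ $$z_i^*z_i-qz_iz_i^*=(1-q)\Bigl(1-\sum_{j=i+1}^n z_jz_j^*\Bigr)\quad\text{for } i=1,\ldots,n.$$
   Context: Universal $C^*$-algebras are unital, with $1$ in the relations denoting the unit. Quantum double suspension: let $\{E_{ij}: i,j=0,1,\ldots\}$ be the standard matrix units in $\mathcal B(\ell^2(\mathbb N))$ relative to the standard basis $\{\xi_j:j=0,1,\ldots\}$, so $E_{ij}\xi_k=\delta_{jk}\xi_i$, and let $V$ be the unilateral shift $V\xi_j=\xi_{j+1}$. For a unital $C^*$-algebra $A$, the quantum double suspension $\Sigma^2A$ is the $C^*$-subalgebra of $A\otimes\mathcal B(\ell^2(\mathbb N))$ generated by $A\otimes E_{00}$ and $1\otimes V$ (equivalently, the unital essential extension of $C(S^1)$ by $A\otimes\mathcal K$, with $\mathcal K$ the compact operators on $\ell^2(\mathbb N)$, whose Busby invariant sends the standard unitary generator of $C(S^1)$ to the class of $1\otimes V$ in $M(A\otimes\mathcal K)/(A\otimes\mathcal K)$). The $C^*$-algebras of the even-dimensional noncommutative balls are defined inductively by $C(B^0_q)=\mathbb C$ and $C(B^{2(n+1)}_q)=\Sigma^2C(B^{2n}_q)$.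 *)

theory Defs
  imports "HOL-Analysis.Analysis" "HOL-Algebra.QuotRing"
begin

section \<open>The Hilbert space of square-summable families\<close>

typedef 'i ell2 = "{f :: 'i \<Rightarrow> complex. (\<lambda>i. (cmod (f i))\<^sup>2) summable_on UNIV}"
  morphisms coord Abs_ell2
  by (rule exI[of _ "\<lambda>_. 0"]) simp

setup_lifting type_definition_ell2

lemma ell2_eqI: "(\<And>i. coord x i = coord y i) \<Longrightarrow> x = y"
  by (metis coord_inject ext)

lemma coord_square_summable: "(\<lambda>i. (cmod (coord x i))\<^sup>2) summable_on UNIV"
  using coord[of x] by simp

lemma square_summable_mult:
  assumes "(\<lambda>i. (cmod (f i))\<^sup>2) summable_on A" "(\<lambda>i. (cmod (g i))\<^sup>2) summable_on A"
  shows "(\<lambda>i. cmod (f i) * cmod (g i)) summable_on A"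
proof (rule summable_on_comparison_test)
  show "(\<lambda>i. (cmod (f i))\<^sup>2 + (cmod (g i))\<^sup>2) summable_on A"
    by (intro summable_on_add assms)
  fix i
  have "0 \<le> (cmod (f i) - cmod (g i))\<^sup>2" by simp
  then have "2 * (cmod (f i) * cmod (g i)) \<le> (cmod (f i))\<^sup>2 + (cmod (g i))\<^sup>2"
    by (simp add: power2_diff)
  moreover have "0 \<le> cmod (f i) * cmod (g i)" by simp
  ultimately show "cmod (f i) * cmod (g i) \<le> (cmod (f i))\<^sup>2 + (cmod (g i))\<^sup>2"
    by linarith
qed auto

lemma square_summable_add:
  assumes "(\<lambda>i. (cmod (f i))\<^sup>2) summable_on A" "(\<lambda>i. (cmod (g i))\<^sup>2) summable_on A"
  shows "(\<lambda>i. (cmod (f i + g i))\<^sup>2) summable_on A"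
proof (rule summable_on_comparison_test)
  show "(\<lambda>i. (cmod (f i))\<^sup>2 + 2 * (cmod (f i) * cmod (g i)) + (cmod (g i))\<^sup>2) summable_on A"
    by (intro summable_on_add summable_on_cmult_right assms square_summable_mult)
  fix i
  have "(cmod (f i + g i))\<^sup>2 \<le> (cmod (f i) + cmod (g i))\<^sup>2"
    by (intro power_mono norm_triangle_ineq) simp
  then show "(cmod (f i + g i))\<^sup>2 \<le> (cmod (f i))\<^sup>2 + 2 * (cmod (f i) * cmod (g i)) + (cmod (g i))\<^sup>2"
    by (simp add: power2_sum)
qed auto

lemma square_summable_cmult:
  assumes "(\<lambda>i. (cmod (f i))\<^sup>2) summable_on A"
  shows "(\<lambda>i. (cmod (c * f i))\<^sup>2) summable_on A"
  using summable_on_cmult_right[OF assms, of "(cmod c)\<^sup>2"]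
  by (simp add: norm_mult power_mult_distrib)

lift_definition cscale_ell2 :: "complex \<Rightarrow> 'i ell2 \<Rightarrow> 'i ell2" is "\<lambda>c f i. c * f i"
  using square_summable_cmult by auto

definition cinner :: "'i ell2 \<Rightarrow> 'i ell2 \<Rightarrow> complex" where
  "cinner x y = (\<Sum>\<^sub>\<infinity>i. cnj (coord x i) * coord y i)"

lemma cinner_summable: "(\<lambda>i. cnj (coord x i) * coord y i) summable_on UNIV"
proof (rule abs_summable_summable)
  show "(\<lambda>i. norm (cnj (coord x i) * coord y i)) summable_on UNIV"
    using square_summable_mult[OF coord_square_summable[of x] coord_square_summable[of y]]
    by (simp add: norm_mult)
qed

instantiation ell2 :: (type) real_inner
begin

lift_definition zero_ell2 :: "'i ell2" is "\<lambda>_. 0" by simp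
lift_definition plus_ell2 :: "'i ell2 \<Rightarrow> 'i ell2 \<Rightarrow> 'i ell2" is "\<lambda>f g i. f i + g i"
  using square_summable_add by auto
lift_definition uminus_ell2 :: "'i ell2 \<Rightarrow> 'i ell2" is "\<lambda>f i. - f i"
  by simp
definition minus_ell2 :: "'i ell2 \<Rightarrow> 'i ell2 \<Rightarrow> 'i ell2" where "minus_ell2 x y = x + (- y)"
definition scaleR_ell2 :: "real \<Rightarrow> 'i ell2 \<Rightarrow> 'i ell2" where
  "scaleR_ell2 r x = cscale_ell2 (complex_of_real r) x"
definition inner_ell2 :: "'i ell2 \<Rightarrow> 'i ell2 \<Rightarrow> real" where "inner_ell2 x y = Re (cinner x y)"
definition norm_ell2 :: "'i ell2 \<Rightarrow> real" where "norm_ell2 x = sqrt (inner x x)"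
definition sgn_ell2 :: "'i ell2 \<Rightarrow> 'i ell2" where "sgn_ell2 x = inverse (norm x) *\<^sub>R x"
definition dist_ell2 :: "'i ell2 \<Rightarrow> 'i ell2 \<Rightarrow> real" where "dist_ell2 x y = norm (x - y)"
definition uniformity_ell2 :: "('i ell2 \<times> 'i ell2) filter" where
  "uniformity_ell2 = (INF e\<in>{0<..}. principal {(x, y). dist x y < e})"
definition open_ell2 :: "'i ell2 set \<Rightarrow> bool" where
  "open_ell2 U = (\<forall>x\<in>U. eventually (\<lambda>(x', y). x' = x \<longrightarrow> y \<in> U) uniformity)"

instance
proof
  fix x y z :: "'i ell2" and r s :: real
  show "x - y = x + - y" by (simp add: minus_ell2_def)
  show "x + y + z = x + (y + z)" by transfer (simp add: add.assoc)
  show "x + y = y + x" by transfer (simp add: add.commute)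
  show "0 + x = x" by transfer simp
  show "- x + x = 0" by transfer simp
  show "r *\<^sub>R (x + y) = r *\<^sub>R x + r *\<^sub>R y"
    unfolding scaleR_ell2_def by transfer (simp add: distrib_left)
  show "(r + s) *\<^sub>R x = r *\<^sub>R x + s *\<^sub>R x"
    unfolding scaleR_ell2_def by transfer (simp add: distrib_right)
  show "r *\<^sub>R s *\<^sub>R x = (r * s) *\<^sub>R x"
    unfolding scaleR_ell2_def by transfer (simp add: mult.assoc)
  show "1 *\<^sub>R x = x" unfolding scaleR_ell2_def by transfer simp
  show "dist x y = norm (x - y)" by (rule dist_ell2_def)
  show "sgn x = inverse (norm x) *\<^sub>R x" by (rule sgn_ell2_def)
  show "uniformity = (INF e\<in>{0<..}. principal {(x, y::'i ell2). dist x y < e})"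
    by (rule uniformity_ell2_def)
  show "open U = (\<forall>x\<in>U. \<forall>\<^sub>F (x', y) in uniformity. x' = x \<longrightarrow> y \<in> U)" for U :: "'i ell2 set"
    by (rule open_ell2_def)
  show "norm x = sqrt (inner x x)" by (rule norm_ell2_def)
  have Re: "inner x y = (\<Sum>\<^sub>\<infinity>i. Re (cnj (coord x i) * coord y i))" for x y :: "'i ell2"
    unfolding inner_ell2_def cinner_def by (rule infsum_Re[symmetric, OF cinner_summable])
  have Re_summable: "(\<lambda>i. Re (cnj (coord x i) * coord y i)) summable_on UNIV" for x y :: "'i ell2"
    by (rule summable_on_Re[OF cinner_summable])
  show "inner x y = inner y x" unfolding Re by (simp add: mult.commute)
  show "inner (x + y) z = inner x z + inner y z"
  proof -
    have "Re (cnj (coord (x + y) i) * coord z i)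
        = Re (cnj (coord x i) * coord z i) + Re (cnj (coord y i) * coord z i)" for i
      by (simp add: plus_ell2.rep_eq algebra_simps)
    then show ?thesis
      unfolding Re using infsum_add[OF Re_summable[of x z] Re_summable[of y z]] by presburger
  qed
  show "inner (r *\<^sub>R x) y = r * inner x y"
  proof -
    have "Re (cnj (coord (r *\<^sub>R x) i) * coord y i) = r * Re (cnj (coord x i) * coord y i)" for i
      by (simp add: scaleR_ell2_def cscale_ell2.rep_eq algebra_simps)
    then show ?thesis unfolding Re by (simp only: infsum_cmult_right')
  qed
  have sq: "inner x x = (\<Sum>\<^sub>\<infinity>i. (cmod (coord x i))\<^sup>2)" for x :: "'i ell2"
    unfolding Re cmod_power2 by (simp add: power2_eq_square)
  show "0 \<le> inner x x" unfolding sq by (rule infsum_nonneg) simp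
  show "(inner x x = 0) = (x = 0)"
  proof
    assume "inner x x = 0"
    then have "((\<lambda>i. (cmod (coord x i))\<^sup>2) has_sum 0) UNIV"
      unfolding sq using has_sum_infsum[OF coord_square_summable[of x]] by simp
    then have "(cmod (coord x i))\<^sup>2 = 0" for i
      by (rule nonneg_has_sum_le_0D) auto
    then show "x = 0" by (intro ell2_eqI) (simp add: zero_ell2.rep_eq)
  next
    assume "x = 0"
    then show "inner x x = 0" unfolding sq by (simp add: zero_ell2.rep_eq)
  qed
qed

end

lemma norm_ell2_square: "(norm x)\<^sup>2 = (\<Sum>\<^sub>\<infinity>i. (cmod (coord x i))\<^sup>2)"
proof -
  have "(norm x)\<^sup>2 = Re (cinner x x)"
    by (simp only: power2_norm_eq_inner inner_ell2_def)
  also have "\<dots> = (\<Sum>\<^sub>\<infinity>i. Re (cnj (coord x i) * coord x i))"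
    unfolding cinner_def by (rule infsum_Re[symmetric, OF cinner_summable])
  also have "\<dots> = (\<Sum>\<^sub>\<infinity>i. (cmod (coord x i))\<^sup>2)"
    unfolding cmod_power2 by (simp add: power2_eq_square)
  finally show ?thesis .
qed


lemma cmod_coord_le: "cmod (coord x i) \<le> norm x"
proof -
  have "(\<Sum>j\<in>{i}. (cmod (coord x j))\<^sup>2) \<le> (\<Sum>\<^sub>\<infinity>j. (cmod (coord x j))\<^sup>2)"
    by (rule finite_sum_le_infsum[OF coord_square_summable]) auto
  then have "(cmod (coord x i))\<^sup>2 \<le> (norm x)\<^sup>2" by (simp add: norm_ell2_square)
  then show ?thesis by (rule power2_le_imp_le) simp
qed

lemma coord_diff: "coord (x - y) i = coord x i - coord y i"
  by (simp only: minus_ell2_def plus_ell2.rep_eq uminus_ell2.rep_eq) simp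

instance ell2 :: (type) complete_space
proof
  fix X :: "nat \<Rightarrow> 'a ell2"
  assume X: "Cauchy X"
  have "Cauchy (\<lambda>n. coord (X n) i)" for i
  proof (rule metric_CauchyI)
    fix e :: real assume "e > 0"
    then obtain M where M: "\<forall>m\<ge>M. \<forall>n\<ge>M. dist (X m) (X n) < e"
      using metric_CauchyD[OF X] by blast
    have le: "dist (coord (X m) i) (coord (X n) i) \<le> dist (X m) (X n)" for m n
      using cmod_coord_le[of "X m - X n" i] by (simp only: dist_norm coord_diff)
    have "\<forall>m\<ge>M. \<forall>n\<ge>M. dist (coord (X m) i) (coord (X n) i) < e"
      using M le_less_trans[OF le] by simp
    then show "\<exists>M. \<forall>m\<ge>M. \<forall>n\<ge>M. dist (coord (X m) i) (coord (X n) i) < e" by blast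
  qed
  then have "\<exists>l. (\<lambda>n. coord (X n) i) \<longlonglongrightarrow> l" for i
    by (simp add: Cauchy_convergent_iff convergent_def)
  then obtain f where f: "\<And>i. (\<lambda>n. coord (X n) i) \<longlonglongrightarrow> f i" by metis
  have fin: "\<exists>M. \<forall>n\<ge>M. \<forall>F. finite F \<longrightarrow> (\<Sum>i\<in>F. (cmod (f i - coord (X n) i))\<^sup>2) \<le> e\<^sup>2"
    if "e > 0" for e
  proof -
    obtain M where M: "\<And>m n. m \<ge> M \<Longrightarrow> n \<ge> M \<Longrightarrow> norm (X m - X n) < e"
      using metric_CauchyD[OF X \<open>e > 0\<close>] unfolding dist_norm by blast
    have "(\<Sum>i\<in>F. (cmod (f i - coord (X n) i))\<^sup>2) \<le> e\<^sup>2" if n: "n \<ge> M" and F: "finite F" for n F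
    proof (rule tendsto_upperbound)
      show "(\<lambda>m. \<Sum>i\<in>F. (cmod (coord (X m) i - coord (X n) i))\<^sup>2)
          \<longlonglongrightarrow> (\<Sum>i\<in>F. (cmod (f i - coord (X n) i))\<^sup>2)"
        by (intro tendsto_intros f)
      have "(\<Sum>i\<in>F. (cmod (coord (X m) i - coord (X n) i))\<^sup>2) \<le> e\<^sup>2" if "m \<ge> M" for m
      proof -
        have "(\<Sum>i\<in>F. (cmod (coord (X m - X n) i))\<^sup>2) \<le> (norm (X m - X n))\<^sup>2"
          unfolding norm_ell2_square
          by (rule finite_sum_le_infsum[OF coord_square_summable F]) auto
        also have "\<dots> \<le> e\<^sup>2" using M[OF that n] by (intro power_mono) auto
        finally show ?thesis by (simp add: coord_diff)
      qed
      then show "\<forall>\<^sub>F m in sequentially. (\<Sum>i\<in>F. (cmod (coord (X m) i - coord (X n) i))\<^sup>2) \<le> e\<^sup>2"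
        unfolding eventually_sequentially by blast
    qed simp
    then show ?thesis by blast
  qed
  have diff: "(\<lambda>i. (cmod (f i - coord (X n) i))\<^sup>2) summable_on UNIV"
    if "\<And>F. finite F \<Longrightarrow> (\<Sum>i\<in>F. (cmod (f i - coord (X n) i))\<^sup>2) \<le> C" for n C
    using that by (intro nonneg_bdd_above_summable_on bdd_aboveI2[where M=C]) auto
  obtain N where "\<And>F. finite F \<Longrightarrow> (\<Sum>i\<in>F. (cmod (f i - coord (X N) i))\<^sup>2) \<le> 1\<^sup>2"
    using fin[of 1] by auto
  then have "(\<lambda>i. (cmod ((f i - coord (X N) i) + coord (X N) i))\<^sup>2) summable_on UNIV"
    by (intro square_summable_add diff coord_square_summable)
  then have "f \<in> {f. (\<lambda>i. (cmod (f i))\<^sup>2) summable_on UNIV}" by simp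
  then obtain x where x: "\<And>i. coord x i = f i"
    using Abs_ell2_inverse[of f] that[of "Abs_ell2 f"] by simp
  have "X \<longlonglongrightarrow> x"
  proof (rule metric_LIMSEQ_I)
    fix e :: real assume e: "e > 0"
    then obtain M where M: "\<And>n F. n \<ge> M \<Longrightarrow> finite F \<Longrightarrow>
        (\<Sum>i\<in>F. (cmod (f i - coord (X n) i))\<^sup>2) \<le> (e / 2)\<^sup>2"
      using fin[of "e / 2"] by auto
    have "dist (X n) x < e" if "n \<ge> M" for n
    proof -
      have "(norm (x - X n))\<^sup>2 \<le> (e / 2)\<^sup>2"
        unfolding norm_ell2_square coord_diff x
        by (intro infsum_le_finite_sums diff[OF M[OF that]] M[OF that])
      then have "norm (x - X n) \<le> e / 2" by (rule power2_le_imp_le) (use e in simp)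
      then show ?thesis using e by (simp add: dist_norm norm_minus_commute)
    qed
    then show "\<exists>M. \<forall>n\<ge>M. dist (X n) x < e" by blast
  qed
  then show "convergent X" by (auto simp: convergent_def)
qed

lemma norm_cscale_ell2: "norm (cscale_ell2 c x) = cmod c * norm x"
proof -
  have "(norm (cscale_ell2 c x))\<^sup>2 = (cmod c * norm x)\<^sup>2"
    by (simp add: norm_ell2_square cscale_ell2.rep_eq norm_mult power_mult_distrib
        infsum_cmult_right')
  then show ?thesis by simp
qed

lift_definition ket :: "'i \<Rightarrow> 'i ell2" is "\<lambda>i j. if j = i then 1 else 0"
  by (rule finite_nonzero_values_imp_summable_on) auto


section \<open>Bounded operators\<close>

text \<open>
  \<open>\<Rightarrow>\<^sub>L\<close> contains all bounded real-linear maps, so complex linearity has to be required separately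
  (\<open>clinear_op\<close>), and the adjoint is taken with respect to the complex inner product.
\<close>

type_synonym 'i op = "'i ell2 \<Rightarrow>\<^sub>L 'i ell2"

definition clinear_op :: "'i op \<Rightarrow> bool" where
  "clinear_op T \<longleftrightarrow> (\<forall>c x. blinfun_apply T (cscale_ell2 c x) = cscale_ell2 c (blinfun_apply T x))"

lemma scaleR_cscale_commute: "cscale_ell2 c (r *\<^sub>R x) = r *\<^sub>R cscale_ell2 c x"
  unfolding scaleR_ell2_def by transfer (simp add: mult.left_commute)

lemma cscale_ell2_add: "cscale_ell2 c (x + y) = cscale_ell2 c x + cscale_ell2 c y"
  by transfer (simp add: distrib_left)

lift_definition scalar_op :: "complex \<Rightarrow> 'i op" is cscale_ell2
proof -
  show "bounded_linear (cscale_ell2 c :: 'i ell2 \<Rightarrow> 'i ell2)" for c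
    by (rule bounded_linear_intro[where K="cmod c"])
      (simp_all add: cscale_ell2_add scaleR_cscale_commute norm_cscale_ell2 mult.commute)
qed

definition cscale_op :: "complex \<Rightarrow> 'i op \<Rightarrow> 'i op" where
  "cscale_op c T = scalar_op c o\<^sub>L T"

definition adj_op :: "'i op \<Rightarrow> 'i op" where
  "adj_op T = (THE S. \<forall>x y. cinner (blinfun_apply S x) y = cinner x (blinfun_apply T y))"

lift_definition restrict_ell2 :: "'i set \<Rightarrow> 'i ell2 \<Rightarrow> 'i ell2" is
  "\<lambda>I f i. if i \<in> I then f i else 0"
proof -
  fix I and f :: "'i \<Rightarrow> complex"
  assume f: "(\<lambda>i. (cmod (f i))\<^sup>2) summable_on UNIV"
  show "(\<lambda>i. (cmod (if i \<in> I then f i else 0))\<^sup>2) summable_on UNIV"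
    by (rule summable_on_comparison_test[of "\<lambda>i. (cmod (f i))\<^sup>2"]) (use f in auto)
qed

lift_definition proj_op :: "'i set \<Rightarrow> 'i op" is restrict_ell2
proof -
  fix I :: "'i set"
  show "bounded_linear (restrict_ell2 I)"
  proof (rule bounded_linear_intro[where K=1])
    fix x y :: "'i ell2" and r :: real
    show "restrict_ell2 I (x + y) = restrict_ell2 I x + restrict_ell2 I y"
      by transfer auto
    show "restrict_ell2 I (r *\<^sub>R x) = r *\<^sub>R restrict_ell2 I x"
      unfolding scaleR_ell2_def by transfer auto
    have "(norm (restrict_ell2 I x))\<^sup>2 \<le> (norm x)\<^sup>2"
      unfolding norm_ell2_square
      by (intro infsum_mono coord_square_summable) (simp add: restrict_ell2.rep_eq)
    then show "norm (restrict_ell2 I x) \<le> norm x * 1" by simp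
  qed
qed

lift_definition matrix_unit :: "'i \<Rightarrow> 'i \<Rightarrow> 'i op" is "\<lambda>i j x. cscale_ell2 (coord x j) (ket i)"
proof -
  fix i j :: 'i
  show "bounded_linear (\<lambda>x. cscale_ell2 (coord x j) (ket i))"
  proof (rule bounded_linear_intro[where K="norm (ket i)"])
    fix x y :: "'i ell2" and r :: real
    show "cscale_ell2 (coord (x + y) j) (ket i) = cscale_ell2 (coord x j) (ket i) + cscale_ell2 (coord y j) (ket i)"
      by transfer (auto simp: distrib_right)
    show "cscale_ell2 (coord (r *\<^sub>R x) j) (ket i) = r *\<^sub>R cscale_ell2 (coord x j) (ket i)"
      unfolding scaleR_ell2_def by transfer auto
    show "norm (cscale_ell2 (coord x j) (ket i)) \<le> norm x * norm (ket i)"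
      by (simp add: norm_cscale_ell2 mult_right_mono cmod_coord_le)
  qed
qed

lemma matrix_unit_ket: "blinfun_apply (matrix_unit i j) (ket k) = (if j = k then ket i else 0)"
  by (simp add: matrix_unit.rep_eq) (transfer, auto)

lemma shift_has_sum:
  fixes g :: "nat \<Rightarrow> 'a :: {comm_monoid_add, t2_space}"
  shows "((\<lambda>k. case k of 0 \<Rightarrow> 0 | Suc j \<Rightarrow> g j) has_sum s) UNIV \<longleftrightarrow> (g has_sum s) UNIV"
proof -
  have "((\<lambda>k. case k of 0 \<Rightarrow> 0 | Suc j \<Rightarrow> g j) has_sum s) UNIV
      \<longleftrightarrow> ((\<lambda>k. case k of 0 \<Rightarrow> 0 | Suc j \<Rightarrow> g j) has_sum s) (range Suc)"
    by (rule has_sum_cong_neutral) (auto split: nat.splits)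
  also have "\<dots> \<longleftrightarrow> (g has_sum s) UNIV"
    by (subst has_sum_reindex) (auto simp: o_def)
  finally show ?thesis .
qed

lift_definition shift_ell2 :: "nat ell2 \<Rightarrow> nat ell2" is
  "\<lambda>f k. case k of 0 \<Rightarrow> 0 | Suc j \<Rightarrow> f j"
proof -
  fix f :: "nat \<Rightarrow> complex"
  have "(cmod (case k of 0 \<Rightarrow> 0 | Suc j \<Rightarrow> f j))\<^sup>2 = (case k of 0 \<Rightarrow> 0 | Suc j \<Rightarrow> (cmod (f j))\<^sup>2)" for k
    by (simp split: nat.splits)
  then show "(\<lambda>j. (cmod (f j))\<^sup>2) summable_on UNIV \<Longrightarrow>
    (\<lambda>k. (cmod (case k of 0 \<Rightarrow> 0 | Suc j \<Rightarrow> f j))\<^sup>2) summable_on UNIV"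
    by (auto simp: summable_on_def shift_has_sum[where g="\<lambda>j. (cmod (f j))\<^sup>2"])
qed

lemma norm_shift_ell2: "norm (shift_ell2 x) = norm x"
proof -
  have "(cmod (coord (shift_ell2 x) k))\<^sup>2 = (case k of 0 \<Rightarrow> 0 | Suc j \<Rightarrow> (cmod (coord x j))\<^sup>2)" for k
    by (simp add: shift_ell2.rep_eq split: nat.splits)
  moreover have "((\<lambda>j. (cmod (coord x j))\<^sup>2) has_sum (norm x)\<^sup>2) UNIV"
    unfolding norm_ell2_square by (rule has_sum_infsum[OF coord_square_summable])
  ultimately have "((\<lambda>k. (cmod (coord (shift_ell2 x) k))\<^sup>2) has_sum (norm x)\<^sup>2) UNIV"
    by (simp add: shift_has_sum)
  then have "(norm (shift_ell2 x))\<^sup>2 = (norm x)\<^sup>2"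
    unfolding norm_ell2_square[of "shift_ell2 x"] by (rule infsumI)
  then show ?thesis by simp
qed

lift_definition unilateral_shift :: "nat op" is shift_ell2
proof (rule bounded_linear_intro[where K=1])
  fix x y :: "nat ell2" and r :: real
  show "shift_ell2 (x + y) = shift_ell2 x + shift_ell2 y"
    by transfer (auto split: nat.splits)
  show "shift_ell2 (r *\<^sub>R x) = r *\<^sub>R shift_ell2 x"
    unfolding scaleR_ell2_def by transfer (auto split: nat.splits)
  show "norm (shift_ell2 x) \<le> norm x * 1" by (simp add: norm_shift_ell2)
qed

lemma unilateral_shift_ket: "blinfun_apply unilateral_shift (ket j) = ket (Suc j)"
  by (simp add: unilateral_shift.rep_eq) (transfer, auto split: nat.splits)

text \<open>
  We identify \<open>\<ell>\<^sup>2(\<nat>\<^sup>n) \<otimes> \<ell>\<^sup>2(\<nat>)\<close> with \<open>\<ell>\<^sup>2(\<nat>\<^sup>n\<^sup>+\<^sup>1)\<close>, where \<open>\<nat>\<^sup>n\<close> is the set of lists of length \<open>n\<close>, by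
  \<open>\<xi>\<^bsub>xs\<^esub> \<otimes> \<xi>\<^bsub>k\<^esub> = \<xi>\<^bsub>k # xs\<^esub>\<close>. Doing this on all of \<open>\<ell>\<^sup>2\<close> of the set of lists keeps the iterated tensor
  products in a single type; the vectors \<open>x \<otimes> y\<close> then span the orthogonal complement of \<open>\<xi>\<^bsub>[]\<^esub>\<close>,
  and \<open>a \<otimes> b\<close> is extended by zero to \<open>\<xi>\<^bsub>[]\<^esub>\<close>.
\<close>

lift_definition tensor_ell2 :: "nat list ell2 \<Rightarrow> nat ell2 \<Rightarrow> nat list ell2" is
  "\<lambda>f g ys. case ys of [] \<Rightarrow> 0 | k # xs \<Rightarrow> f xs * g k"
proof -
  fix f :: "nat list \<Rightarrow> complex" and g :: "nat \<Rightarrow> complex"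
  assume f: "(\<lambda>i. (cmod (f i))\<^sup>2) summable_on UNIV"
    and g: "(\<lambda>i. (cmod (g i))\<^sup>2) summable_on UNIV"
  let ?h = "\<lambda>ys. (cmod (case ys of [] \<Rightarrow> 0 | k # xs \<Rightarrow> f xs * g k))\<^sup>2"
  let ?c = "\<lambda>(k :: nat, xs). k # xs"
  have "(\<lambda>(k, xs). (cmod (g k))\<^sup>2 * (cmod (f xs))\<^sup>2) summable_on (UNIV \<times> UNIV)"
  proof (rule summable_on_SigmaI)
    show "((\<lambda>xs. case (k, xs) of (k, xs) \<Rightarrow> (cmod (g k))\<^sup>2 * (cmod (f xs))\<^sup>2) has_sum
        ((cmod (g k))\<^sup>2 * (\<Sum>\<^sub>\<infinity>xs. (cmod (f xs))\<^sup>2))) UNIV" for k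
      unfolding prod.case using f by (intro has_sum_cmult_right has_sum_infsum) simp
    show "(\<lambda>k. (cmod (g k))\<^sup>2 * (\<Sum>\<^sub>\<infinity>xs. (cmod (f xs))\<^sup>2)) summable_on UNIV"
      using g by (intro summable_on_cmult_left) simp
  qed auto
  then have "(?h \<circ> ?c) summable_on UNIV"
    by (simp add: o_def split_def norm_mult power_mult_distrib mult.commute)
  moreover have "inj ?c" by (auto intro: injI)
  ultimately have "?h summable_on range ?c" by (simp add: summable_on_reindex)
  also have "?h summable_on range ?c \<longleftrightarrow> ?h summable_on UNIV"
    by (rule summable_on_cong_neutral) (auto simp: image_iff split: list.splits)
  finally show "?h summable_on UNIV" .
qed

lemma tensor_ell2_ket: "tensor_ell2 (ket xs) (ket k) = ket (k # xs)"
  by transfer (auto split: list.splits)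

definition tensor_op :: "nat list op \<Rightarrow> nat op \<Rightarrow> nat list op" where
  "tensor_op a b = (THE T. clinear_op T \<and> blinfun_apply T (ket []) = 0 \<and>
     (\<forall>x y. blinfun_apply T (tensor_ell2 x y) = tensor_ell2 (blinfun_apply a x) (blinfun_apply b y)))"


section \<open>C*-algebras\<close>

record 'a cstar_alg = "'a ring" +
  cscale :: "complex \<Rightarrow> 'a \<Rightarrow> 'a"
  star :: "'a \<Rightarrow> 'a"
  cnorm :: "'a \<Rightarrow> real"

definition cstar_isomorphic :: "'a cstar_alg \<Rightarrow> 'b cstar_alg \<Rightarrow> bool" where
  "cstar_isomorphic A B \<longleftrightarrow> (\<exists>h \<in> ring_iso A B.
     (\<forall>c. \<forall>x\<in>carrier A. h (cscale A c x) = cscale B c (h x)) \<and>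
     (\<forall>x\<in>carrier A. h (star A x) = star B (h x)))"

text \<open>A C*-subalgebra need not contain the unit.\<close>

definition cstar_subalgebra :: "'a set \<Rightarrow> 'a cstar_alg \<Rightarrow> bool" where
  "cstar_subalgebra B A \<longleftrightarrow> B \<subseteq> carrier A \<and> \<zero>\<^bsub>A\<^esub> \<in> B \<and>
     (\<forall>x\<in>B. \<forall>y\<in>B. x \<oplus>\<^bsub>A\<^esub> y \<in> B \<and> x \<otimes>\<^bsub>A\<^esub> y \<in> B) \<and>
     (\<forall>c. \<forall>x\<in>B. cscale A c x \<in> B) \<and> (\<forall>x\<in>B. star A x \<in> B) \<and>
     (\<forall>x\<in>carrier A. (\<forall>e>0. \<exists>y\<in>B. cnorm A (x \<ominus>\<^bsub>A\<^esub> y) < e) \<longrightarrow> x \<in> B)"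

definition cstar_generated :: "'a cstar_alg \<Rightarrow> 'a set \<Rightarrow> 'a set" where
  "cstar_generated A S = \<Inter>{B. cstar_subalgebra B A \<and> S \<subseteq> B}"

text \<open>
  The algebra of bounded operators on \<open>\<ell>\<^sup>2(I)\<close>, as the operators on \<open>\<ell>\<^sup>2\<close> of the whole type that map
  \<open>\<ell>\<^sup>2(I)\<close> to itself and vanish on its orthogonal complement. Its unit is the projection onto \<open>\<ell>\<^sup>2(I)\<close>.
\<close>

definition bounded_operators :: "'i set \<Rightarrow> 'i op cstar_alg" where
  "bounded_operators I =
     \<lparr>carrier = {T. clinear_op T \<and> proj_op I o\<^sub>L T = T \<and> T o\<^sub>L proj_op I = T},
      mult = (o\<^sub>L), one = proj_op I, zero = 0, add = (+),
      cscale = cscale_op, star = adj_op, cnorm = norm\<rparr>"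

definition cstar_product :: "'r set \<Rightarrow> ('r \<Rightarrow> 'a cstar_alg) \<Rightarrow> ('r \<Rightarrow> 'a) cstar_alg" where
  "cstar_product R F =
     \<lparr>carrier = {f \<in> \<Pi>\<^sub>E r\<in>R. carrier (F r). bdd_above ((\<lambda>r. cnorm (F r) (f r)) ` R)},
      mult = (\<lambda>f g. \<lambda>r\<in>R. f r \<otimes>\<^bsub>F r\<^esub> g r), one = (\<lambda>r\<in>R. \<one>\<^bsub>F r\<^esub>),
      zero = (\<lambda>r\<in>R. \<zero>\<^bsub>F r\<^esub>), add = (\<lambda>f g. \<lambda>r\<in>R. f r \<oplus>\<^bsub>F r\<^esub> g r),
      cscale = (\<lambda>c f. \<lambda>r\<in>R. cscale (F r) c (f r)), star = (\<lambda>f. \<lambda>r\<in>R. star (F r) (f r)),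
      cnorm = (\<lambda>f. SUP r\<in>R. cnorm (F r) (f r))\<rparr>"


section \<open>Universal C*-algebras\<close>

text \<open>
  \<open>rels A z\<close> says that the elements \<open>z 1, \<dots>, z n\<close> of the unital *-algebra \<open>A\<close> satisfy the defining
  relations. The representations are taken on the Hilbert spaces \<open>\<ell>\<^sup>2(I)\<close>, \<open>I \<subseteq> UNIV :: 'i set\<close>, which up
  to unitary equivalence are all Hilbert spaces of dimension at most the cardinality of \<open>'i\<close>. As
  finitely generated C*-algebras are separable, any infinite \<open>'i\<close> yields the same universal algebra.
\<close>

definition representations ::
  "'i itself \<Rightarrow> nat \<Rightarrow> ('i op cstar_alg \<Rightarrow> (nat \<Rightarrow> 'i op) \<Rightarrow> bool) \<Rightarrow> ('i set \<times> (nat \<Rightarrow> 'i op)) set"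
  where
  "representations _ n rels = {(I, T).
     T \<in> (\<Pi>\<^sub>E i\<in>{1..n}. carrier (bounded_operators I)) \<and> rels (bounded_operators I) T}"

text \<open>
  The universal unital C*-algebra is generated by the universal family of generators in the product
  of the \<open>B(\<ell>\<^sup>2(I))\<close> over all representations \<open>(I, T)\<close>; its norm is thus the supremum over all
  representations, and the representation with \<open>z\<^sub>i \<mapsto> T i\<close> is the evaluation at \<open>(I, T)\<close>. As usual, this
  requires the relations to bound the norms of the generators.
\<close>

definition universal_generator ::
  "'i itself \<Rightarrow> nat \<Rightarrow> ('i op cstar_alg \<Rightarrow> (nat \<Rightarrow> 'i op) \<Rightarrow> bool) \<Rightarrow>
    nat \<Rightarrow> ('i set \<times> (nat \<Rightarrow> 'i op)) \<Rightarrow> 'i op" where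
  "universal_generator ty n rels i = (\<lambda>(I, T)\<in>representations ty n rels. T i)"

definition universal_cstar_alg ::
  "'i itself \<Rightarrow> nat \<Rightarrow> ('i op cstar_alg \<Rightarrow> (nat \<Rightarrow> 'i op) \<Rightarrow> bool) \<Rightarrow>
    ('i set \<times> (nat \<Rightarrow> 'i op) \<Rightarrow> 'i op) cstar_alg" where
  "universal_cstar_alg ty n rels =
    (let P = cstar_product (representations ty n rels) (\<lambda>(I, T). bounded_operators I)
     in P\<lparr>carrier := cstar_generated P (insert \<one>\<^bsub>P\<^esub> (universal_generator ty n rels ` {1..n}))\<rparr>)"


section \<open>Noncommutative balls\<close>

text \<open>
  The quantum double suspension of a unital C*-algebra \<open>A\<close> of operators (with unit a projection
  \<open>\<one>\<^bsub>A\<^esub>\<close>), by means of the spatial tensor product. The generated algebra contains its unit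
  \<open>1 \<otimes> 1 = (1 \<otimes> V)\<^sup>*(1 \<otimes> V)\<close>.
\<close>

definition quantum_double_suspension :: "nat list op cstar_alg \<Rightarrow> nat list op cstar_alg" where
  "quantum_double_suspension A = A
     \<lparr>carrier := cstar_generated (bounded_operators UNIV)
        (insert (tensor_op \<one>\<^bsub>A\<^esub> unilateral_shift) ((\<lambda>a. tensor_op a (matrix_unit 0 0)) ` carrier A)),
      one := tensor_op \<one>\<^bsub>A\<^esub> id_blinfun\<rparr>"

text \<open>
  The algebra of the ball of dimension \<open>2n\<close>, acting on \<open>\<ell>\<^sup>2\<close> of the lists of length \<open>n\<close>. The construction
  does not involve \<open>q\<close>.
\<close>

primrec quantum_ball :: "nat \<Rightarrow> nat list op cstar_alg" where
  "quantum_ball 0 = (bounded_operators {[]})\<lparr>carrier := range (\<lambda>c. cscale_op c (proj_op {[]}))\<rparr>"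
| "quantum_ball (Suc n) = quantum_double_suspension (quantum_ball n)"

definition ball_relations :: "real \<Rightarrow> nat \<Rightarrow> 'a cstar_alg \<Rightarrow> (nat \<Rightarrow> 'a) \<Rightarrow> bool" where
  "ball_relations q n A z \<longleftrightarrow>
     (\<forall>i\<in>{1..n}. \<forall>j\<in>{1..n}. i < j \<longrightarrow>
        z i \<otimes>\<^bsub>A\<^esub> z j = cscale A (complex_of_real (q powr (1/2))) (z j \<otimes>\<^bsub>A\<^esub> z i)) \<and>
     (\<forall>i\<in>{1..n}. \<forall>j\<in>{1..n}. i < j \<longrightarrow>
        z i \<otimes>\<^bsub>A\<^esub> star A (z j) = cscale A (complex_of_real (q powr (- 1/2))) (star A (z j) \<otimes>\<^bsub>A\<^esub> z i)) \<and>
     (\<forall>i\<in>{1..n}.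
        star A (z i) \<otimes>\<^bsub>A\<^esub> z i \<ominus>\<^bsub>A\<^esub> cscale A (complex_of_real q) (z i \<otimes>\<^bsub>A\<^esub> star A (z i)) =
        cscale A (complex_of_real (1 - q)) (\<one>\<^bsub>A\<^esub> \<ominus>\<^bsub>A\<^esub> (\<Oplus>\<^bsub>A\<^esub>j\<in>{i+1..n}. z j \<otimes>\<^bsub>A\<^esub> star A (z j))))"

end

theory Submission
  imports Defs
begin

text \<open>
  The idea. The algebra of the ball is realised on \<open>\<ell>\<^sup>2(\<nat>\<^sup>n)\<close>. There the relations have a canonical
  solution by weighted shifts (\<open>model\<close>): the last generator is \<open>1 \<otimes> W\<close> with
  \<open>W \<xi>\<^sub>k = (1 - q\<^bsup>k+1\<^esup>)\<^bsup>1/2\<^esup> \<xi>\<^bsub>k+1\<^esub>\<close>, and the others are the generators of the smaller ball tensored with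
  the diagonal operator \<open>q\<^bsup>k/2\<^esup>\<close>. Two facts give the theorem.

  First, the model generates the algebra of the ball (\<open>quantum_ball_model\<close>). The diagonal operator \<open>q\<^sup>k\<close>
  is \<open>1 - W W\<^sup>*\<close>, its powers converge to \<open>E\<^sub>0\<^sub>0\<close>, and \<open>W\<close> differs from the unilateral shift by a norm
  convergent series of rank one operators; so each of the two generating sets lies in the algebra
  generated by the other.

  Second, the model has the largest norm: \<open>\<parallel>p(T)\<parallel> \<le> \<parallel>p(Z)\<parallel>\<close> for every *-polynomial \<open>p\<close> and every family
  \<open>T\<close> that satisfies the relations (\<open>model_dominates\<close>). As \<open>\<ell>\<^sup>2(\<nat>\<^sup>n)\<close> embeds into \<open>\<ell>\<^sup>2\<close> of any infinite
  type, the model is one of the representations defining the universal norm, so that this norm is the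
  norm of the model. An isometry between dense subalgebras then extends to the isomorphism
  (\<open>universal_algebra_isomorphic\<close>).

  The norm estimate is a Coburn type theorem. It rests on Poisson kernels: isometries \<open>J\<close> of the
  representation space into \<open>\<ell>\<^sup>2(\<nat>\<^sup>n) \<otimes> H\<close> for which \<open>Z\<^sub>i\<^sup>* J - J T\<^sub>i\<^sup>*\<close> is arbitrarily small
  (\<open>poisson_exists\<close>). The relations express \<open>T\<^sub>i\<^sup>* T\<^sub>i\<close> through the \<open>T\<^sub>j T\<^sub>j\<^sup>*\<close>, and therefore
  \<open>Z\<^sub>i J - J T\<^sub>i\<close> is small too (\<open>hereditary_intertwining\<close>); hence so is \<open>p(Z) J - J p(T)\<close>.

  Poisson kernels are built by induction on \<open>n\<close>. The last generator \<open>T\<close> satisfies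
  \<open>T\<^sup>* T - q T T\<^sup>* = 1 - q\<close>, and its Wold decomposition splits the space into copies of the weighted shift,
  spanned by the \<open>T\<^sup>k\<close>-images of the kernel of \<open>T\<^sup>*\<close>, and a part on which \<open>T\<close> is unitary. The remaining
  generators restrict to a representation of the smaller ball on the kernel of \<open>T\<^sup>*\<close>, which has a kernel
  by induction. They vanish on the unitary part, because there \<open>\<parallel>T\<^sub>i y\<parallel>\<^sup>2 \<le> q \<parallel>T\<^sub>i\<^sup>* y\<parallel>\<^sup>2\<close>; and a unitary \<open>U\<close>
  is approximated by the shift along the isometries
  \<open>y \<mapsto> \<Sum>\<^sub>k r\<^sup>k (1 - r\<^sup>2)\<^bsup>1/2\<^esup> \<xi>\<^sub>k \<otimes> U\<^sup>*\<^sup>k y\<close> as \<open>r\<close> tends to \<open>1\<close>, since these spread over large \<open>k\<close>, where the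
  weights of \<open>W\<close> are close to \<open>1\<close>.
\<close>
section \<open>Operators on square-summable families\<close>

lemmas coord_simps = plus_ell2.rep_eq coord_diff uminus_ell2.rep_eq zero_ell2.rep_eq
  cscale_ell2.rep_eq restrict_ell2.rep_eq ket.rep_eq

lemma coord_scaleR: "coord (r *\<^sub>R x) i = complex_of_real r * coord x i"
  by (simp add: scaleR_ell2_def cscale_ell2.rep_eq)

lemma coord_sum: "coord (sum f A) i = (\<Sum>a\<in>A. coord (f a) i)"
  by (induction A rule: infinite_finite_induct) (auto simp: coord_simps)

lemma ell2_exists:
  assumes "(\<lambda>i. (cmod (f i))\<^sup>2) summable_on UNIV"
  obtains x where "\<And>i. coord x i = f i"
  using Abs_ell2_inverse[of f] assms that[of "Abs_ell2 f"] by simp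

lemma cscale_of_real: "cscale_ell2 (complex_of_real r) x = r *\<^sub>R x"
  by (simp add: scaleR_ell2_def)

lemma cinner_ket_left: "cinner (ket i) x = coord x i"
proof -
  have "cinner (ket i) x = (\<Sum>\<^sub>\<infinity>j\<in>{i}. cnj (coord (ket i) j) * coord x j)"
    unfolding cinner_def by (rule infsum_cong_neutral) (auto simp: ket.rep_eq)
  then show ?thesis by (simp add: ket.rep_eq)
qed

lemma cinner_commute: "cinner y x = cnj (cinner x y)"
  unfolding cinner_def by (simp add: infsum_cnj[symmetric] mult.commute)

lemma cinner_ket_right: "cinner x (ket i) = cnj (coord x i)"
  by (subst cinner_commute) (simp add: cinner_ket_left)

lemma cinner_cscale_right: "cinner x (cscale_ell2 c y) = c * cinner x y"
  unfolding cinner_def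
  by (simp add: cscale_ell2.rep_eq infsum_cmult_right'[symmetric] mult.left_commute)

lemma cinner_cscale_left: "cinner (cscale_ell2 c x) y = cnj c * cinner x y"
  by (subst cinner_commute) (simp add: cinner_cscale_right, subst cinner_commute, simp)

lemma cinner_eq_inner: "cinner x y = Complex (inner x y) (inner (cscale_ell2 \<i> x) y)"
  by (simp add: complex_eq_iff inner_ell2_def cinner_cscale_left)

text \<open>Complex-linearity recovers the imaginary part, so that adjoints can be verified with the real inner product.\<close>

lemma cinner_adjointI:
  assumes "\<And>x y. inner (S x) y = inner x (T y)" and "\<And>x. S (cscale_ell2 \<i> x) = cscale_ell2 \<i> (S x)"
  shows "cinner (S x) y = cinner x (T y)"
  unfolding cinner_eq_inner using assms by metis

lemma restrict_tendsto:
  assumes "e > 0"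
  obtains F where "finite F" "norm (x - restrict_ell2 F x) < e"
proof -
  have hs: "((\<lambda>i. (cmod (coord x i))\<^sup>2) has_sum (norm x)\<^sup>2) UNIV"
    unfolding norm_ell2_square by (rule has_sum_infsum[OF coord_square_summable])
  then have "((\<lambda>F. \<Sum>i\<in>F. (cmod (coord x i))\<^sup>2) \<longlongrightarrow> (norm x)\<^sup>2) (finite_subsets_at_top UNIV)"
    by (simp add: has_sum_def)
  then have "\<forall>\<^sub>F F in finite_subsets_at_top UNIV. dist (\<Sum>i\<in>F. (cmod (coord x i))\<^sup>2) ((norm x)\<^sup>2) < e\<^sup>2"
    using assms by (intro tendstoD) auto
  then obtain F where F: "finite F" "dist (\<Sum>i\<in>F. (cmod (coord x i))\<^sup>2) ((norm x)\<^sup>2) < e\<^sup>2"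
    unfolding eventually_finite_subsets_at_top by auto
  have "(norm (x - restrict_ell2 F x))\<^sup>2 = (\<Sum>\<^sub>\<infinity>i. (cmod (coord (x - restrict_ell2 F x) i))\<^sup>2)"
    by (rule norm_ell2_square)
  also have "\<dots> = (\<Sum>\<^sub>\<infinity>i\<in>UNIV - F. (cmod (coord x i))\<^sup>2)"
    by (rule infsum_cong_neutral) (auto simp: coord_simps)
  also have "\<dots> = (norm x)\<^sup>2 - (\<Sum>i\<in>F. (cmod (coord x i))\<^sup>2)"
    using has_sum_Diff[OF hs has_sum_finite[OF F(1)]] by (auto intro: infsumI)
  also have "\<dots> < e\<^sup>2" using F(2) by (simp add: dist_real_def)
  finally have "norm (x - restrict_ell2 F x) < e"
    using assms by (simp add: power_less_imp_less_base)
  then show ?thesis using F(1) that by blast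
qed

lemma restrict_finite: "finite F \<Longrightarrow> restrict_ell2 F x = (\<Sum>i\<in>F. cscale_ell2 (coord x i) (ket i))"
  by (rule ell2_eqI)
    (simp add: coord_simps coord_sum if_distrib[of "\<lambda>t. _ * t"] sum.delta cong: if_cong)

text \<open>Vectors of finite support are dense, so that a bounded map is determined on multiples of the basis.\<close>
lemma bounded_linear_eqI:
  fixes f g :: "'i ell2 \<Rightarrow> 'b :: real_normed_vector"
  assumes f: "bounded_linear f" and g: "bounded_linear g"
    and eq: "\<And>c i. f (cscale_ell2 c (ket i)) = g (cscale_ell2 c (ket i))"
  shows "f x = g x"
proof -
  interpret h: bounded_linear "\<lambda>x. f x - g x" by (rule bounded_linear_sub[OF f g])
  obtain K where K: "K > 0" "\<And>x. norm (f x - g x) \<le> norm x * K"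
    using h.pos_bounded by blast
  have "norm (f x - g x) \<le> e" if "e > 0" for e
  proof -
    obtain F where F: "finite F" "norm (x - restrict_ell2 F x) < e / K"
      using restrict_tendsto[of "e / K" x] K(1) \<open>e > 0\<close> by (metis divide_pos_pos)
    have "f (restrict_ell2 F x) - g (restrict_ell2 F x) = 0"
      unfolding restrict_finite[OF F(1)] by (simp add: h.sum eq)
    then have "f x - g x = f (x - restrict_ell2 F x) - g (x - restrict_ell2 F x)"
      using h.diff[of x "restrict_ell2 F x"] by simp
    also have "norm \<dots> \<le> norm (x - restrict_ell2 F x) * K" by (rule K)
    also have "\<dots> \<le> e" using F(2) K by (simp add: field_simps)
    finally show ?thesis .
  qed
  then have "norm (f x - g x) \<le> 0" by (rule field_le_epsilon[of _ 0, simplified])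
  then show ?thesis by simp
qed

subsection \<open>Complex-linear operators and adjoints\<close>

lemma clinear_opD: "clinear_op T \<Longrightarrow> blinfun_apply T (cscale_ell2 c x) = cscale_ell2 c (blinfun_apply T x)"
  by (simp add: clinear_op_def)

lemma cscale_zero: "cscale_ell2 c 0 = 0"
  by (rule ell2_eqI) (simp add: coord_simps)

lemma cscale_minus: "cscale_ell2 c (- x) = - cscale_ell2 c x"
  by (rule ell2_eqI) (simp add: coord_simps)

lemma cscale_diff: "cscale_ell2 c (x - y) = cscale_ell2 c x - cscale_ell2 c y"
  by (rule ell2_eqI) (simp add: coord_simps algebra_simps)

lemma cscale_cscale: "cscale_ell2 c (cscale_ell2 d x) = cscale_ell2 (c * d) x"
  by (rule ell2_eqI) (simp add: coord_simps)

lemma clinear_compose [simp, intro]: "clinear_op S \<Longrightarrow> clinear_op T \<Longrightarrow> clinear_op (S o\<^sub>L T)"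
  by (simp add: clinear_op_def)

lemma clinear_plus [simp, intro]: "clinear_op S \<Longrightarrow> clinear_op T \<Longrightarrow> clinear_op (S + T)"
  by (simp add: clinear_op_def plus_blinfun.rep_eq cscale_ell2_add)

lemma clinear_uminus [simp, intro]: "clinear_op S \<Longrightarrow> clinear_op (- S)"
  by (simp add: clinear_op_def uminus_blinfun.rep_eq cscale_minus)

lemma clinear_minus [simp, intro]: "clinear_op S \<Longrightarrow> clinear_op T \<Longrightarrow> clinear_op (S - T)"
  by (simp add: clinear_op_def minus_blinfun.rep_eq cscale_diff)

lemma clinear_zero [simp, intro]: "clinear_op 0"
  by (simp add: clinear_op_def cscale_zero)

lemma clinear_sum [intro]: "(\<And>a. a \<in> A \<Longrightarrow> clinear_op (f a)) \<Longrightarrow> clinear_op (sum f A)"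
  by (induction A rule: infinite_finite_induct) auto

lemma clinear_scaleR [simp, intro]: "clinear_op S \<Longrightarrow> clinear_op (r *\<^sub>R S)"
  by (simp add: clinear_op_def scaleR_blinfun.rep_eq scaleR_cscale_commute)

lemma clinear_scalar [simp, intro]: "clinear_op (scalar_op c)"
  by (simp add: clinear_op_def scalar_op.rep_eq cscale_cscale mult.commute)

lemma clinear_cscale [simp, intro]: "clinear_op S \<Longrightarrow> clinear_op (cscale_op c S)"
  by (simp add: cscale_op_def)

lemma clinear_id [simp, intro]: "clinear_op id_blinfun"
  by (simp add: clinear_op_def)

lemma clinear_proj [simp, intro]: "clinear_op (proj_op I)"
  by (auto simp: clinear_op_def proj_op.rep_eq coord_simps intro!: ell2_eqI)

lemma cscale_op_of_real: "cscale_op (complex_of_real r) T = r *\<^sub>R T"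
  by (rule blinfun_eqI)
    (simp add: cscale_op_def scalar_op.rep_eq scaleR_blinfun.rep_eq cscale_of_real)

lemma cscale_op_apply: "blinfun_apply (cscale_op c T) x = cscale_ell2 c (blinfun_apply T x)"
  by (simp add: cscale_op_def scalar_op.rep_eq)

lemma clinear_compose_cscale_right: "clinear_op S \<Longrightarrow> S o\<^sub>L cscale_op c T = cscale_op c (S o\<^sub>L T)"
  by (rule blinfun_eqI) (simp add: cscale_op_apply clinear_opD)

lemma compose_cscale_left: "cscale_op c S o\<^sub>L T = cscale_op c (S o\<^sub>L T)"
  by (rule blinfun_eqI) (simp add: cscale_op_apply)

lemma norm_cscale_op: "norm (cscale_op c T) \<le> cmod c * norm T"
  by (rule norm_blinfun_bound)
    (simp_all add: cscale_op_apply norm_cscale_ell2 mult_left_mono norm_blinfun mult.assoc)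

lemma clinear_op_eqI:
  assumes "clinear_op S" "clinear_op T" "\<And>i. blinfun_apply S (ket i) = blinfun_apply T (ket i)"
  shows "S = T"
proof (rule blinfun_eqI)
  show "blinfun_apply S x = blinfun_apply T x" for x
    by (rule bounded_linear_eqI)
      (auto intro: blinfun.bounded_linear_right simp: assms clinear_opD)
qed

lemma closed_clinear: "closed {T. clinear_op T}"
proof -
  have "{T :: 'i op. clinear_op T} =
      (\<Inter>c. \<Inter>x. {T. blinfun_apply T (cscale_ell2 c x) = blinfun_apply (scalar_op c) (blinfun_apply T x)})"
    by (auto simp: clinear_op_def scalar_op.rep_eq)
  also have "closed \<dots>"
    by (intro closed_INT ballI closed_Collect_eq continuous_intros)
  finally show ?thesis .
qed

text \<open>
  The coordinates of \<open>S x\<close> are forced to be \<open>\<langle>T \<xi>\<^sub>i, x\<rangle>\<close>. They are square-summable: if \<open>v\<close> is the vector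
  with these coordinates cut off to a finite set, then \<open>\<parallel>v\<parallel>\<^sup>2 = \<langle>T v, x\<rangle> \<le> \<parallel>T\<parallel> \<parallel>v\<parallel> \<parallel>x\<parallel>\<close>.
\<close>
lemma adjoint_exists:
  assumes T: "clinear_op T"
  obtains S where "\<And>x i. coord (blinfun_apply S x) i = cinner (blinfun_apply T (ket i)) x"
    "\<And>x y. cinner (blinfun_apply S x) y = cinner x (blinfun_apply T y)"
proof -
  let ?a = "\<lambda>x i. cinner (blinfun_apply T (ket i)) x"
  have fin: "(\<Sum>i\<in>F. (cmod (?a x i))\<^sup>2) \<le> (norm T * norm x)\<^sup>2" if F: "finite F" for x F
  proof -
    define v where "v = (\<Sum>i\<in>F. cscale_ell2 (?a x i) (ket i))"
    define s where "s = (\<Sum>i\<in>F. (cmod (?a x i))\<^sup>2)"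
    have coord_v: "coord v i = (if i \<in> F then ?a x i else 0)" for i
      using F by (simp add: v_def coord_sum coord_simps if_distrib[of "\<lambda>t. _ * t"] sum.delta cong: if_cong)
    have "(norm v)\<^sup>2 = (\<Sum>\<^sub>\<infinity>i\<in>F. (cmod (?a x i))\<^sup>2)"
      unfolding norm_ell2_square by (rule infsum_cong_neutral) (auto simp: coord_v)
    then have nv: "(norm v)\<^sup>2 = s" using F by (simp add: s_def)
    have "blinfun_apply T v = (\<Sum>i\<in>F. cscale_ell2 (?a x i) (blinfun_apply T (ket i)))"
      by (simp add: v_def blinfun.sum_right clinear_opD[OF T])
    then have "inner (blinfun_apply T v) x = (\<Sum>i\<in>F. inner (cscale_ell2 (?a x i) (blinfun_apply T (ket i))) x)"
      by (simp add: inner_sum_left)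
    also have "\<dots> = s"
      by (simp add: s_def inner_ell2_def cinner_cscale_left cmod_power2) (simp add: power2_eq_square)
    finally have "s \<le> norm (blinfun_apply T v) * norm x" by (metis norm_cauchy_schwarz)
    also have "\<dots> \<le> (norm T * norm v) * norm x" by (intro mult_right_mono norm_blinfun) simp
    finally have "norm v * norm v \<le> norm v * (norm T * norm x)"
      using nv by (simp add: power2_eq_square mult_ac)
    then have "norm v \<le> norm T * norm x" by (cases "norm v = 0") auto
    then show ?thesis using nv by (metis norm_ge_zero power_mono s_def)
  qed
  have "(\<lambda>i. (cmod (?a x i))\<^sup>2) summable_on UNIV" for x
    using fin by (intro nonneg_bdd_above_summable_on bdd_aboveI2[where M="(norm T * norm x)\<^sup>2"]) auto
  then have "\<forall>x. \<exists>y. \<forall>i. coord y i = ?a x i" using ell2_exists by metis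
  then obtain S where S: "\<And>x i. coord (S x) i = ?a x i" by metis
  have "bounded_linear S"
  proof (rule bounded_linear_intro[where K="norm T"])
    show "S (x + y) = S x + S y" for x y
      by (rule ell2_eqI) (simp add: S coord_simps cinner_eq_inner complex_eq_iff inner_add_right)
    show "S (r *\<^sub>R x) = r *\<^sub>R S x" for r x
      by (rule ell2_eqI) (simp add: S coord_scaleR cinner_eq_inner complex_eq_iff)
    have "(norm (S x))\<^sup>2 \<le> (norm T * norm x)\<^sup>2" for x
      unfolding norm_ell2_square
    proof (rule infsum_le_finite_sums[OF coord_square_summable])
      show "(\<Sum>i\<in>F. (cmod (coord (S x) i))\<^sup>2) \<le> (norm T * norm x)\<^sup>2" if "finite F" for F
        using fin[OF that] by (simp add: S)
    qed
    then show "norm (S x) \<le> norm x * norm T" for x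
      by (metis mult.commute mult_nonneg_nonneg norm_ge_zero power2_le_imp_le)
  qed
  then have app: "blinfun_apply (Blinfun S) = S" by (rule bounded_linear_Blinfun_apply)
  have "inner (S x) y = inner x (blinfun_apply T y)" for x y
  proof (rule bounded_linear_eqI[where x=y])
    show "bounded_linear (\<lambda>y. inner x (blinfun_apply T y))"
      by (rule bounded_linear_compose[OF bounded_linear_inner_right blinfun.bounded_linear_right])
    show "inner (S x) (cscale_ell2 c (ket i)) = inner x (blinfun_apply T (cscale_ell2 c (ket i)))" for c i
      by (simp add: clinear_opD[OF T] inner_ell2_def cinner_cscale_right cinner_ket_right S
        cinner_commute[of x "blinfun_apply T (ket i)"])
  qed (rule bounded_linear_inner_right)
  moreover have "S (cscale_ell2 c x) = cscale_ell2 c (S x)" for c x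
    by (rule ell2_eqI) (simp add: S coord_simps cinner_cscale_right)
  ultimately have "cinner (S x) y = cinner x (blinfun_apply T y)" for x y
    by (rule cinner_adjointI)
  then show ?thesis using S that app by metis
qed

lemma adj_op_unique:
  assumes "\<And>x y. inner (blinfun_apply S x) y = inner (blinfun_apply S' x) y"
  shows "S = S'"
proof (rule blinfun_eqI)
  show "blinfun_apply S x = blinfun_apply S' x" for x
    using assms[of x] by (metis inner_commute vector_eq_ldot)
qed

lemma
  assumes T: "clinear_op T"
  shows cinner_adj: "cinner (blinfun_apply (adj_op T) x) y = cinner x (blinfun_apply T y)"
    and coord_adj: "coord (blinfun_apply (adj_op T) x) i = cinner (blinfun_apply T (ket i)) x"
proof -
  obtain S where S: "\<And>x i. coord (blinfun_apply S x) i = cinner (blinfun_apply T (ket i)) x"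
    "\<And>x y. cinner (blinfun_apply S x) y = cinner x (blinfun_apply T y)"
    using adjoint_exists[OF T] by blast
  have "adj_op T = S"
    unfolding adj_op_def
  proof (rule the_equality)
    show "\<forall>x y. cinner (blinfun_apply S x) y = cinner x (blinfun_apply T y)" using S(2) by blast
    show "S' = S" if "\<forall>x y. cinner (blinfun_apply S' x) y = cinner x (blinfun_apply T y)" for S'
      by (rule adj_op_unique) (simp add: inner_ell2_def S(2) that)
  qed
  then show "cinner (blinfun_apply (adj_op T) x) y = cinner x (blinfun_apply T y)"
    "coord (blinfun_apply (adj_op T) x) i = cinner (blinfun_apply T (ket i)) x"
    using S by auto
qed

lemma inner_adj: "clinear_op T \<Longrightarrow> inner (blinfun_apply (adj_op T) x) y = inner x (blinfun_apply T y)"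
  by (simp add: inner_ell2_def cinner_adj)

lemma inner_adj_right: "clinear_op T \<Longrightarrow> inner x (blinfun_apply (adj_op T) y) = inner (blinfun_apply T x) y"
  by (metis inner_adj inner_commute)

lemma clinear_adj [simp, intro]: "clinear_op T \<Longrightarrow> clinear_op (adj_op T)"
  unfolding clinear_op_def[of "adj_op T"]
  by (auto intro!: ell2_eqI simp: coord_adj coord_simps cinner_cscale_right)

lemma adj_eqI:
  assumes "clinear_op T" "\<And>x y. inner (blinfun_apply S x) y = inner x (blinfun_apply T y)"
  shows "adj_op T = S"
  by (rule adj_op_unique) (simp add: assms inner_adj)

lemma adj_adj [simp]: "clinear_op T \<Longrightarrow> adj_op (adj_op T) = T"
  by (rule adj_eqI) (auto simp: inner_adj_right)

lemma adj_compose [simp]: "clinear_op S \<Longrightarrow> clinear_op T \<Longrightarrow> adj_op (S o\<^sub>L T) = adj_op T o\<^sub>L adj_op S"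
  by (rule adj_eqI) (auto simp: inner_adj)

lemma adj_plus [simp]: "clinear_op S \<Longrightarrow> clinear_op T \<Longrightarrow> adj_op (S + T) = adj_op S + adj_op T"
  by (rule adj_eqI) (auto simp: inner_adj plus_blinfun.rep_eq inner_add_left inner_add_right)

lemma adj_minus [simp]: "clinear_op S \<Longrightarrow> clinear_op T \<Longrightarrow> adj_op (S - T) = adj_op S - adj_op T"
  by (rule adj_eqI) (auto simp: inner_adj minus_blinfun.rep_eq inner_diff_left inner_diff_right)

lemma adj_scaleR [simp]: "clinear_op S \<Longrightarrow> adj_op (r *\<^sub>R S) = r *\<^sub>R adj_op S"
  by (rule adj_eqI) (auto simp: inner_adj scaleR_blinfun.rep_eq)

lemma adj_zero [simp]: "adj_op 0 = 0"
  by (rule adj_eqI) auto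

lemma adj_cscale [simp]: "clinear_op S \<Longrightarrow> adj_op (cscale_op c S) = cscale_op (cnj c) (adj_op S)"
  by (rule adj_eqI)
    (auto simp: cscale_op_apply inner_ell2_def cinner_cscale_left cinner_cscale_right cinner_adj)

lemma adj_id [simp]: "adj_op id_blinfun = id_blinfun"
  by (rule adj_eqI) auto

lemma adj_proj [simp]: "adj_op (proj_op I) = proj_op I"
proof (rule adj_eqI)
  show "inner (blinfun_apply (proj_op I) x) y = inner x (blinfun_apply (proj_op I) y)" for x y
    unfolding inner_ell2_def cinner_def proj_op.rep_eq restrict_ell2.rep_eq
    by (rule arg_cong[where f=Re]) (rule infsum_cong, auto)
qed simp

lemma proj_proj [simp]: "proj_op I o\<^sub>L proj_op I = proj_op I"
  by (rule blinfun_eqI) (auto simp: proj_op.rep_eq coord_simps intro!: ell2_eqI)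

lemma norm_adj_le: "clinear_op T \<Longrightarrow> norm (adj_op T) \<le> norm T"
proof (rule norm_blinfun_bound)
  assume T: "clinear_op T"
  fix x
  let ?y = "blinfun_apply (adj_op T) x"
  have "(norm ?y)\<^sup>2 = inner x (blinfun_apply T ?y)"
    using T by (simp add: power2_norm_eq_inner inner_adj)
  also have "\<dots> \<le> norm x * (norm T * norm ?y)"
    by (intro order.trans[OF norm_cauchy_schwarz] mult_left_mono norm_blinfun) simp
  finally have "norm ?y * norm ?y \<le> norm ?y * (norm T * norm x)"
    by (simp add: power2_eq_square mult_ac)
  then show "norm ?y \<le> norm T * norm x" by (cases "norm ?y = 0") auto
qed simp

lemma norm_adj [simp]: "clinear_op T \<Longrightarrow> norm (adj_op T) = norm T"
  by (rule antisym) (use norm_adj_le[of T] norm_adj_le[of "adj_op T"] in auto)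

lemma norm_adj_diff: "clinear_op S \<Longrightarrow> clinear_op T \<Longrightarrow> norm (adj_op S - adj_op T) = norm (S - T)"
  using norm_adj[of "S - T"] by simp

lemma coord_unilateral_shift:
  "coord (blinfun_apply unilateral_shift x) k = (case k of 0 \<Rightarrow> 0 | Suc j \<Rightarrow> coord x j)"
  by (simp add: unilateral_shift.rep_eq shift_ell2.rep_eq)

section \<open>Block-diagonal amplifications\<close>

lemmas blinfun_compose_add_left = bounded_bilinear.add_left[OF bounded_bilinear_blinfun_compose]
  and blinfun_compose_add_right = bounded_bilinear.add_right[OF bounded_bilinear_blinfun_compose]
  and blinfun_compose_diff_left = bounded_bilinear.diff_left[OF bounded_bilinear_blinfun_compose]
  and blinfun_compose_diff_right = bounded_bilinear.diff_right[OF bounded_bilinear_blinfun_compose]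

lemma blinfun_compose_assoc: "(a o\<^sub>L b) o\<^sub>L c = a o\<^sub>L (b o\<^sub>L c)"
  by (rule blinfun_eqI) simp

lemma has_sum_diff:
  fixes f g :: "'a \<Rightarrow> real"
  assumes "(f has_sum a) A" "(g has_sum b) A"
  shows "((\<lambda>x. f x - g x) has_sum (a - b)) A"
  using has_sum_add[OF assms(1), of "\<lambda>x. - g x" "- b"] assms(2) by (simp add: has_sum_uminus)

lemma range_cases:
  assumes "l \<in> range \<phi> \<Longrightarrow> P" "l \<notin> range \<phi> \<Longrightarrow> P" shows P
  using assms by blast

text \<open>
  An injection \<open>\<phi> :: 'k \<times> 'j \<Rightarrow> 'l\<close> identifies a direct sum of copies of \<open>\<ell>\<^sup>2('k)\<close>, indexed by \<open>'j\<close>, with a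
  coordinate subspace of \<open>\<ell>\<^sup>2('l)\<close>. Below, \<open>amp \<phi> X\<close> is \<open>X\<close> acting on each of the copies. Suitable choices
  of \<open>\<phi>\<close> give both factors of a tensor product of operators, the amplification \<open>X \<otimes> 1\<close> by another
  Hilbert space, and the transport of \<open>X\<close> to another index type.
\<close>
definition join_blocks :: "('k \<times> 'j \<Rightarrow> 'l) \<Rightarrow> ('j \<Rightarrow> 'k ell2) \<Rightarrow> 'l ell2" where
  "join_blocks \<phi> z = Abs_ell2 (\<lambda>l. if l \<in> range \<phi> then case inv_into UNIV \<phi> l of (k, j) \<Rightarrow> coord (z j) k else 0)"

lift_definition slice :: "('k \<times> 'j \<Rightarrow> 'l) \<Rightarrow> 'j \<Rightarrow> 'l ell2 \<Rightarrow> 'k ell2" is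
  "\<lambda>\<phi> j f k. if inj \<phi> then f (\<phi> (k, j)) else 0"
proof -
  fix \<phi> :: "'k \<times> 'j \<Rightarrow> 'l" and j and f :: "'l \<Rightarrow> complex"
  assume f: "(\<lambda>i. (cmod (f i))\<^sup>2) summable_on UNIV"
  show "(\<lambda>k. (cmod (if inj \<phi> then f (\<phi> (k, j)) else 0))\<^sup>2) summable_on UNIV"
  proof (cases "inj \<phi>")
    case True
    then have inj: "inj (\<lambda>k. \<phi> (k, j))" by (auto simp: inj_def)
    have "(\<lambda>i. (cmod (f i))\<^sup>2) summable_on range (\<lambda>k. \<phi> (k, j))"
      by (rule summable_on_subset_banach[OF f]) auto
    then show ?thesis using True by (simp add: summable_on_reindex[OF inj] o_def)
  qed auto
qed

context
  fixes \<phi> :: "'k \<times> 'j \<Rightarrow> 'l"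
  assumes inj: "inj \<phi>"
begin

lemma coord_slice: "coord (slice \<phi> j y) k = coord y (\<phi> (k, j))"
  using inj by (simp add: slice.rep_eq)

lemma ell2_eq_blocks:
  assumes "\<And>j. slice \<phi> j x = slice \<phi> j y" "\<And>l. l \<notin> range \<phi> \<Longrightarrow> coord x l = coord y l"
  shows "x = y"
proof (rule ell2_eqI)
  fix l
  show "coord x l = coord y l"
  proof (rule range_cases[of l \<phi>])
    assume "l \<in> range \<phi>"
    then obtain k j where "l = \<phi> (k, j)" by auto
    then show ?thesis using arg_cong[OF assms(1)[of j], of "\<lambda>z. coord z k"] by (simp add: coord_slice)
  qed (rule assms(2))
qed

lemma has_sum_blocks:
  fixes f :: "'l \<Rightarrow> real"
  assumes "\<And>j. ((\<lambda>k. f (\<phi> (k, j))) has_sum g j) UNIV" "(g has_sum S) UNIV"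
    and "\<And>l. f l \<ge> 0" "\<And>l. l \<notin> range \<phi> \<Longrightarrow> f l = 0"
  shows "(f has_sum S) UNIV"
proof -
  let ?c = "\<lambda>(j, k). \<phi> (k, j)"
  have "((f \<circ> ?c) has_sum S) (UNIV \<times> UNIV)"
  proof (rule has_sum_SigmaI)
    show "(f \<circ> ?c) summable_on UNIV \<times> UNIV"
      by (rule summable_on_SigmaI[where g=g]) (use assms in \<open>auto simp: summable_on_def\<close>)
  qed (use assms in auto)
  moreover have "inj ?c" using inj by (auto simp: inj_def)
  ultimately have "(f has_sum S) (range ?c)" by (simp add: has_sum_reindex)
  also have "range ?c = range \<phi>" by (auto simp: image_def)
  also have "(f has_sum S) (range \<phi>) \<longleftrightarrow> (f has_sum S) UNIV"
    by (rule has_sum_cong_neutral) (use assms in auto)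
  finally show ?thesis .
qed

lemma slice_norm_has_sum:
  "((\<lambda>j. (norm (slice \<phi> j y))\<^sup>2) has_sum (norm (restrict_ell2 (range \<phi>) y))\<^sup>2) UNIV"
proof -
  let ?c = "\<lambda>(j, k). \<phi> (k, j)" and ?f = "\<lambda>l. (cmod (coord y l))\<^sup>2"
  have "((\<lambda>l. (cmod (coord (restrict_ell2 (range \<phi>) y) l))\<^sup>2) has_sum (norm (restrict_ell2 (range \<phi>) y))\<^sup>2) UNIV"
    unfolding norm_ell2_square by (rule has_sum_infsum[OF coord_square_summable])
  also have "?this \<longleftrightarrow> (?f has_sum (norm (restrict_ell2 (range \<phi>) y))\<^sup>2) (range \<phi>)"
    by (rule has_sum_cong_neutral) (auto simp: coord_simps)
  also have "range \<phi> = range ?c" by (auto simp: image_def)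
  finally have "(?f has_sum (norm (restrict_ell2 (range \<phi>) y))\<^sup>2) (range ?c)"
    by (simp add: \<open>range \<phi> = range ?c\<close>)
  moreover have "inj ?c" using inj by (auto simp: inj_def)
  ultimately have "((?f \<circ> ?c) has_sum (norm (restrict_ell2 (range \<phi>) y))\<^sup>2) (UNIV \<times> UNIV)"
    by (simp add: has_sum_reindex)
  then show ?thesis
  proof (rule has_sum_SigmaD)
    fix j
    have "((\<lambda>k. (cmod (coord (slice \<phi> j y) k))\<^sup>2) has_sum (norm (slice \<phi> j y))\<^sup>2) UNIV"
      unfolding norm_ell2_square by (rule has_sum_infsum[OF coord_square_summable])
    then show "((\<lambda>k. (?f \<circ> ?c) (j, k)) has_sum (norm (slice \<phi> j y))\<^sup>2) UNIV"
      by (simp add: coord_slice)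
  qed
qed

lemma norm_slice_le: "norm (slice \<phi> j y) \<le> norm y"
proof -
  have "(norm (slice \<phi> j y))\<^sup>2 = (\<Sum>\<^sub>\<infinity>l\<in>range (\<lambda>k. \<phi> (k, j)). (cmod (coord y l))\<^sup>2)"
    unfolding norm_ell2_square coord_slice
    using inj by (subst infsum_reindex) (auto simp: inj_def o_def)
  also have "\<dots> \<le> (norm y)\<^sup>2"
    unfolding norm_ell2_square
    by (rule infsum_mono_neutral[OF summable_on_subset_banach[OF coord_square_summable] coord_square_summable]) auto
  finally show ?thesis by (rule power2_le_imp_le) simp
qed

lemma
  assumes summable: "(\<lambda>j. (norm (z j))\<^sup>2) summable_on UNIV"
  shows slice_join: "slice \<phi> j (join_blocks \<phi> z) = z j"
    and coord_join_out: "l \<notin> range \<phi> \<Longrightarrow> coord (join_blocks \<phi> z) l = 0"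
    and norm_join: "(norm (join_blocks \<phi> z))\<^sup>2 = (\<Sum>\<^sub>\<infinity>j. (norm (z j))\<^sup>2)"
proof -
  define f where "f l = (if l \<in> range \<phi> then case inv_into UNIV \<phi> l of (k, j) \<Rightarrow> coord (z j) k else 0)" for l
  have f: "f (\<phi> (k, j)) = coord (z j) k" for k j using inj by (simp add: f_def)
  have hs: "((\<lambda>l. (cmod (f l))\<^sup>2) has_sum (\<Sum>\<^sub>\<infinity>j. (norm (z j))\<^sup>2)) UNIV"
  proof (rule has_sum_blocks[where g="\<lambda>j. (norm (z j))\<^sup>2"])
    show "((\<lambda>k. (cmod (f (\<phi> (k, j))))\<^sup>2) has_sum (norm (z j))\<^sup>2) UNIV" for j
      unfolding f norm_ell2_square by (rule has_sum_infsum[OF coord_square_summable])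
  qed (use summable in \<open>auto simp: f_def\<close>)
  then have "coord (join_blocks \<phi> z) = f"
    using Abs_ell2_inverse[of f] by (auto simp: join_blocks_def f_def[abs_def] summable_on_def)
  then have c: "coord (join_blocks \<phi> z) l = f l" for l by simp
  show "slice \<phi> j (join_blocks \<phi> z) = z j"
    by (rule ell2_eqI) (simp add: coord_slice c f)
  show "l \<notin> range \<phi> \<Longrightarrow> coord (join_blocks \<phi> z) l = 0" by (simp add: c f_def)
  show "(norm (join_blocks \<phi> z))\<^sup>2 = (\<Sum>\<^sub>\<infinity>j. (norm (z j))\<^sup>2)"
    using infsumI[OF hs] by (simp add: norm_ell2_square[of "join_blocks \<phi> z"] c)
qed

lemma slice_add: "slice \<phi> j (x + y) = slice \<phi> j x + slice \<phi> j y"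
  by (rule ell2_eqI) (simp add: coord_slice coord_simps)

lemma slice_diff: "slice \<phi> j (x - y) = slice \<phi> j x - slice \<phi> j y"
  by (rule ell2_eqI) (simp add: coord_slice coord_simps)

lemma slice_cscale: "slice \<phi> j (cscale_ell2 c x) = cscale_ell2 c (slice \<phi> j x)"
  by (rule ell2_eqI) (simp add: coord_slice coord_simps)

lemma slice_scaleR: "slice \<phi> j (r *\<^sub>R x) = r *\<^sub>R slice \<phi> j x"
  by (rule ell2_eqI) (simp add: coord_slice coord_scaleR)

end

lemma norm_restrict_le: "norm (restrict_ell2 A x) \<le> norm x"
proof -
  have "(norm (restrict_ell2 A x))\<^sup>2 \<le> (norm x)\<^sup>2"
    unfolding norm_ell2_square
    by (intro infsum_mono coord_square_summable) (simp add: restrict_ell2.rep_eq)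
  then show ?thesis by (rule power2_le_imp_le) simp
qed

definition amp :: "('k \<times> 'j \<Rightarrow> 'l) \<Rightarrow> 'k op \<Rightarrow> 'l op" where
  "amp \<phi> X = Blinfun (\<lambda>y. join_blocks \<phi> (\<lambda>j. blinfun_apply X (slice \<phi> j y)))"

context
  fixes \<phi> :: "'k \<times> 'j \<Rightarrow> 'l"
  assumes inj: "inj \<phi>"
begin

lemma
  shows slice_amp: "slice \<phi> j (blinfun_apply (amp \<phi> X) y) = blinfun_apply X (slice \<phi> j y)"
    and coord_amp_out: "l \<notin> range \<phi> \<Longrightarrow> coord (blinfun_apply (amp \<phi> X) y) l = 0"
    and norm_amp_le: "norm (amp \<phi> X) \<le> norm X"
proof -
  let ?z = "\<lambda>y j. blinfun_apply X (slice \<phi> j y)"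
  have bound: "((\<lambda>j. (norm X)\<^sup>2 * (norm (slice \<phi> j y))\<^sup>2) has_sum
      (norm X)\<^sup>2 * (norm (restrict_ell2 (range \<phi>) y))\<^sup>2) UNIV" for y
    by (intro has_sum_cmult_right slice_norm_has_sum inj)
  have le: "(norm (?z y j))\<^sup>2 \<le> (norm X)\<^sup>2 * (norm (slice \<phi> j y))\<^sup>2" for y j
    unfolding power_mult_distrib[symmetric] by (intro power_mono norm_blinfun) simp
  have sm: "(\<lambda>j. (norm (?z y j))\<^sup>2) summable_on UNIV" for y
    by (rule summable_on_comparison_test[OF has_sum_imp_summable[OF bound]]) (use le in auto)
  note sl = slice_join[OF inj sm] and out = coord_join_out[OF inj sm] and nj = norm_join[OF inj sm]
  have norm_le: "norm (join_blocks \<phi> (?z y)) \<le> norm X * norm y" for y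
  proof (rule power2_le_imp_le)
    have "(norm (join_blocks \<phi> (?z y)))\<^sup>2 \<le> (norm X)\<^sup>2 * (norm (restrict_ell2 (range \<phi>) y))\<^sup>2"
      unfolding nj by (rule has_sum_mono[OF has_sum_infsum[OF sm] bound]) (rule le)
    also have "\<dots> \<le> (norm X)\<^sup>2 * (norm y)\<^sup>2"
      by (intro mult_left_mono power_mono norm_restrict_le) auto
    finally show "(norm (join_blocks \<phi> (?z y)))\<^sup>2 \<le> (norm X * norm y)\<^sup>2" by (simp add: power_mult_distrib)
  qed simp
  have "bounded_linear (\<lambda>y. join_blocks \<phi> (?z y))"
  proof (rule bounded_linear_intro[where K="norm X"])
    show "join_blocks \<phi> (?z (x + y)) = join_blocks \<phi> (?z x) + join_blocks \<phi> (?z y)" for x y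
    proof (rule ell2_eq_blocks[OF inj])
      fix j
      have "slice \<phi> j (join_blocks \<phi> (?z (x + y))) = ?z x j + ?z y j"
        unfolding sl by (simp add: slice_add[OF inj] blinfun.add_right)
      also have "\<dots> = slice \<phi> j (join_blocks \<phi> (?z x) + join_blocks \<phi> (?z y))"
        unfolding slice_add[OF inj] sl ..
      finally show "slice \<phi> j (join_blocks \<phi> (?z (x + y))) = slice \<phi> j (join_blocks \<phi> (?z x) + join_blocks \<phi> (?z y))" .
      fix l assume l: "l \<notin> range \<phi>"
      show "coord (join_blocks \<phi> (?z (x + y))) l = coord (join_blocks \<phi> (?z x) + join_blocks \<phi> (?z y)) l"
        unfolding plus_ell2.rep_eq out[OF l] by simp
    qed
    show "join_blocks \<phi> (?z (r *\<^sub>R y)) = r *\<^sub>R join_blocks \<phi> (?z y)" for r y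
    proof (rule ell2_eq_blocks[OF inj])
      fix j
      have "slice \<phi> j (join_blocks \<phi> (?z (r *\<^sub>R y))) = r *\<^sub>R ?z y j"
        unfolding sl by (simp add: slice_scaleR[OF inj] blinfun.scaleR_right)
      also have "\<dots> = slice \<phi> j (r *\<^sub>R join_blocks \<phi> (?z y))"
        unfolding slice_scaleR[OF inj] sl ..
      finally show "slice \<phi> j (join_blocks \<phi> (?z (r *\<^sub>R y))) = slice \<phi> j (r *\<^sub>R join_blocks \<phi> (?z y))" .
      fix l assume l: "l \<notin> range \<phi>"
      show "coord (join_blocks \<phi> (?z (r *\<^sub>R y))) l = coord (r *\<^sub>R join_blocks \<phi> (?z y)) l"
        unfolding coord_scaleR out[OF l] by simp
    qed
    show "norm (join_blocks \<phi> (?z y)) \<le> norm y * norm X" for y using norm_le[of y] by (simp add: mult.commute)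
  qed
  then have app: "blinfun_apply (amp \<phi> X) y = join_blocks \<phi> (?z y)" for y
    by (simp add: amp_def bounded_linear_Blinfun_apply)
  show "slice \<phi> j (blinfun_apply (amp \<phi> X) y) = blinfun_apply X (slice \<phi> j y)"
    by (simp add: app sl)
  show "l \<notin> range \<phi> \<Longrightarrow> coord (blinfun_apply (amp \<phi> X) y) l = 0" by (simp add: app out)
  show "norm (amp \<phi> X) \<le> norm X"
    by (rule norm_blinfun_bound) (simp_all add: app norm_le)
qed

lemma coord_amp: "coord (blinfun_apply (amp \<phi> X) y) (\<phi> (k, j)) = coord (blinfun_apply X (slice \<phi> j y)) k"
  using slice_amp[of j X y] coord_slice[OF inj] by metis

lemma amp_eqI:
  assumes "\<And>j y. slice \<phi> j (blinfun_apply S y) = blinfun_apply X (slice \<phi> j y)"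
    and "\<And>l y. l \<notin> range \<phi> \<Longrightarrow> coord (blinfun_apply S y) l = 0"
  shows "amp \<phi> X = S"
  by (rule blinfun_eqI, rule ell2_eq_blocks[OF inj]) (simp_all add: assms slice_amp coord_amp_out)

lemma clinear_amp: "clinear_op X \<Longrightarrow> clinear_op (amp \<phi> X)"
  unfolding clinear_op_def[of "amp \<phi> X"]
  by (auto intro!: ell2_eq_blocks[OF inj]
      simp: slice_amp coord_amp_out slice_cscale[OF inj] clinear_opD coord_simps)

lemma amp_compose: "amp \<phi> (X o\<^sub>L Y) = amp \<phi> X o\<^sub>L amp \<phi> Y"
  by (rule amp_eqI) (simp_all add: slice_amp coord_amp_out)

lemma amp_plus: "amp \<phi> (X + Y) = amp \<phi> X + amp \<phi> Y"
  by (rule amp_eqI) (simp_all add: plus_blinfun.rep_eq slice_add[OF inj] slice_amp coord_amp_out coord_simps)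

lemma amp_diff: "amp \<phi> (X - Y) = amp \<phi> X - amp \<phi> Y"
  by (rule amp_eqI) (simp_all add: minus_blinfun.rep_eq slice_diff[OF inj] slice_amp coord_amp_out coord_simps)

lemma amp_cscale: "amp \<phi> (cscale_op c X) = cscale_op c (amp \<phi> X)"
  by (rule amp_eqI) (simp_all add: cscale_op_apply slice_cscale[OF inj] slice_amp coord_amp_out coord_simps)

lemma amp_scaleR: "amp \<phi> (r *\<^sub>R X) = r *\<^sub>R amp \<phi> X"
  by (simp add: cscale_op_of_real[symmetric] amp_cscale)

lemma amp_zero: "amp \<phi> 0 = 0"
  by (rule amp_eqI) (simp_all add: coord_simps ell2_eqI coord_slice[OF inj])

lemma amp_sum: "amp \<phi> (sum f A) = (\<Sum>a\<in>A. amp \<phi> (f a))"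
  by (induction A rule: infinite_finite_induct) (auto simp: amp_zero amp_plus)

lemma amp_proj: "amp \<phi> (proj_op K) = proj_op (\<phi> ` (K \<times> UNIV))"
proof (rule amp_eqI)
  show "slice \<phi> j (blinfun_apply (proj_op (\<phi> ` (K \<times> UNIV))) y) = blinfun_apply (proj_op K) (slice \<phi> j y)" for j y
    using inj by (intro ell2_eqI) (auto simp: coord_slice[OF inj] proj_op.rep_eq coord_simps inj_def)
qed (auto simp: proj_op.rep_eq coord_simps)

text \<open>By polarization from the statement about norms.\<close>
lemma inner_blocks:
  assumes "\<And>l. l \<notin> range \<phi> \<Longrightarrow> coord x l = 0"
  shows "((\<lambda>j. inner (slice \<phi> j x) (slice \<phi> j y)) has_sum inner x y) UNIV"
proof -
  have *: "inner x y = ((norm (restrict_ell2 (range \<phi>) (x + y)))\<^sup>2 - (norm (restrict_ell2 (range \<phi>) x))\<^sup>2 -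
      (norm (restrict_ell2 (range \<phi>) y))\<^sup>2) / 2"
  proof -
    let ?R = "blinfun_apply (proj_op (range \<phi>))"
    have x: "?R x = x"
      by (rule ell2_eqI) (use assms in \<open>auto simp: proj_op.rep_eq coord_simps\<close>)
    have "inner x y = inner (?R x) (?R y)"
    proof -
      have "?R (?R x) = ?R x" using x by simp
      then show ?thesis using inner_adj[of "proj_op (range \<phi>)" "?R x" y] x by simp
    qed
    also have "\<dots> = ((norm (?R (x + y)))\<^sup>2 - (norm (?R x))\<^sup>2 - (norm (?R y))\<^sup>2) / 2"
      unfolding dot_norm blinfun.add_right ..
    finally show ?thesis unfolding proj_op.rep_eq .
  qed
  show ?thesis
    unfolding * dot_norm[of "slice \<phi> _ x"] slice_add[OF inj, symmetric] divide_inverse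
    by (intro has_sum_cmult_left has_sum_diff slice_norm_has_sum inj)
qed

lemma adj_amp: "clinear_op X \<Longrightarrow> adj_op (amp \<phi> X) = amp \<phi> (adj_op X)"
proof (rule adj_eqI)
  assume X: "clinear_op X"
  then show "clinear_op (amp \<phi> X)" by (rule clinear_amp)
  fix x y
  have "((\<lambda>j. inner (slice \<phi> j x) (blinfun_apply X (slice \<phi> j y))) has_sum
      inner (blinfun_apply (amp \<phi> (adj_op X)) x) y) UNIV"
    using inner_blocks[of "blinfun_apply (amp \<phi> (adj_op X)) x" y]
    by (simp add: coord_amp_out slice_amp inner_adj X)
  moreover have "((\<lambda>j. inner (slice \<phi> j x) (blinfun_apply X (slice \<phi> j y))) has_sum
      inner x (blinfun_apply (amp \<phi> X) y)) UNIV"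
    using inner_blocks[of "blinfun_apply (amp \<phi> X) y" x]
    by (simp add: coord_amp_out slice_amp inner_commute)
  ultimately show "inner (blinfun_apply (amp \<phi> (adj_op X)) x) y = inner x (blinfun_apply (amp \<phi> X) y)"
    by (rule has_sum_unique)
qed

text \<open>A vector put into a single block shows that nothing is lost.\<close>
lemma norm_amp: "norm (amp \<phi> X) = norm X"
proof (rule antisym[OF norm_amp_le norm_blinfun_bound])
  fix v
  define j0 :: 'j where "j0 = undefined"
  let ?z = "\<lambda>j. if j = j0 then v else (0 :: 'k ell2)"
  have "(\<lambda>j. (norm (?z j))\<^sup>2) summable_on UNIV"
    by (rule finite_nonzero_values_imp_summable_on) (rule finite_subset[of _ "{j0}"], auto)
  note J = slice_join[OF inj this] norm_join[OF inj this]
  have "(norm (join_blocks \<phi> ?z))\<^sup>2 = (\<Sum>\<^sub>\<infinity>j\<in>{j0}. (norm (?z j))\<^sup>2)"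
    unfolding J by (rule infsum_cong_neutral) auto
  then have n: "norm (join_blocks \<phi> ?z) = norm v" by simp
  have "norm (blinfun_apply X v) = norm (slice \<phi> j0 (blinfun_apply (amp \<phi> X) (join_blocks \<phi> ?z)))"
    by (simp add: slice_amp J)
  also have "\<dots> \<le> norm (amp \<phi> X) * norm (join_blocks \<phi> ?z)"
    by (rule order.trans[OF norm_slice_le[OF inj] norm_blinfun])
  finally show "norm (blinfun_apply X v) \<le> norm (amp \<phi> X) * norm v" by (simp add: n)
qed simp

end

subsection \<open>Tensor products of operators\<close>

abbreviation "lft \<equiv> (\<lambda>(xs :: nat list, k :: nat). k # xs)"
abbreviation "rgt \<equiv> (\<lambda>(k :: nat, xs :: nat list). k # xs)"

lemma inj_lft: "inj lft" and inj_rgt: "inj rgt"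
  by (auto simp: inj_def)

lemma notin_lft: "l \<notin> range lft \<longleftrightarrow> l = []" and notin_rgt: "l \<notin> range rgt \<longleftrightarrow> l = []"
  by (cases l, auto simp: image_iff)+

lemma slice_lft_tensor: "slice lft k (tensor_ell2 x y) = cscale_ell2 (coord y k) x"
  by (rule ell2_eqI) (simp add: coord_slice[OF inj_lft] tensor_ell2.rep_eq coord_simps)

lemma slice_rgt_tensor: "slice rgt xs (tensor_ell2 x y) = cscale_ell2 (coord x xs) y"
  by (rule ell2_eqI) (simp add: coord_slice[OF inj_rgt] tensor_ell2.rep_eq coord_simps)

lemma amp_lft_tensor:
  "clinear_op a \<Longrightarrow> blinfun_apply (amp lft a) (tensor_ell2 x y) = tensor_ell2 (blinfun_apply a x) y"
  by (rule ell2_eq_blocks[OF inj_lft])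
    (auto simp: slice_amp[OF inj_lft] slice_lft_tensor clinear_opD coord_amp_out[OF inj_lft] notin_lft tensor_ell2.rep_eq)

lemma amp_rgt_tensor:
  "clinear_op b \<Longrightarrow> blinfun_apply (amp rgt b) (tensor_ell2 x y) = tensor_ell2 x (blinfun_apply b y)"
  by (rule ell2_eq_blocks[OF inj_rgt])
    (auto simp: slice_amp[OF inj_rgt] slice_rgt_tensor clinear_opD coord_amp_out[OF inj_rgt] notin_rgt tensor_ell2.rep_eq)

lemma slice_ket_Nil: "inj \<phi> \<Longrightarrow> [] \<notin> range \<phi> \<Longrightarrow> slice \<phi> j (ket []) = 0"
  by (rule ell2_eqI) (auto simp: coord_simps coord_slice image_iff, metis)

lemma amp_ket_Nil: "inj \<phi> \<Longrightarrow> [] \<notin> range \<phi> \<Longrightarrow> blinfun_apply (amp \<phi> a) (ket []) = 0"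
  by (rule ell2_eq_blocks, assumption)
    (simp_all add: slice_amp slice_ket_Nil coord_amp_out coord_simps, rule ell2_eqI, simp add: coord_slice coord_simps)

lemma amp_lft_ket_Nil: "blinfun_apply (amp lft a) (ket []) = 0"
  and amp_rgt_ket_Nil: "blinfun_apply (amp rgt a') (ket []) = 0"
  by (rule amp_ket_Nil; use inj_lft inj_rgt in auto)+

text \<open>
  Both sides agree on the vectors \<open>\<xi>\<^bsub>xs\<^esub> \<otimes> \<xi>\<^sub>k\<close>, and these form the basis up to \<open>\<xi>\<^bsub>[]\<^esub>\<close>, which both annihilate.
\<close>
lemma tensor_op_eq:
  assumes a: "clinear_op a" and b: "clinear_op b"
  shows "tensor_op a b = amp lft a o\<^sub>L amp rgt b"
  unfolding tensor_op_def
proof (rule the_equality)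
  let ?T = "amp lft a o\<^sub>L amp rgt b"
  have lin: "clinear_op ?T" using a b by (intro clinear_compose clinear_amp inj_lft inj_rgt)
  have nil: "blinfun_apply ?T (ket []) = 0"
    by (simp add: amp_rgt_ket_Nil blinfun.zero_right)
  have ten: "blinfun_apply ?T (tensor_ell2 x y) = tensor_ell2 (blinfun_apply a x) (blinfun_apply b y)" for x y
    using a b by (simp add: amp_lft_tensor amp_rgt_tensor)
  show "clinear_op ?T \<and> blinfun_apply ?T (ket []) = 0 \<and>
     (\<forall>x y. blinfun_apply ?T (tensor_ell2 x y) = tensor_ell2 (blinfun_apply a x) (blinfun_apply b y))"
    using lin nil ten by blast
  fix S assume S: "clinear_op S \<and> blinfun_apply S (ket []) = 0 \<and>
     (\<forall>x y. blinfun_apply S (tensor_ell2 x y) = tensor_ell2 (blinfun_apply a x) (blinfun_apply b y))"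
  show "S = ?T"
  proof (rule clinear_op_eqI)
    fix l show "blinfun_apply S (ket l) = blinfun_apply ?T (ket l)"
    proof (cases l)
      case Nil then show ?thesis using S nil by simp
    next
      case (Cons k xs)
      then show ?thesis using S ten by (metis tensor_ell2_ket)
    qed
  qed (use S lin in auto)
qed

lemma amp_commute:
  assumes a: "clinear_op a" and b: "clinear_op b"
  shows "amp rgt b o\<^sub>L amp lft a = amp lft a o\<^sub>L amp rgt b"
proof (rule clinear_op_eqI)
  fix l
  show "blinfun_apply (amp rgt b o\<^sub>L amp lft a) (ket l) = blinfun_apply (amp lft a o\<^sub>L amp rgt b) (ket l)"
  proof (cases l)
    case Nil then show ?thesis
      by (simp add: amp_lft_ket_Nil amp_rgt_ket_Nil blinfun.zero_right)
  next
    case (Cons k xs)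
    then show ?thesis using a b by (simp add: tensor_ell2_ket[symmetric] amp_lft_tensor amp_rgt_tensor)
  qed
qed (use a b in \<open>auto intro!: clinear_compose clinear_amp inj_lft inj_rgt\<close>)

lemma clinear_tensor [simp, intro]: "clinear_op a \<Longrightarrow> clinear_op b \<Longrightarrow> clinear_op (tensor_op a b)"
  by (auto simp: tensor_op_eq intro!: clinear_compose clinear_amp inj_lft inj_rgt)

lemma tensor_compose:
  assumes "clinear_op a" "clinear_op b" "clinear_op c" "clinear_op d"
  shows "tensor_op a b o\<^sub>L tensor_op c d = tensor_op (a o\<^sub>L c) (b o\<^sub>L d)"
proof -
  have "(amp lft a o\<^sub>L amp rgt b) o\<^sub>L (amp lft c o\<^sub>L amp rgt d)
      = amp lft a o\<^sub>L (amp rgt b o\<^sub>L amp lft c) o\<^sub>L amp rgt d"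
    by (simp add: blinfun_compose_assoc)
  also have "\<dots> = (amp lft a o\<^sub>L amp lft c) o\<^sub>L (amp rgt b o\<^sub>L amp rgt d)"
    by (simp add: blinfun_compose_assoc amp_commute assms)
  finally show ?thesis
    using assms by (simp add: tensor_op_eq amp_compose[OF inj_lft] amp_compose[OF inj_rgt])
qed

lemma adj_tensor: "clinear_op a \<Longrightarrow> clinear_op b \<Longrightarrow> adj_op (tensor_op a b) = tensor_op (adj_op a) (adj_op b)"
  by (simp add: tensor_op_eq clinear_amp[OF inj_lft] clinear_amp[OF inj_rgt] adj_amp[OF inj_lft] adj_amp[OF inj_rgt] amp_commute)

lemma norm_tensor_le: "clinear_op a \<Longrightarrow> clinear_op b \<Longrightarrow> norm (tensor_op a b) \<le> norm a * norm b"
  using norm_blinfun_compose[of "amp lft a" "amp rgt b"]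
  by (simp add: tensor_op_eq norm_amp[OF inj_lft] norm_amp[OF inj_rgt])

lemma tensor_plus_left: "clinear_op a \<Longrightarrow> clinear_op b \<Longrightarrow> clinear_op c \<Longrightarrow>
    tensor_op (a + b) c = tensor_op a c + tensor_op b c"
  by (simp add: tensor_op_eq amp_plus[OF inj_lft] blinfun_compose_add_left)

lemma tensor_plus_right: "clinear_op a \<Longrightarrow> clinear_op b \<Longrightarrow> clinear_op c \<Longrightarrow>
    tensor_op c (a + b) = tensor_op c a + tensor_op c b"
  by (simp add: tensor_op_eq amp_plus[OF inj_rgt] blinfun_compose_add_right)

lemma tensor_diff_left: "clinear_op a \<Longrightarrow> clinear_op b \<Longrightarrow> clinear_op c \<Longrightarrow>
    tensor_op (a - b) c = tensor_op a c - tensor_op b c"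
  by (simp add: tensor_op_eq amp_diff[OF inj_lft] blinfun_compose_diff_left)

lemma tensor_diff_right: "clinear_op a \<Longrightarrow> clinear_op b \<Longrightarrow> clinear_op c \<Longrightarrow>
    tensor_op c (a - b) = tensor_op c a - tensor_op c b"
  by (simp add: tensor_op_eq amp_diff[OF inj_rgt] blinfun_compose_diff_right)

lemma tensor_cscale_left: "clinear_op a \<Longrightarrow> clinear_op b \<Longrightarrow> tensor_op (cscale_op c a) b = cscale_op c (tensor_op a b)"
  by (simp add: tensor_op_eq amp_cscale[OF inj_lft] compose_cscale_left)

lemma tensor_cscale_right: "clinear_op a \<Longrightarrow> clinear_op b \<Longrightarrow> tensor_op a (cscale_op c b) = cscale_op c (tensor_op a b)"
  by (simp add: tensor_op_eq amp_cscale[OF inj_rgt] clinear_compose_cscale_right clinear_amp[OF inj_lft])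

lemma tensor_scaleR_left: "clinear_op a \<Longrightarrow> clinear_op b \<Longrightarrow> tensor_op (r *\<^sub>R a) b = r *\<^sub>R tensor_op a b"
  by (simp add: cscale_op_of_real[symmetric] tensor_cscale_left)

lemma tensor_scaleR_right: "clinear_op a \<Longrightarrow> clinear_op b \<Longrightarrow> tensor_op a (r *\<^sub>R b) = r *\<^sub>R tensor_op a b"
  by (simp add: cscale_op_of_real[symmetric] tensor_cscale_right)

lemma tensor_zero_left: "clinear_op b \<Longrightarrow> tensor_op 0 b = 0"
  by (simp add: tensor_op_eq amp_zero[OF inj_lft])

lemma tensor_zero_right: "clinear_op b \<Longrightarrow> tensor_op b 0 = 0"
  by (simp add: tensor_op_eq amp_zero[OF inj_rgt])

lemma tensor_sum_left: "(\<And>a. a \<in> A \<Longrightarrow> clinear_op (f a)) \<Longrightarrow> clinear_op b \<Longrightarrow>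
    tensor_op (sum f A) b = (\<Sum>a\<in>A. tensor_op (f a) b)"
  by (induction A rule: infinite_finite_induct) (auto simp: tensor_zero_left tensor_plus_left clinear_sum)

lemma coord_tensor_op:
  "clinear_op a \<Longrightarrow> clinear_op b \<Longrightarrow> coord (blinfun_apply (tensor_op a b) y) (k # xs) =
     coord (blinfun_apply a (slice lft k (blinfun_apply (amp rgt b) y))) xs"
  using coord_amp[OF inj_lft, of a "blinfun_apply (amp rgt b) y" xs k] by (simp add: tensor_op_eq)

lemma coord_amp_rgt: "coord (blinfun_apply (amp rgt b) y) (k # xs) = coord (blinfun_apply b (slice rgt xs y)) k"
  using coord_amp[OF inj_rgt, of b y k xs] by simp

lemma coord_slice_lft: "coord (slice lft k y) xs = coord y (k # xs)"
  and coord_slice_rgt: "coord (slice rgt xs y) k = coord y (k # xs)"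
  by (simp_all add: coord_slice[OF inj_lft] coord_slice[OF inj_rgt])

lemma coord_tensor_op_Nil: "clinear_op a \<Longrightarrow> clinear_op b \<Longrightarrow> coord (blinfun_apply (tensor_op a b) y) [] = 0"
  by (simp add: tensor_op_eq coord_amp_out[OF inj_lft] notin_lft)

lemma tensor_proj: "tensor_op (proj_op K) id_blinfun = proj_op {k # xs |k xs. xs \<in> K}"
proof (rule blinfun_eqI, rule ell2_eqI)
  fix y l
  show "coord (blinfun_apply (tensor_op (proj_op K) id_blinfun) y) l =
      coord (blinfun_apply (proj_op {k # xs |k xs. xs \<in> K}) y) l"
    by (cases l) (auto simp: coord_tensor_op coord_tensor_op_Nil proj_op.rep_eq coord_simps coord_slice_lft
        coord_amp_rgt coord_slice_rgt)
qed

instance ell2 :: (type) banach ..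

section \<open>Star-polynomials and closed algebras of operators\<close>

text \<open>
  Noncommutative *-polynomials are kept as syntax because the same polynomial has to be evaluated in
  the model and in all representations.
\<close>
datatype 'g star_poly = Gen 'g | Unit | Plus "'g star_poly" "'g star_poly"
  | Times "'g star_poly" "'g star_poly" | Scale complex "'g star_poly" | Star "'g star_poly"

primrec ev :: "'i op \<Rightarrow> ('g \<Rightarrow> 'i op) \<Rightarrow> 'g star_poly \<Rightarrow> 'i op" where
  "ev E z (Gen g) = z g"
| "ev E z Unit = E"
| "ev E z (Plus p q) = ev E z p + ev E z q"
| "ev E z (Times p q) = ev E z p o\<^sub>L ev E z q"
| "ev E z (Scale c p) = cscale_op c (ev E z p)"
| "ev E z (Star p) = adj_op (ev E z p)"

abbreviation star_polys :: "'g set \<Rightarrow> 'g star_poly set" where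
  "star_polys N \<equiv> {p. set_star_poly p \<subseteq> N}"

abbreviation op_alg :: "'i op \<Rightarrow> ('g \<Rightarrow> 'i op) \<Rightarrow> 'g set \<Rightarrow> 'i op set" where
  "op_alg E z N \<equiv> closure (ev E z ` star_polys N)"

text \<open>
  In contrast to \<open>cstar_subalgebra\<close>, this does not refer to an ambient \<open>bounded_operators I\<close>, and hence
  allows one to compare subalgebras for different \<open>I\<close>.
\<close>
definition closed_star_algebra :: "'i op set \<Rightarrow> bool" where
  "closed_star_algebra B \<longleftrightarrow> B \<subseteq> Collect clinear_op \<and> 0 \<in> B \<and>
     (\<forall>x\<in>B. \<forall>y\<in>B. x + y \<in> B \<and> x o\<^sub>L y \<in> B) \<and> (\<forall>c. \<forall>x\<in>B. cscale_op c x \<in> B) \<and>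
     (\<forall>x\<in>B. adj_op x \<in> B) \<and> closed B"

lemma cscale_op_minus_one: "cscale_op (-1) T = - T"
  using cscale_op_of_real[of "-1" T] by simp

lemma cscale_op_zero: "cscale_op 0 T = 0"
  using cscale_op_of_real[of 0 T] by simp

lemma tendsto_cscale_op:
  assumes "(X \<longlongrightarrow> x) F" shows "((\<lambda>n. cscale_op c (X n)) \<longlongrightarrow> cscale_op c x) F"
  unfolding cscale_op_def
  by (intro bounded_bilinear.tendsto[OF bounded_bilinear_blinfun_compose] tendsto_const assms)

lemma tendsto_adj_op:
  assumes "(X \<longlongrightarrow> x) F" "\<And>n. clinear_op (X n)" "clinear_op x"
  shows "((\<lambda>n. adj_op (X n)) \<longlongrightarrow> adj_op x) F"
  using assms by (simp add: tendsto_iff dist_norm norm_adj_diff)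

lemma closed_star_algebraD:
  assumes "closed_star_algebra B"
  shows "x \<in> B \<Longrightarrow> clinear_op x" "0 \<in> B" "x \<in> B \<Longrightarrow> y \<in> B \<Longrightarrow> x + y \<in> B"
    "x \<in> B \<Longrightarrow> y \<in> B \<Longrightarrow> x o\<^sub>L y \<in> B" "x \<in> B \<Longrightarrow> cscale_op c x \<in> B" "x \<in> B \<Longrightarrow> adj_op x \<in> B"
    "closed B" "x \<in> B \<Longrightarrow> r *\<^sub>R x \<in> B" "x \<in> B \<Longrightarrow> y \<in> B \<Longrightarrow> x - y \<in> B"
proof -
  have B: "x \<in> B \<Longrightarrow> y \<in> B \<Longrightarrow> x + y \<in> B" "x \<in> B \<Longrightarrow> cscale_op c x \<in> B" for x y c
    using assms by (auto simp: closed_star_algebra_def)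
  show "x \<in> B \<Longrightarrow> r *\<^sub>R x \<in> B"
    using B(2)[of x "complex_of_real r"] by (simp only: cscale_op_of_real)
  show "x \<in> B \<Longrightarrow> y \<in> B \<Longrightarrow> x - y \<in> B"
    using B(1)[of x "- y"] B(2)[of y "-1"] by (simp add: cscale_op_minus_one)
qed (use assms in \<open>auto simp: closed_star_algebra_def\<close>)

lemma closed_star_algebra_Int:
  "closed_star_algebra A \<Longrightarrow> closed_star_algebra B \<Longrightarrow> closed_star_algebra (A \<inter> B)"
  unfolding closed_star_algebra_def by (auto intro: closed_Int)

lemma ev_in:
  assumes "closed_star_algebra B" "E \<in> B" "z ` N \<subseteq> B" "p \<in> star_polys N"
  shows "ev E z p \<in> B"
  using assms(4) by (induction p) (use assms in \<open>auto simp: closed_star_algebraD image_subset_iff\<close>)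

lemma closed_star_algebra_closure:
  assumes "A \<subseteq> Collect clinear_op" "0 \<in> A" "\<And>x y. x \<in> A \<Longrightarrow> y \<in> A \<Longrightarrow> x + y \<in> A"
    "\<And>x y. x \<in> A \<Longrightarrow> y \<in> A \<Longrightarrow> x o\<^sub>L y \<in> A" "\<And>c x. x \<in> A \<Longrightarrow> cscale_op c x \<in> A"
    "\<And>x. x \<in> A \<Longrightarrow> adj_op x \<in> A"
  shows "closed_star_algebra (closure A)"
proof -
  have lin: "closure A \<subseteq> Collect clinear_op"
    using assms(1) closed_clinear by (intro closure_minimal) auto
  have seq: "\<exists>X. (\<forall>n. X n \<in> A) \<and> X \<longlonglongrightarrow> x" if "x \<in> closure A" for x
    using that by (simp add: closure_sequential)
  have add: "x + y \<in> closure A \<and> x o\<^sub>L y \<in> closure A" if xy: "x \<in> closure A" "y \<in> closure A" for x y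
  proof -
    obtain X Y where XY: "\<And>n. X n \<in> A" "X \<longlonglongrightarrow> x" "\<And>n. Y n \<in> A" "Y \<longlonglongrightarrow> y"
      using seq[OF xy(1)] seq[OF xy(2)] by blast
    have "(\<lambda>n. X n + Y n) \<longlonglongrightarrow> x + y" by (intro tendsto_add XY)
    moreover have "(\<lambda>n. X n o\<^sub>L Y n) \<longlonglongrightarrow> (x o\<^sub>L y)"
      by (rule bounded_bilinear.tendsto[OF bounded_bilinear_blinfun_compose XY(2) XY(4)])
    ultimately show ?thesis
      unfolding closure_sequential using assms(3)[OF XY(1) XY(3)] assms(4)[OF XY(1) XY(3)] by meson
  qed
  have "cscale_op c x \<in> closure A \<and> adj_op x \<in> closure A" if x: "x \<in> closure A" for c x
  proof -
    obtain X where X: "\<And>n. X n \<in> A" "X \<longlonglongrightarrow> x" using seq[OF x] by blast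
    have "(\<lambda>n. cscale_op c (X n)) \<longlonglongrightarrow> cscale_op c x" by (intro tendsto_cscale_op X)
    moreover have "(\<lambda>n. adj_op (X n)) \<longlonglongrightarrow> adj_op x"
      by (intro tendsto_adj_op X) (use X x lin assms(1) in auto)
    ultimately show ?thesis
      unfolding closure_sequential using assms(5)[OF X(1)] assms(6)[OF X(1)] by meson
  qed
  then show ?thesis
    using add lin assms(2) closure_subset[of A] by (auto simp: closed_star_algebra_def)
qed

lemma closed_star_algebra_ev:
  assumes "clinear_op E" "\<And>g. g \<in> N \<Longrightarrow> clinear_op (z g)"
  shows "closed_star_algebra (op_alg E z N)"
proof (rule closed_star_algebra_closure)
  have "clinear_op (ev E z p)" if "p \<in> star_polys N" for p
    using that by (induction p) (use assms in auto)
  then show "ev E z ` star_polys N \<subseteq> Collect clinear_op" by auto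
  have "ev E z (Scale 0 Unit) = 0" by (simp add: cscale_op_zero)
  then show "0 \<in> ev E z ` star_polys N" by (intro image_eqI[of _ _ "Scale 0 Unit"]) auto
  fix x assume "x \<in> ev E z ` star_polys N"
  then obtain p where p: "x = ev E z p" "p \<in> star_polys N" by auto
  show "adj_op x \<in> ev E z ` star_polys N"
    by (rule image_eqI[of _ _ "Star p"]) (use p in auto)
  show "cscale_op c x \<in> ev E z ` star_polys N" for c
    by (rule image_eqI[of _ _ "Scale c p"]) (use p in auto)
  fix y assume "y \<in> ev E z ` star_polys N"
  then obtain q where q: "y = ev E z q" "q \<in> star_polys N" by auto
  show "x + y \<in> ev E z ` star_polys N"
    by (rule image_eqI[of _ _ "Plus p q"]) (use p q in auto)
  show "x o\<^sub>L y \<in> ev E z ` star_polys N"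
    by (rule image_eqI[of _ _ "Times p q"]) (use p q in auto)
qed

lemma closure_ev_least:
  assumes "closed_star_algebra B" "E \<in> B" "z ` N \<subseteq> B"
  shows "op_alg E z N \<subseteq> B"
  using ev_in[OF assms] closed_star_algebraD(7)[OF assms(1)] by (intro closure_minimal) auto

lemma gen_in_closure: "E \<in> op_alg E z N"
  "g \<in> N \<Longrightarrow> z g \<in> op_alg E z N"
proof -
  show "E \<in> op_alg E z N"
    by (rule subsetD[OF closure_subset], rule image_eqI[of _ _ Unit]) auto
  show "g \<in> N \<Longrightarrow> z g \<in> op_alg E z N"
    by (rule subsetD[OF closure_subset], rule image_eqI[of _ _ "Gen g"]) auto
qed

subsection \<open>The algebras of bounded operators on coordinate subspaces\<close>

abbreviation ops :: "'i set \<Rightarrow> 'i op set" where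
  "ops I \<equiv> {T. clinear_op T \<and> proj_op I o\<^sub>L T = T \<and> T o\<^sub>L proj_op I = T}"

lemma bounded_operators_simps [simp]:
  "carrier (bounded_operators I) = ops I" "mult (bounded_operators I) = (o\<^sub>L)"
  "one (bounded_operators I) = proj_op I" "zero (bounded_operators I) = 0"
  "add (bounded_operators I) = (+)" "cscale (bounded_operators I) = cscale_op"
  "star (bounded_operators I) = adj_op" "cnorm (bounded_operators I) = norm"
  by (simp_all add: bounded_operators_def)

lemma closed_star_algebra_ops: "closed_star_algebra (ops I)"
proof -
  have "closed (Collect clinear_op \<inter> {T. proj_op I o\<^sub>L T = T} \<inter> {T. T o\<^sub>L proj_op I = T})"
    by (intro closed_Int closed_clinear closed_Collect_eq continuous_intros
        bounded_bilinear.continuous_on[OF bounded_bilinear_blinfun_compose])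
  also have "Collect clinear_op \<inter> {T. proj_op I o\<^sub>L T = T} \<inter> {T. T o\<^sub>L proj_op I = T} = ops I" by auto
  finally have cl: "closed (ops I)" .
  have adj: "proj_op I o\<^sub>L adj_op T = adj_op T \<and> adj_op T o\<^sub>L proj_op I = adj_op T" if "T \<in> ops I" for T
    using that adj_compose[of T "proj_op I"] adj_compose[of "proj_op I" T] by auto
  have comp: "x o\<^sub>L y \<in> ops I" if "x \<in> ops I" "y \<in> ops I" for x y
  proof -
    have "proj_op I o\<^sub>L (x o\<^sub>L y) = (proj_op I o\<^sub>L x) o\<^sub>L y" "(x o\<^sub>L y) o\<^sub>L proj_op I = x o\<^sub>L (y o\<^sub>L proj_op I)"
      by (simp_all only: blinfun_compose_assoc)
    then show ?thesis using that by auto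
  qed
  have add: "x + y \<in> ops I" if "x \<in> ops I" "y \<in> ops I" for x y
    using that by (auto simp: blinfun_compose_add_left blinfun_compose_add_right)
  have scale: "cscale_op c x \<in> ops I" if "x \<in> ops I" for c x
    using that by (auto simp: compose_cscale_left clinear_compose_cscale_right)
  have star: "adj_op x \<in> ops I" if "x \<in> ops I" for x
    using adj[OF that] that by simp
  have zero: "0 \<in> ops I" and sub: "ops I \<subseteq> Collect clinear_op" by auto
  show ?thesis
    unfolding closed_star_algebra_def
    by (intro conjI ballI allI; (rule comp add scale star zero sub cl)?; assumption?)
qed

lemma abelian_group_ops: "abelian_group (bounded_operators I)"
proof (rule abelian_groupI)
  fix x assume "x \<in> carrier (bounded_operators I)"
  then have "- x \<in> carrier (bounded_operators I) \<and> - x \<oplus>\<^bsub>bounded_operators I\<^esub> x = \<zero>\<^bsub>bounded_operators I\<^esub>"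
    using closed_star_algebraD(5)[OF closed_star_algebra_ops[of I], of x "-1"] by (simp add: cscale_op_minus_one)
  then show "\<exists>y\<in>carrier (bounded_operators I). y \<oplus>\<^bsub>bounded_operators I\<^esub> x = \<zero>\<^bsub>bounded_operators I\<^esub>" by blast
next
  fix x y z
  assume x: "x \<in> carrier (bounded_operators I)" and y: "y \<in> carrier (bounded_operators I)"
  show "x \<oplus>\<^bsub>bounded_operators I\<^esub> y \<in> carrier (bounded_operators I)"
    using closed_star_algebraD(3)[OF closed_star_algebra_ops[of I]] x y unfolding bounded_operators_simps by blast
  show "x \<oplus>\<^bsub>bounded_operators I\<^esub> y = y \<oplus>\<^bsub>bounded_operators I\<^esub> x"
    by (simp add: add.commute)
  show "(x \<oplus>\<^bsub>bounded_operators I\<^esub> y) \<oplus>\<^bsub>bounded_operators I\<^esub> z =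
      x \<oplus>\<^bsub>bounded_operators I\<^esub> (y \<oplus>\<^bsub>bounded_operators I\<^esub> z)"
    by (simp add: add.assoc)
qed simp_all

lemma minus_ops:
  assumes "x \<in> ops I" "y \<in> ops I"
  shows "x \<ominus>\<^bsub>bounded_operators I\<^esub> y = x - y"
proof -
  have "- y \<in> ops I"
    using closed_star_algebraD(5)[OF closed_star_algebra_ops[of I], of y "-1"] assms by (simp add: cscale_op_minus_one)
  then have "\<ominus>\<^bsub>bounded_operators I\<^esub> y = - y"
    using assms by (intro abelian_group.minus_equality[OF abelian_group_ops]) auto
  then show ?thesis by (simp add: a_minus_def)
qed

lemma finsum_ops:
  assumes "\<And>a. a \<in> A \<Longrightarrow> f a \<in> ops I"
  shows "finsum (bounded_operators I) f A = sum f A"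
proof -
  interpret abelian_group "bounded_operators I" by (rule abelian_group_ops)
  show ?thesis
  proof (cases "finite A")
    case True
    then show ?thesis using assms
      by (induction A) (auto simp: finsum_insert Pi_iff)
  qed (simp add: finsum_infinite)
qed

lemma cstar_subalgebra_ops:
  "cstar_subalgebra B (bounded_operators I) \<longleftrightarrow> B \<subseteq> ops I \<and> closed_star_algebra B"
proof (cases "B \<subseteq> ops I")
  case True
  have "(\<forall>x\<in>ops I. (\<forall>e>0. \<exists>y\<in>B. norm (x \<ominus>\<^bsub>bounded_operators I\<^esub> y) < e) \<longrightarrow> x \<in> B) \<longleftrightarrow>
      (\<forall>x\<in>ops I. x \<in> closure B \<longrightarrow> x \<in> B)"
  proof -
    have "(\<exists>y\<in>B. norm (x \<ominus>\<^bsub>bounded_operators I\<^esub> y) < e) \<longleftrightarrow> (\<exists>y\<in>B. dist y x < e)" if "x \<in> ops I" for x e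
    proof (rule bex_cong[OF refl])
      fix y assume "y \<in> B"
      then show "(norm (x \<ominus>\<^bsub>bounded_operators I\<^esub> y) < e) = (dist y x < e)"
        using minus_ops[OF that subsetD[OF True]] by (simp add: dist_norm norm_minus_commute)
    qed
    then show ?thesis unfolding closure_approachable by simp
  qed
  also have "\<dots> \<longleftrightarrow> closed B"
    using closure_minimal[OF True closed_star_algebraD(7)[OF closed_star_algebra_ops]]
    unfolding closure_subset_eq[symmetric] by blast
  finally show ?thesis
    using True by (auto simp: cstar_subalgebra_def closed_star_algebra_def)
qed (auto simp: cstar_subalgebra_def)

text \<open>Intersecting with \<open>ops I\<close> shows that the ambient algebra does not matter.\<close>
lemma generated_ops:
  assumes "S \<subseteq> ops I"
  shows "cstar_generated (bounded_operators I) S = \<Inter>{B. closed_star_algebra B \<and> S \<subseteq> B}"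
proof -
  note inter = closed_star_algebra_Int[OF _ closed_star_algebra_ops[of I]]
  show ?thesis
  proof (intro equalityI)
    show "cstar_generated (bounded_operators I) S \<subseteq> \<Inter>{B. closed_star_algebra B \<and> S \<subseteq> B}"
    proof (rule Inter_greatest)
      fix B assume "B \<in> {B. closed_star_algebra B \<and> S \<subseteq> B}"
      then have "B \<inter> ops I \<in> {B. cstar_subalgebra B (bounded_operators I) \<and> S \<subseteq> B}"
        using assms inter[of B] by (auto simp: cstar_subalgebra_ops)
      then show "cstar_generated (bounded_operators I) S \<subseteq> B" unfolding cstar_generated_def by auto
    qed
    show "\<Inter>{B. closed_star_algebra B \<and> S \<subseteq> B} \<subseteq> cstar_generated (bounded_operators I) S"
      unfolding cstar_generated_def cstar_subalgebra_ops by (rule Inter_anti_mono) auto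
  qed
qed

lemma generated_ev:
  assumes "clinear_op E" "\<And>g. g \<in> N \<Longrightarrow> clinear_op (z g)"
  shows "\<Inter>{B. closed_star_algebra B \<and> insert E (z ` N) \<subseteq> B} = op_alg E z N"
proof
  show "\<Inter>{B. closed_star_algebra B \<and> insert E (z ` N) \<subseteq> B} \<subseteq> op_alg E z N"
    using closed_star_algebra_ev[OF assms] gen_in_closure(1)[of E z N] gen_in_closure(2)[of _ N z E] by (intro Inter_lower) auto
  show "op_alg E z N \<subseteq> \<Inter>{B. closed_star_algebra B \<and> insert E (z ` N) \<subseteq> B}"
    by (intro Inter_greatest closure_ev_least) auto
qed

subsection \<open>Extension by continuity\<close>

text \<open>
  A limit of \<open>p\<^sub>k(z)\<close> is sent to the limit of \<open>p\<^sub>k(t)\<close>, which exists as the assumption, applied to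
  differences of polynomials, makes this sequence Cauchy. The estimate characterises \<open>\<pi> x\<close>, and all
  algebraic properties of \<open>\<pi>\<close> follow from it.
\<close>
lemma ev_extension:
  fixes z :: "'g \<Rightarrow> 'i op" and t :: "'g \<Rightarrow> 'j op"
  assumes le: "\<And>p. p \<in> star_polys N \<Longrightarrow> norm (ev F t p) \<le> norm (ev E z p)"
  obtains \<pi> where "\<And>x p. x \<in> op_alg E z N \<Longrightarrow> p \<in> star_polys N \<Longrightarrow>
    norm (\<pi> x - ev F t p) \<le> norm (x - ev E z p)"
proof -
  have diff: "norm (ev F t p - ev F t q) \<le> norm (ev E z p - ev E z q)" if "p \<in> star_polys N" "q \<in> star_polys N" for p q
    using le[of "Plus p (Scale (-1) q)"] that by (simp add: cscale_op_minus_one)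
  have "\<exists>y. \<forall>p\<in>star_polys N. norm (y - ev F t p) \<le> norm (x - ev E z p)"
    if x: "x \<in> op_alg E z N" for x
  proof -
    obtain X where "\<And>n. X n \<in> ev E z ` star_polys N" "X \<longlonglongrightarrow> x"
      using x by (auto simp: closure_sequential)
    moreover from this have "\<forall>n. \<exists>p. p \<in> star_polys N \<and> X n = ev E z p" by blast
    then obtain p where p: "\<And>n. p n \<in> star_polys N" "\<And>n. X n = ev E z (p n)"
      using choice[of "\<lambda>n p. p \<in> star_polys N \<and> X n = ev E z p"] by blast
    moreover have "X = (\<lambda>n. ev E z (p n))" using p(2) by (rule ext)
    ultimately have p: "\<And>n. p n \<in> star_polys N" "(\<lambda>n. ev E z (p n)) \<longlonglongrightarrow> x"
      by simp_all
    have "Cauchy (\<lambda>n. ev F t (p n))"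
    proof (rule metric_CauchyI)
      fix e :: real assume "e > 0"
      then obtain M where "\<forall>m\<ge>M. \<forall>n\<ge>M. dist (ev E z (p m)) (ev E z (p n)) < e"
        using metric_CauchyD[OF LIMSEQ_imp_Cauchy[OF p(2)]] by blast
      then show "\<exists>M. \<forall>m\<ge>M. \<forall>n\<ge>M. dist (ev F t (p m)) (ev F t (p n)) < e"
        using le_less_trans[OF diff[OF p(1) p(1)]] unfolding dist_norm by blast
    qed
    then obtain y where y: "(\<lambda>n. ev F t (p n)) \<longlonglongrightarrow> y"
      by (auto simp: Cauchy_convergent_iff convergent_def)
    have "norm (y - ev F t q) \<le> norm (x - ev E z q)" if q: "q \<in> star_polys N" for q
    proof (rule LIMSEQ_le)
      show "(\<lambda>n. norm (ev F t (p n) - ev F t q)) \<longlonglongrightarrow> norm (y - ev F t q)" by (intro tendsto_intros y)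
      show "(\<lambda>n. norm (ev E z (p n) - ev E z q)) \<longlonglongrightarrow> norm (x - ev E z q)" by (intro tendsto_intros p)
      show "\<exists>M. \<forall>n\<ge>M. norm (ev F t (p n) - ev F t q) \<le> norm (ev E z (p n) - ev E z q)"
        using diff[OF p(1) q] by blast
    qed
    then show ?thesis by blast
  qed
  then have "\<exists>\<pi>. \<forall>x. x \<in> op_alg E z N \<longrightarrow>
      (\<forall>p\<in>star_polys N. norm (\<pi> x - ev F t p) \<le> norm (x - ev E z p))"
    by (intro choice) blast
  then show ?thesis using that by blast
qed

section \<open>Recognizing a universal algebra\<close>

context
  fixes R :: "'r set" and J :: "'r \<Rightarrow> 'i set"
begin

abbreviation (input) "PR \<equiv> cstar_product R (\<lambda>r. bounded_operators (J r))"

lemma product_carrier: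
  "f \<in> carrier PR \<longleftrightarrow> f \<in> extensional R \<and> (\<forall>r\<in>R. f r \<in> ops (J r)) \<and> (\<exists>M. \<forall>r\<in>R. norm (f r) \<le> M)"
  unfolding cstar_product_def
  by (simp only: partial_object.simps mem_Collect_eq bounded_operators_simps PiE_iff bdd_above.unfold ball_simps)
    blast

lemma product_simps:
  "f \<otimes>\<^bsub>PR\<^esub> g = (\<lambda>r\<in>R. f r o\<^sub>L g r)" "f \<oplus>\<^bsub>PR\<^esub> g = (\<lambda>r\<in>R. f r + g r)"
  "\<one>\<^bsub>PR\<^esub> = (\<lambda>r\<in>R. proj_op (J r))" "\<zero>\<^bsub>PR\<^esub> = (\<lambda>r\<in>R. 0)"
  "cscale PR c f = (\<lambda>r\<in>R. cscale_op c (f r))" "star PR f = (\<lambda>r\<in>R. adj_op (f r))"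
  "cnorm PR f = (SUP r\<in>R. norm (f r))"
  by (simp_all add: cstar_product_def)

lemma product_carrierI:
  assumes "\<And>r. r \<in> R \<Longrightarrow> f r \<in> ops (J r)" "\<And>r. r \<in> R \<Longrightarrow> norm (f r) \<le> M"
  shows "(\<lambda>r\<in>R. f r) \<in> carrier PR"
  unfolding product_carrier using assms by (intro conjI ballI exI[of _ M]) (simp_all only: restrict_extensional restrict_apply' )

lemma product_carrierD:
  assumes "f \<in> carrier PR"
  shows "r \<in> R \<Longrightarrow> f r \<in> ops (J r)" "f = (\<lambda>r\<in>R. f r)"
  using assms unfolding product_carrier by (auto simp: extensional_restrict)

lemma product_bound:
  assumes "f \<in> carrier PR"
  obtains M where "\<And>r. r \<in> R \<Longrightarrow> norm (f r) \<le> M"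
  using assms unfolding product_carrier by blast

lemma product_minus:
  assumes f: "f \<in> carrier PR" and g: "g \<in> carrier PR"
  shows "f \<ominus>\<^bsub>PR\<^esub> g = (\<lambda>r\<in>R. f r - g r)"
proof -
  have neg: "(\<lambda>r\<in>R. - x r) \<in> carrier PR" if x: "x \<in> carrier PR" for x
  proof -
    obtain M where M: "\<And>r. r \<in> R \<Longrightarrow> norm (x r) \<le> M" using product_bound[OF x] by blast
    show ?thesis
    proof (rule product_carrierI[where M=M])
      fix r assume r: "r \<in> R"
      show "- x r \<in> ops (J r)"
        using closed_star_algebraD(5)[OF closed_star_algebra_ops product_carrierD(1)[OF x r], of "-1"]
        by (simp only: cscale_op_minus_one)
    qed (simp add: M)
  qed
  have ab: "abelian_group PR"
  proof (rule abelian_groupI)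
    fix x y assume x: "x \<in> carrier PR" and y: "y \<in> carrier PR"
    obtain M where M: "\<And>r. r \<in> R \<Longrightarrow> norm (x r) \<le> M" using product_bound[OF x] by blast
    obtain M' where M': "\<And>r. r \<in> R \<Longrightarrow> norm (y r) \<le> M'" using product_bound[OF y] by blast
    show "x \<oplus>\<^bsub>PR\<^esub> y \<in> carrier PR"
      unfolding product_simps
    proof (rule product_carrierI[where M="M + M'"])
      fix r assume r: "r \<in> R"
      show "x r + y r \<in> ops (J r)"
        by (rule closed_star_algebraD(3)[OF closed_star_algebra_ops product_carrierD(1)[OF x r] product_carrierD(1)[OF y r]])
      show "norm (x r + y r) \<le> M + M'"
        using M[OF r] M'[OF r] norm_triangle_ineq[of "x r" "y r"] by linarith
    qed
    show "x \<oplus>\<^bsub>PR\<^esub> y = y \<oplus>\<^bsub>PR\<^esub> x" unfolding product_simps by (simp add: add.commute)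
    show "x \<oplus>\<^bsub>PR\<^esub> y \<oplus>\<^bsub>PR\<^esub> z = x \<oplus>\<^bsub>PR\<^esub> (y \<oplus>\<^bsub>PR\<^esub> z)" for z
      unfolding product_simps by (rule restrict_ext) (simp add: add.assoc)
    show "\<zero>\<^bsub>PR\<^esub> \<oplus>\<^bsub>PR\<^esub> x = x"
      using product_carrierD(2)[OF x] unfolding product_simps by (metis (no_types, lifting) add_0 restrict_apply' restrict_ext)
    show "\<exists>y\<in>carrier PR. y \<oplus>\<^bsub>PR\<^esub> x = \<zero>\<^bsub>PR\<^esub>"
      by (rule bexI[OF _ neg[OF x]]) (unfold product_simps, rule restrict_ext, simp)
  next
    show "\<zero>\<^bsub>PR\<^esub> \<in> carrier PR"
      unfolding product_simps
      by (rule product_carrierI[where M=0]) (rule closed_star_algebraD(2)[OF closed_star_algebra_ops], simp)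
  qed
  have "\<ominus>\<^bsub>PR\<^esub> g = (\<lambda>r\<in>R. - g r)"
    by (rule abelian_group.minus_equality[OF ab _ g neg[OF g]])
      (unfold product_simps, rule restrict_ext, simp)
  then show ?thesis unfolding a_minus_def product_simps by (auto intro: restrict_ext)
qed

lemma product_norm_less:
  assumes f: "f \<in> carrier PR" and g: "g \<in> carrier PR" and "cnorm PR (f \<ominus>\<^bsub>PR\<^esub> g) < e" "r \<in> R"
  shows "norm (f r - g r) < e"
proof -
  obtain M where M: "\<And>r. r \<in> R \<Longrightarrow> norm (f r) \<le> M" using product_bound[OF f] by blast
  obtain M' where M': "\<And>r. r \<in> R \<Longrightarrow> norm (g r) \<le> M'" using product_bound[OF g] by blast
  have bdd: "bdd_above ((\<lambda>r. norm ((\<lambda>r\<in>R. f r - g r) r)) ` R)"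
  proof (rule bdd_aboveI2)
    fix r assume "r \<in> R"
    then show "norm ((\<lambda>r\<in>R. f r - g r) r) \<le> M + M'"
      using M[of r] M'[of r] norm_triangle_ineq4[of "f r" "g r"] by simp
  qed
  have "norm ((\<lambda>r\<in>R. f r - g r) r) \<le> cnorm PR (f \<ominus>\<^bsub>PR\<^esub> g)"
    unfolding product_minus[OF f g] product_simps by (rule cSUP_upper[OF \<open>r \<in> R\<close> bdd])
  then show ?thesis using assms by simp
qed

lemma product_norm_le:
  assumes "f \<in> carrier PR" "g \<in> carrier PR" "R \<noteq> {}" "\<And>r. r \<in> R \<Longrightarrow> norm (f r - g r) \<le> e"
  shows "cnorm PR (f \<ominus>\<^bsub>PR\<^esub> g) \<le> e"
  unfolding product_minus[OF assms(1,2)] product_simps by (rule cSUP_least) (use assms in auto)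

end

lemma proj_in_ops: "proj_op I \<in> ops I"
  by simp

text \<open>
  If the family \<open>z\<close> dominates all representations in norm and one representation is at least as large,
  then the algebra generated by \<open>z\<close> is universal. Each representation extends from polynomials to a
  contractive *-homomorphism \<open>\<pi> r\<close>; together they form a *-homomorphism \<open>h\<close> into the product, which is
  isometric because of the one large representation. Hence its image is closed, and it is the
  subalgebra generated by the universal generators.
\<close>
theorem universal_algebra_isomorphic:
  fixes z :: "nat \<Rightarrow> 'k op" and rels :: "'i op cstar_alg \<Rightarrow> (nat \<Rightarrow> 'i op) \<Rightarrow> bool"
  assumes z: "\<And>i. i \<in> {1..n} \<Longrightarrow> z i \<in> ops L"
    and le: "\<And>I T p. (I, T) \<in> representations TYPE('i) n rels \<Longrightarrow> p \<in> star_polys {1..n} \<Longrightarrow>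
      norm (ev (proj_op I) T p) \<le> norm (ev (proj_op L) z p)"
    and rep: "(I0, T0) \<in> representations TYPE('i) n rels"
    and isometric: "\<And>p. p \<in> star_polys {1..n} \<Longrightarrow> norm (ev (proj_op L) z p) \<le> norm (ev (proj_op I0) T0 p)"
  shows "cstar_isomorphic ((bounded_operators L)\<lparr>carrier := op_alg (proj_op L) z {1..n}\<rparr>)
    (universal_cstar_alg TYPE('i) n rels)"
proof -
  define R where "R = representations TYPE('i) n rels"
  define P where "P = cstar_product R (\<lambda>r. bounded_operators (fst r))"
  define SP where "SP = star_polys {1..n}"
  define e where "e = ev (proj_op L) z"
  define f where "f r = ev (proj_op (fst r)) (snd r)" for r :: "'i set \<times> (nat \<Rightarrow> 'i op)"
  define D where "D = closure (e ` SP)"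
  define u where "u = universal_generator TYPE('i) n rels"
  have r0: "(I0, T0) \<in> R" using rep by (simp add: R_def)
  have le': "norm (f r p) \<le> norm (e p)" if "r \<in> R" "p \<in> SP" for r p
    using le[of "fst r" "snd r" p] that by (simp add: f_def e_def R_def SP_def)
  have gens: "snd r i \<in> ops (fst r)" if "r \<in> R" "i \<in> {1..n}" for r i
  proof -
    have "snd r \<in> (\<Pi>\<^sub>E i\<in>{1..n}. ops (fst r))"
      using that(1) unfolding R_def representations_def by (cases r) (simp only: bounded_operators_simps mem_Collect_eq prod.case fst_conv snd_conv)
    then show ?thesis using that(2) by (rule PiE_mem)
  qed
  have zlin: "clinear_op (z i)" if "i \<in> {1..n}" for i using z[OF that] by simp
  have e_alg: "closed_star_algebra D"
    unfolding D_def e_def SP_def by (rule closed_star_algebra_ev) (auto simp: zlin)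
  have e_ops: "D \<subseteq> ops L"
    unfolding D_def e_def SP_def by (rule closure_ev_least[OF closed_star_algebra_ops proj_in_ops]) (use z in blast)
  have f_ops: "f r p \<in> ops (fst r)" if "r \<in> R" "p \<in> SP" for r p
    unfolding f_def by (rule ev_in[where N="{1..n}", OF closed_star_algebra_ops proj_in_ops])
      (use gens[OF that(1)] that(2) in \<open>auto simp only: SP_def\<close>)
  have "\<exists>\<pi>. \<forall>x\<in>D. \<forall>p\<in>SP. norm (\<pi> x - f r p) \<le> norm (x - e p)" if r: "r \<in> R" for r
    using ev_extension[of "{1..n}" "proj_op (fst r)" "snd r" "proj_op L" z] le'[OF r]
    unfolding D_def e_def SP_def f_def by metis
  then obtain \<pi> where \<pi>: "\<And>r x p. r \<in> R \<Longrightarrow> x \<in> D \<Longrightarrow> p \<in> SP \<Longrightarrow> norm (\<pi> r x - f r p) \<le> norm (x - e p)"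
    by metis
  have seq: "\<exists>p. (\<forall>k. p k \<in> SP) \<and> (\<lambda>k. e (p k)) \<longlonglongrightarrow> x" if "x \<in> D" for x
  proof -
    obtain X where X: "\<And>k. X k \<in> e ` SP" "X \<longlonglongrightarrow> x"
      using \<open>x \<in> D\<close> unfolding D_def closure_sequential by blast
    have "\<forall>k. \<exists>p. p \<in> SP \<and> X k = e p" using X(1) by blast
    then obtain p where p: "\<And>k. p k \<in> SP" "\<And>k. X k = e (p k)"
      using choice[of "\<lambda>k p. p \<in> SP \<and> X k = e p"] by blast
    then have "X = (\<lambda>k. e (p k))" by (intro ext)
    then show ?thesis using p X by auto
  qed
  have lim: "(\<lambda>k. f r (p k)) \<longlonglongrightarrow> \<pi> r x" if "r \<in> R" "x \<in> D" "\<And>k. p k \<in> SP" "(\<lambda>k. e (p k)) \<longlonglongrightarrow> x" for r x p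
  proof (rule LIM_zero_cancel, rule Lim_null_comparison)
    show "(\<lambda>k. norm (e (p k) - x)) \<longlonglongrightarrow> 0" using LIM_zero[OF that(4)] tendsto_norm_zero by blast
    show "\<forall>\<^sub>F k in sequentially. norm (f r (p k) - \<pi> r x) \<le> norm (e (p k) - x)"
      using \<pi>[OF that(1,2,3)] by (simp add: norm_minus_commute)
  qed
  have \<pi>_e: "\<pi> r (e p) = f r p" if "r \<in> R" "p \<in> SP" for r p
    using \<pi>[OF that(1) _ that(2), of "e p"] that(2) closure_subset[of "e ` SP"] by (auto simp: D_def)
  have e_in: "e p \<in> D" if "p \<in> SP" for p
    using that closure_subset[of "e ` SP"] by (auto simp: D_def)
  have SP: "Unit \<in> SP" "\<And>p q. p \<in> SP \<Longrightarrow> q \<in> SP \<Longrightarrow> Plus p q \<in> SP" "\<And>p q. p \<in> SP \<Longrightarrow> q \<in> SP \<Longrightarrow> Times p q \<in> SP"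
    "\<And>p c. p \<in> SP \<Longrightarrow> Scale c p \<in> SP" "\<And>p. p \<in> SP \<Longrightarrow> Star p \<in> SP" "\<And>i. i \<in> {1..n} \<Longrightarrow> Gen i \<in> SP"
    by (auto simp: SP_def)
  have \<pi>_lin: "clinear_op (\<pi> r x)" and \<pi>_ops: "\<pi> r x \<in> ops (fst r)" and \<pi>_norm: "norm (\<pi> r x) \<le> norm x"
    if r: "r \<in> R" and x: "x \<in> D" for r x
  proof -
    obtain p where p: "\<And>k. p k \<in> SP" "(\<lambda>k. e (p k)) \<longlonglongrightarrow> x" using seq[OF x] by blast
    note l = lim[OF r x p]
    show ops: "\<pi> r x \<in> ops (fst r)"
      by (rule closed_sequentially[OF closed_star_algebraD(7)[OF closed_star_algebra_ops] _ l])
        (rule f_ops[OF r p(1)])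
    show "clinear_op (\<pi> r x)" by (rule closed_star_algebraD(1)[OF closed_star_algebra_ops ops])
    show "norm (\<pi> r x) \<le> norm x"
      by (rule LIMSEQ_le[OF tendsto_norm[OF l] tendsto_norm[OF p(2)]]) (use le'[OF r p(1)] in blast)
  qed
  have \<pi>_iso: "norm x \<le> norm (\<pi> (I0, T0) x)" if x: "x \<in> D" for x
  proof -
    obtain p where p: "\<And>k. p k \<in> SP" "(\<lambda>k. e (p k)) \<longlonglongrightarrow> x" using seq[OF x] by blast
    have "norm (e (p k)) \<le> norm (f (I0, T0) (p k))" for k
      using isometric p(1)[of k] by (simp add: e_def f_def SP_def)
    then show ?thesis
      by (intro LIMSEQ_le[OF tendsto_norm[OF p(2)] tendsto_norm[OF lim[OF r0 x p]]]) blast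
  qed
  have \<pi>_plus: "\<pi> r (x + y) = \<pi> r x + \<pi> r y" and \<pi>_times: "\<pi> r (x o\<^sub>L y) = \<pi> r x o\<^sub>L \<pi> r y"
    if r: "r \<in> R" and x: "x \<in> D" and y: "y \<in> D" for r x y
  proof -
    obtain p where p: "\<And>k. p k \<in> SP" "(\<lambda>k. e (p k)) \<longlonglongrightarrow> x" using seq[OF x] by blast
    obtain q where q: "\<And>k. q k \<in> SP" "(\<lambda>k. e (q k)) \<longlonglongrightarrow> y" using seq[OF y] by blast
    have "(\<lambda>k. f r (Plus (p k) (q k))) \<longlonglongrightarrow> \<pi> r (x + y)"
      using tendsto_add[OF p(2) q(2)]
      by (intro lim[OF r closed_star_algebraD(3)[OF e_alg x y]] SP(2) p(1) q(1)) (simp add: e_def)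
    moreover have "(\<lambda>k. f r (Plus (p k) (q k))) \<longlonglongrightarrow> \<pi> r x + \<pi> r y"
      using tendsto_add[OF lim[OF r x p] lim[OF r y q]] by (simp add: f_def)
    ultimately show "\<pi> r (x + y) = \<pi> r x + \<pi> r y" by (rule LIMSEQ_unique)
    have "(\<lambda>k. f r (Times (p k) (q k))) \<longlonglongrightarrow> \<pi> r (x o\<^sub>L y)"
      using bounded_bilinear.tendsto[OF bounded_bilinear_blinfun_compose p(2) q(2)]
      by (intro lim[OF r closed_star_algebraD(4)[OF e_alg x y]] SP(3) p(1) q(1)) (simp add: e_def)
    moreover have "(\<lambda>k. f r (Times (p k) (q k))) \<longlonglongrightarrow> (\<pi> r x o\<^sub>L \<pi> r y)"
      using bounded_bilinear.tendsto[OF bounded_bilinear_blinfun_compose lim[OF r x p] lim[OF r y q]] by (simp add: f_def)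
    ultimately show "\<pi> r (x o\<^sub>L y) = \<pi> r x o\<^sub>L \<pi> r y" by (rule LIMSEQ_unique)
  qed
  have \<pi>_scale: "\<pi> r (cscale_op c x) = cscale_op c (\<pi> r x)" and \<pi>_star: "\<pi> r (adj_op x) = adj_op (\<pi> r x)"
    if r: "r \<in> R" and x: "x \<in> D" for r x c
  proof -
    obtain p where p: "\<And>k. p k \<in> SP" "(\<lambda>k. e (p k)) \<longlonglongrightarrow> x" using seq[OF x] by blast
    have "(\<lambda>k. f r (Scale c (p k))) \<longlonglongrightarrow> \<pi> r (cscale_op c x)"
      using tendsto_cscale_op[OF p(2), of c]
      by (intro lim[OF r closed_star_algebraD(5)[OF e_alg x]] SP(4) p(1)) (simp add: e_def)
    moreover have "(\<lambda>k. f r (Scale c (p k))) \<longlonglongrightarrow> cscale_op c (\<pi> r x)"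
      using tendsto_cscale_op[OF lim[OF r x p], of c] by (simp add: f_def)
    ultimately show "\<pi> r (cscale_op c x) = cscale_op c (\<pi> r x)" by (rule LIMSEQ_unique)
    have "(\<lambda>k. e (Star (p k))) \<longlonglongrightarrow> adj_op x"
      using tendsto_adj_op[OF p(2) closed_star_algebraD(1)[OF e_alg e_in[OF p(1)]] closed_star_algebraD(1)[OF e_alg x]]
      by (simp add: e_def)
    then have "(\<lambda>k. f r (Star (p k))) \<longlonglongrightarrow> \<pi> r (adj_op x)"
      by (rule lim[OF r closed_star_algebraD(6)[OF e_alg x] SP(5)[OF p(1)]])
    moreover have "(\<lambda>k. f r (Star (p k))) \<longlonglongrightarrow> adj_op (\<pi> r x)"
      using tendsto_adj_op[OF lim[OF r x p] closed_star_algebraD(1)[OF closed_star_algebra_ops f_ops[OF r p(1)]] \<pi>_lin[OF r x]]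
      by (simp add: f_def)
    ultimately show "\<pi> r (adj_op x) = adj_op (\<pi> r x)" by (rule LIMSEQ_unique)
  qed
  have \<pi>_diff: "\<pi> r (x - y) = \<pi> r x - \<pi> r y" if "r \<in> R" "x \<in> D" "y \<in> D" for r x y
    using \<pi>_plus[OF that(1,2) closed_star_algebraD(5)[OF e_alg that(3), of "-1"]] \<pi>_scale[OF that(1,3), of "-1"]
    by (simp add: cscale_op_minus_one)
  define h where "h x = (\<lambda>r\<in>R. \<pi> r x)" for x
  have h_carrier: "h x \<in> carrier P" if "x \<in> D" for x
    unfolding h_def P_def by (rule product_carrierI[where M="norm x"]) (use \<pi>_ops \<pi>_norm that in blast)+
  have h_apply: "h x r = \<pi> r x" if "r \<in> R" for x r using that by (simp add: h_def)
  note Psimps = product_simps[where R=R and J=fst, folded P_def]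
  have h_mult: "h (x o\<^sub>L y) = h x \<otimes>\<^bsub>P\<^esub> h y" and h_plus: "h (x + y) = h x \<oplus>\<^bsub>P\<^esub> h y" if "x \<in> D" "y \<in> D" for x y
    unfolding Psimps unfolding h_def by (rule restrict_ext; use that in \<open>simp add: \<pi>_times \<pi>_plus\<close>)+
  have h_scale: "h (cscale_op c x) = cscale P c (h x)" and h_star: "h (adj_op x) = star P (h x)" if "x \<in> D" for c x
    unfolding Psimps unfolding h_def by (rule restrict_ext; use that in \<open>simp add: \<pi>_scale \<pi>_star\<close>)+
  have h_one: "h (proj_op L) = \<one>\<^bsub>P\<^esub>"
    unfolding Psimps unfolding h_def
    by (rule restrict_ext) (use \<pi>_e[OF _ SP(1)] in \<open>simp add: e_def f_def\<close>)
  have h_zero: "h 0 = \<zero>\<^bsub>P\<^esub>"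
    unfolding Psimps unfolding h_def
    by (rule restrict_ext) (use \<pi>_scale[OF _ closed_star_algebraD(2)[OF e_alg], of _ 0] in \<open>simp add: cscale_op_zero\<close>)
  have h_gen: "h (z i) = u i" if "i \<in> {1..n}" for i
    unfolding u_def universal_generator_def R_def[symmetric] h_def
    by (rule restrict_ext) (use \<pi>_e[OF _ SP(6)[OF that]] in \<open>simp add: e_def f_def split_def\<close>)
  have h_inj: "inj_on h D"
  proof (rule inj_onI)
    fix x y assume xy: "x \<in> D" "y \<in> D" "h x = h y"
    then have "\<pi> (I0, T0) (x - y) = 0"
      using h_apply[OF r0, of x] h_apply[OF r0, of y] \<pi>_diff[OF r0 xy(1,2)] by simp
    then show "x = y" using \<pi>_iso[OF closed_star_algebraD(9)[OF e_alg xy(1,2)]] by simp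
  qed
  let ?S = "insert \<one>\<^bsub>P\<^esub> (u ` {1..n})"
  \<comment> \<open>For closedness, preimages of a convergent sequence in the image are Cauchy as \<open>\<pi> (I0, T0)\<close> is isometric.\<close>
  have h_sub: "cstar_subalgebra (h ` D) P"
    unfolding cstar_subalgebra_def
  proof (intro conjI ballI allI impI)
    show "h ` D \<subseteq> carrier P" using h_carrier by blast
    show "\<zero>\<^bsub>P\<^esub> \<in> h ` D" using h_zero closed_star_algebraD(2)[OF e_alg] by (metis imageI)
    show "a \<oplus>\<^bsub>P\<^esub> b \<in> h ` D" if "a \<in> h ` D" "b \<in> h ` D" for a b
      using that by (auto simp: h_plus[symmetric] intro!: imageI closed_star_algebraD(3)[OF e_alg])
    show "a \<otimes>\<^bsub>P\<^esub> b \<in> h ` D" if "a \<in> h ` D" "b \<in> h ` D" for a b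
      using that by (auto simp: h_mult[symmetric] intro!: imageI closed_star_algebraD(4)[OF e_alg])
    show "cscale P c a \<in> h ` D" if "a \<in> h ` D" for c a
      using that by (auto simp: h_scale[symmetric] intro!: imageI closed_star_algebraD(5)[OF e_alg])
    show "star P a \<in> h ` D" if "a \<in> h ` D" for a
      using that by (auto simp: h_star[symmetric] intro!: imageI closed_star_algebraD(6)[OF e_alg])
    fix a assume a: "a \<in> carrier P" and ap: "\<forall>e>0. \<exists>b\<in>h ` D. cnorm P (a \<ominus>\<^bsub>P\<^esub> b) < e"
    have "\<forall>k. \<exists>x. x \<in> D \<and> cnorm P (a \<ominus>\<^bsub>P\<^esub> h x) < 1 / Suc k"
    proof
      fix k show "\<exists>x. x \<in> D \<and> cnorm P (a \<ominus>\<^bsub>P\<^esub> h x) < 1 / Suc k"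
        using ap[rule_format, of "1 / Suc k"] by auto
    qed
    then obtain X where X: "\<And>k. X k \<in> D" "\<And>k. cnorm P (a \<ominus>\<^bsub>P\<^esub> h (X k)) < 1 / Suc k"
      using choice[of "\<lambda>k x. x \<in> D \<and> cnorm P (a \<ominus>\<^bsub>P\<^esub> h x) < 1 / Suc k"] by blast
    have close: "norm (a r - \<pi> r (X k)) < 1 / Suc k" if r: "r \<in> R" for r k
      using product_norm_less[OF a[unfolded P_def] h_carrier[OF X(1), unfolded P_def] X(2)[unfolded P_def] r]
      by (simp add: h_apply[OF r])
    have to_a: "(\<lambda>k. \<pi> r (X k)) \<longlonglongrightarrow> a r" if r: "r \<in> R" for r
    proof (rule LIM_zero_cancel, rule Lim_null_comparison)
      show "(\<lambda>k. 1 / real (Suc k)) \<longlonglongrightarrow> 0" by (rule LIMSEQ_Suc[OF lim_1_over_n])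
      show "\<forall>\<^sub>F k in sequentially. norm (\<pi> r (X k) - a r) \<le> 1 / real (Suc k)"
        using close[OF r] by (simp add: norm_minus_commute less_imp_le)
    qed
    have "Cauchy X"
    proof (rule metric_CauchyI)
      fix d :: real assume "d > 0"
      then obtain M where M: "\<forall>j\<ge>M. \<forall>k\<ge>M. dist (\<pi> (I0, T0) (X j)) (\<pi> (I0, T0) (X k)) < d"
        using metric_CauchyD[OF LIMSEQ_imp_Cauchy[OF to_a[OF r0]]] by blast
      have "dist (X j) (X k) \<le> dist (\<pi> (I0, T0) (X j)) (\<pi> (I0, T0) (X k))" for j k
        using \<pi>_iso[OF closed_star_algebraD(9)[OF e_alg X(1) X(1)], of j k] \<pi>_diff[OF r0 X(1) X(1), of j k]
        by (simp add: dist_norm)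
      then show "\<exists>M. \<forall>j\<ge>M. \<forall>k\<ge>M. dist (X j) (X k) < d" using M le_less_trans by blast
    qed
    then obtain x where x: "X \<longlonglongrightarrow> x" using Cauchy_convergent convergent_def by blast
    have xD: "x \<in> D" by (rule closed_sequentially[OF closed_star_algebraD(7)[OF e_alg] X(1) x])
    have "\<pi> r x = a r" if r: "r \<in> R" for r
    proof (rule LIMSEQ_unique[OF _ to_a[OF r]])
      show "(\<lambda>k. \<pi> r (X k)) \<longlonglongrightarrow> \<pi> r x"
      proof (rule LIM_zero_cancel, rule Lim_null_comparison)
        show "(\<lambda>k. norm (X k - x)) \<longlonglongrightarrow> 0" using LIM_zero[OF x] tendsto_norm_zero by blast
        show "\<forall>\<^sub>F k in sequentially. norm (\<pi> r (X k) - \<pi> r x) \<le> norm (X k - x)"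
          using \<pi>_norm[OF r closed_star_algebraD(9)[OF e_alg X(1) xD]] \<pi>_diff[OF r X(1) xD] by simp
      qed
    qed
    then have "h x = a"
      using product_carrierD(2)[OF a[unfolded P_def]] unfolding h_def by (metis (no_types, lifting) restrict_ext)
    then show "a \<in> h ` D" using xD by blast
  qed
  have h_least: "h x \<in> B" if B: "cstar_subalgebra B P" "?S \<subseteq> B" and x: "x \<in> D" for B x
  proof -
    note BD = B(1)[unfolded cstar_subalgebra_def]
    have poly: "h (e p) \<in> B" if "p \<in> SP" for p
      using that
    proof (induction p)
      case (Gen i)
      then have "i \<in> {1..n}" by (auto simp: SP_def)
      then show ?case using h_gen B(2) by (auto simp: e_def)
    next
      case Unit then show ?case using h_one B(2) by (auto simp: e_def)
    next
      case (Plus p q)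
      then have pq: "p \<in> SP" "q \<in> SP" by (auto simp: SP_def)
      then show ?case using Plus BD h_plus[OF e_in e_in, of p q] by (auto simp: e_def)
    next
      case (Times p q)
      then have pq: "p \<in> SP" "q \<in> SP" by (auto simp: SP_def)
      then show ?case using Times BD h_mult[OF e_in e_in, of p q] by (auto simp: e_def)
    next
      case (Scale c p)
      then have pq: "p \<in> SP" by (auto simp: SP_def)
      then show ?case using Scale BD h_scale[OF e_in, of p c] by (auto simp: e_def)
    next
      case (Star p)
      then have pq: "p \<in> SP" by (auto simp: SP_def)
      then show ?case using Star BD h_star[OF e_in, of p] by (auto simp: e_def)
    qed
    have "\<exists>b\<in>B. cnorm P (h x \<ominus>\<^bsub>P\<^esub> b) < d" if "d > 0" for d
    proof -
      obtain p where p: "p \<in> SP" "norm (x - e p) < d"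
        using x \<open>d > 0\<close> unfolding D_def closure_approachable by (auto simp: dist_norm norm_minus_commute)
      have "cnorm P (h x \<ominus>\<^bsub>P\<^esub> h (e p)) \<le> norm (x - e p)"
        unfolding P_def
      proof (rule product_norm_le)
        show "h x \<in> carrier (cstar_product R (\<lambda>r. bounded_operators (fst r)))"
          "h (e p) \<in> carrier (cstar_product R (\<lambda>r. bounded_operators (fst r)))"
          using h_carrier[OF x] h_carrier[OF e_in[OF p(1)]] unfolding P_def by blast+
        show "R \<noteq> {}" using r0 by blast
        show "norm (h x r - h (e p) r) \<le> norm (x - e p)" if r: "r \<in> R" for r
          using \<pi>[OF r x p(1)] by (simp add: h_apply[OF r] \<pi>_e[OF r p(1)])
      qed
      then show ?thesis using p poly[OF p(1)] by (meson le_less_trans)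
    qed
    then show ?thesis using BD h_carrier[OF x] by blast
  qed
  have zD: "z i \<in> D" if "i \<in> {1..n}" for i
    using e_in[OF SP(6)[OF that]] by (simp add: e_def)
  have oneD: "proj_op L \<in> D" using e_in[OF SP(1)] by (simp add: e_def)
  have image: "h ` D = cstar_generated P ?S"
  proof
    have "u i \<in> h ` D" if "i \<in> {1..n}" for i
      using imageI[OF zD[OF that], of h] unfolding h_gen[OF that] .
    moreover have "\<one>\<^bsub>P\<^esub> \<in> h ` D" using imageI[OF oneD, of h] unfolding h_one .
    ultimately have "?S \<subseteq> h ` D" by blast
    then show "cstar_generated P ?S \<subseteq> h ` D"
      unfolding cstar_generated_def by (intro Inter_lower) (simp add: h_sub)
    show "h ` D \<subseteq> cstar_generated P ?S" unfolding cstar_generated_def using h_least by auto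
  qed
  have U: "universal_cstar_alg TYPE('i) n rels = P\<lparr>carrier := h ` D\<rparr>"
    unfolding image universal_cstar_alg_def Let_def P_def R_def u_def by (simp add: split_def)
  have "h \<in> ring_iso ((bounded_operators L)\<lparr>carrier := D\<rparr>) (P\<lparr>carrier := h ` D\<rparr>)"
    unfolding ring_iso_def
  proof (intro CollectI conjI ring_hom_memI)
    show "bij_betw h (carrier ((bounded_operators L)\<lparr>carrier := D\<rparr>)) (carrier (P\<lparr>carrier := h ` D\<rparr>))"
      using h_inj by (simp add: bij_betw_def)
  qed (simp_all add: h_mult h_plus h_one)
  then show ?thesis
    unfolding cstar_isomorphic_def U D_def[unfolded e_def SP_def, symmetric]
    by (rule rev_bexI) (simp add: h_scale h_star)
qed

section \<open>The Wold decomposition of a q-oscillator\<close>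

primrec opow :: "'i op \<Rightarrow> nat \<Rightarrow> 'i op" where
  "opow A 0 = id_blinfun"
| "opow A (Suc k) = A o\<^sub>L opow A k"

lemma opow_apply [simp]: "blinfun_apply (opow A 0) x = x"
  "blinfun_apply (opow A (Suc k)) x = blinfun_apply A (blinfun_apply (opow A k) x)"
  by simp_all

lemma opow_shift: "blinfun_apply (opow A k) (blinfun_apply A x) = blinfun_apply A (blinfun_apply (opow A k) x)"
  by (induction k) simp_all

lemma opow_Suc_right: "opow A (Suc k) = opow A k o\<^sub>L A"
  by (rule blinfun_eqI) (simp add: opow_shift)

lemma opow_add: "blinfun_apply (opow A (j + k)) x = blinfun_apply (opow A j) (blinfun_apply (opow A k) x)"
  by (induction j) simp_all

lemma clinear_opow [simp, intro]: "clinear_op A \<Longrightarrow> clinear_op (opow A k)"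
  by (induction k) auto

lemma adj_opow: "clinear_op A \<Longrightarrow> adj_op (opow A k) = opow (adj_op A) k"
proof (induction k)
  case (Suc k)
  then show ?case using opow_Suc_right[of "adj_op A" k] by simp
qed simp

lemma opow_contraction:
  assumes "\<And>x. norm (blinfun_apply A x) \<le> norm x"
  shows "norm (blinfun_apply (opow A k) x) \<le> norm x"
  by (induction k) (use assms order_trans in auto)

text \<open>The q-shifted factorial \<open>(q; q)\<^sub>k\<close>, which is \<open>\<parallel>W\<^sup>k \<xi>\<^sub>0\<parallel>\<^sup>2\<close> for the weighted shift \<open>W\<close>.\<close>
definition qfac :: "real \<Rightarrow> nat \<Rightarrow> real" where
  "qfac q k = (\<Prod>j<k. 1 - q ^ Suc j)"

lemma qfac_simps [simp]: "qfac q 0 = 1" "qfac q (Suc k) = qfac q k * (1 - q ^ Suc k)"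
  by (simp_all add: qfac_def)

lemma qfac_pos: "0 < q \<Longrightarrow> q < 1 \<Longrightarrow> 0 < qfac q k"
  unfolding qfac_def by (intro prod_pos) (simp add: power_Suc_less_one del: power_Suc)

definition is_projection :: "'i op \<Rightarrow> bool" where
  "is_projection E \<longleftrightarrow> clinear_op E \<and> E o\<^sub>L E = E \<and> adj_op E = E"

lemma projection_norm:
  assumes "is_projection E"
  shows "(norm (blinfun_apply E x))\<^sup>2 = inner x (blinfun_apply E x)"
    "norm (blinfun_apply E x) \<le> norm x"
    "blinfun_apply E (blinfun_apply E x) = blinfun_apply E x"
proof -
  have E: "clinear_op E" "adj_op E = E" using assms by (auto simp: is_projection_def)
  show EE: "blinfun_apply E (blinfun_apply E x) = blinfun_apply E x"
    using assms unfolding is_projection_def by (metis blinfun_apply_blinfun_compose)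
  show *: "(norm (blinfun_apply E x))\<^sup>2 = inner x (blinfun_apply E x)"
    using inner_adj[OF E(1), of x "blinfun_apply E x"] by (simp add: E(2) EE power2_norm_eq_inner)
  have "norm (blinfun_apply E x) * norm (blinfun_apply E x) \<le> norm x * norm (blinfun_apply E x)"
    using * norm_cauchy_schwarz[of x "blinfun_apply E x"] by (simp add: power2_eq_square)
  then show "norm (blinfun_apply E x) \<le> norm x"
    by (cases "norm (blinfun_apply E x) = 0") auto
qed

lemma orthogonal_series:
  fixes f :: "nat \<Rightarrow> 'a :: {real_inner, banach}"
  assumes orth: "\<And>k l. k \<noteq> l \<Longrightarrow> inner (f k) (f l) = 0" and sm: "summable (\<lambda>k. (norm (f k))\<^sup>2)"
  shows "summable f"
proof (rule summable_Cauchy[THEN iffD2], intro allI impI)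
  have pyth: "(norm (sum f {m..<n}))\<^sup>2 = (\<Sum>k=m..<n. (norm (f k))\<^sup>2)" for m n
  proof (induction n)
    case (Suc n)
    have "inner (sum f {m..<n}) (f n) = 0" by (simp add: inner_sum_left orth)
    then show ?case
      using Suc by (auto simp: power2_norm_eq_inner inner_add_left inner_add_right inner_commute)
  qed simp
  fix e :: real assume "e > 0"
  then obtain N where N: "\<And>m n. m \<ge> N \<Longrightarrow> norm (\<Sum>k=m..<n. (norm (f k))\<^sup>2) < e\<^sup>2"
    using sm[unfolded summable_Cauchy, rule_format, of "e\<^sup>2"] by auto
  show "\<exists>N. \<forall>m\<ge>N. \<forall>n. norm (sum f {m..<n}) < e"
  proof (intro exI[of _ N] allI impI)
    fix m n assume "m \<ge> N"
    then have "(norm (sum f {m..<n}))\<^sup>2 < e\<^sup>2" using N[of m n] pyth[of m n] by simp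
    then show "norm (sum f {m..<n}) < e" using \<open>e > 0\<close> by (simp add: power_less_imp_less_base)
  qed
qed

text \<open>
  The relation of a single generator, in the corner of a projection \<open>E\<close>. Everything is expressed by
  \<open>S = E - T T\<^sup>*\<close>, which satisfies \<open>S T = q T S\<close>: in the weighted shift it is the diagonal operator \<open>q\<^sup>k\<close>, and
  on a unitary it is \<open>0\<close>.
\<close>
locale q_oscillator =
  fixes q :: real and E T :: "'i op"
  assumes q: "0 < q" "q < 1" and E: "is_projection E"
    and T: "clinear_op T" "E o\<^sub>L T = T" "T o\<^sub>L E = T"
    and rel: "(adj_op T o\<^sub>L T) - q *\<^sub>R (T o\<^sub>L adj_op T) = (1 - q) *\<^sub>R E"
begin

abbreviation "T' \<equiv> adj_op T"
definition "S = E - (T o\<^sub>L T')"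

lemma E_lin: "clinear_op E" and E_adj: "adj_op E = E"
  using E by (auto simp: is_projection_def)

lemma T'_lin: "clinear_op T'" using T by auto

lemma E_T: "E (T x) = T x" "T (E x) = T x" "E (T' x) = T' x" "T' (E x) = T' x" "E (E x) = E x"
proof -
  show "E (T x) = T x" "T (E x) = T x" using T by (metis blinfun_apply_blinfun_compose)+
  have "E o\<^sub>L T' = T'" "T' o\<^sub>L E = T'"
    using adj_compose[OF T(1) E_lin] adj_compose[OF E_lin T(1)] T E_adj by simp_all
  then show "E (T' x) = T' x" "T' (E x) = T' x" by (metis blinfun_apply_blinfun_compose)+
  show "E (E x) = E x" using projection_norm(3)[OF E] .
qed

lemma T'_T: "T' (T x) = q *\<^sub>R T (T' x) + (1 - q) *\<^sub>R E x"
  using arg_cong[OF rel, of "\<lambda>X. X x"]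
  by (simp add: minus_blinfun.rep_eq scaleR_blinfun.rep_eq) (simp add: diff_eq_eq add.commute)

lemma S_apply: "S x = E x - T (T' x)"
  by (simp add: S_def minus_blinfun.rep_eq)

lemma S_lin: "clinear_op S" and S_adj: "adj_op S = S"
  by (simp_all add: S_def E_lin T'_lin T E_adj)

lemma inner_T: "inner (T' x) y = inner x (T y)" "inner (T x) y = inner x (T' y)"
  using inner_adj[OF T(1)] inner_adj_right[OF T(1)] by simp_all

lemma inner_E: "inner (E x) y = inner x (E y)" and inner_S: "inner (S x) y = inner x (S y)"
  using inner_adj[OF E_lin] inner_adj[OF S_lin] by (simp_all add: E_adj S_adj)

lemma norm_E: "norm (E x) \<le> norm x"
  by (rule projection_norm(2)[OF E])

text \<open>The relation gives \<open>\<parallel>T\<parallel>\<^sup>2 \<le> q \<parallel>T\<parallel>\<^sup>2 + (1 - q)\<close>.\<close>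
lemma norm_T_le: "norm T \<le> 1"
proof -
  have le: "norm (T x) \<le> sqrt (q * (norm T)\<^sup>2 + (1 - q)) * norm x" for x
  proof (rule power2_le_imp_le)
    have "(norm (T x))\<^sup>2 = inner x (T' (T x))" by (simp add: power2_norm_eq_inner inner_T)
    also have "\<dots> = q * (norm (T' x))\<^sup>2 + (1 - q) * (norm (E x))\<^sup>2"
      by (simp add: T'_T inner_add_right projection_norm(1)[OF E]) (simp add: power2_norm_eq_inner inner_T)
    also have "\<dots> \<le> q * (norm T * norm x)\<^sup>2 + (1 - q) * (norm x)\<^sup>2"
      using norm_blinfun[of T' x] q norm_E[of x]
      by (intro add_mono mult_left_mono power_mono) (simp_all add: T)
    also have "\<dots> = (q * (norm T)\<^sup>2 + (1 - q)) * (norm x)\<^sup>2" by (simp add: algebra_simps power_mult_distrib)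
    finally show "(norm (T x))\<^sup>2 \<le> (sqrt (q * (norm T)\<^sup>2 + (1 - q)) * norm x)\<^sup>2"
      using q by (simp add: power_mult_distrib)
  qed (use q in simp)
  have "norm T \<le> sqrt (q * (norm T)\<^sup>2 + (1 - q))"
    by (rule norm_blinfun_bound) (use q le in simp_all)
  then have "(norm T)\<^sup>2 \<le> q * (norm T)\<^sup>2 + (1 - q)"
    using q by (metis norm_ge_zero power_mono real_sqrt_pow2 add_nonneg_nonneg diff_ge_0_iff_ge less_imp_le mult_nonneg_nonneg zero_le_power2)
  then have "(1 - q) * (norm T)\<^sup>2 \<le> (1 - q) * 1" by (simp add: algebra_simps)
  then have "(norm T)\<^sup>2 \<le> 1\<^sup>2" using q by simp
  then show ?thesis by (rule power2_le_imp_le) simp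
qed

lemma norm_Tx: "norm (T x) \<le> norm x" and norm_T'x: "norm (T' x) \<le> norm x"
proof -
  show "norm (T x) \<le> norm x"
    using norm_blinfun[of T x] mult_right_mono[OF norm_T_le, of "norm x"] by simp
  show "norm (T' x) \<le> norm x"
    using norm_blinfun[of T' x] mult_right_mono[OF norm_T_le, of "norm x"] by (simp add: T)
qed

lemma norm_Sx: "norm (S x) \<le> norm x"
proof (rule power2_le_imp_le)
  have "(norm (S x))\<^sup>2 = (norm (E x))\<^sup>2 - 2 * inner (E x) (T (T' x)) + (norm (T (T' x)))\<^sup>2"
    by (simp add: S_apply power2_norm_eq_inner inner_diff_left inner_diff_right inner_commute)
  also have "inner (E x) (T (T' x)) = (norm (T' x))\<^sup>2"
    by (simp add: inner_E E_T power2_norm_eq_inner inner_T)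
  also have "(norm (T (T' x)))\<^sup>2 \<le> (norm (T' x))\<^sup>2" by (intro power_mono norm_Tx) simp
  finally have "(norm (S x))\<^sup>2 \<le> (norm (E x))\<^sup>2 - (norm (T' x))\<^sup>2" by (simp del: power2_le_iff_abs_le abs_norm_cancel power_mono_iff)
  then have "(norm (S x))\<^sup>2 \<le> (norm (E x))\<^sup>2" using zero_le_power2[of "norm (T' x)"] by linarith
  also have "\<dots> \<le> (norm x)\<^sup>2" by (intro power_mono norm_E) simp
  finally show "(norm (S x))\<^sup>2 \<le> (norm x)\<^sup>2" .
qed simp

lemma S_T: "S (T x) = q *\<^sub>R T (S x)"
  by (simp add: S_apply T'_T E_T blinfun.bilinear_simps algebra_simps)

lemma T'_S: "T' (S x) = q *\<^sub>R S (T' x)"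
  by (simp add: S_apply T'_T E_T blinfun.bilinear_simps algebra_simps)

lemma E_S: "E (S x) = S x" "S (E x) = S x"
  by (simp_all add: S_apply E_T blinfun.bilinear_simps)

lemma T'_T_S: "T' (T x) = E x - q *\<^sub>R S x"
  by (simp add: S_apply T'_T algebra_simps)

lemma Spow_T: "opow S m (T x) = q ^ m *\<^sub>R T (opow S m x)"
  by (induction m) (simp_all add: S_T blinfun.bilinear_simps)

lemma Spow_inner: "inner (opow S m x) y = inner x (opow S m y)"
  by (induction m arbitrary: x y) (simp_all add: inner_S opow_shift)

lemma norm_Spow_T: "norm (opow S m (T x)) \<le> q ^ m * norm x"
  using q order.trans[OF norm_Tx opow_contraction[OF norm_Sx]]
  by (simp add: Spow_T mult_left_mono)

lemma Spow_diff: "opow S (Suc m) x = opow S m (E x) - opow S m (T (T' x))"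
  by (simp add: opow_shift[symmetric] S_apply blinfun.bilinear_simps)

text \<open>
  The projection onto the kernel of \<open>T'\<close> is the norm limit of the powers of \<open>S\<close>: since
  \<open>S\<^sup>m - S\<^bsup>m+1\<^esup> = S\<^sup>m T T\<^sup>* = q\<^sup>m T S\<^sup>m T\<^sup>*\<close>, they converge geometrically. As a limit of powers of \<open>S\<close>, it commutes
  with whatever commutes with \<open>S\<close>.
\<close>
definition "P0 = lim (\<lambda>m. opow S (Suc m))"

lemma P0_lim: "(\<lambda>m. opow S (Suc m)) \<longlonglongrightarrow> P0"
proof -
  let ?X = "\<lambda>m. opow S (Suc m)"
  have le: "norm (?X (Suc m) - ?X m) \<le> q ^ m" for m
  proof (rule norm_blinfun_bound)
    fix x
    have "?X (Suc m) x - ?X m x = - opow S (Suc m) (T (T' x))"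
      by (simp only: Spow_diff[of "Suc m" x] opow_Suc_right[of S m] blinfun_apply_blinfun_compose E_S) simp
    moreover have "norm (opow S (Suc m) (T (T' x))) \<le> q ^ m * norm x"
    proof -
      have "norm (opow S (Suc m) (T (T' x))) \<le> q ^ Suc m * norm (T' x)" by (rule norm_Spow_T)
      also have "\<dots> \<le> q ^ m * norm x"
        using q by (intro mult_mono norm_T'x) (simp_all add: power_decreasing mult_left_le_one_le)
      finally show ?thesis .
    qed
    ultimately show "norm ((?X (Suc m) - ?X m) x) \<le> q ^ m * norm x"
      by (simp only: minus_blinfun.rep_eq norm_minus_cancel)
  qed (use q in simp)
  have "summable (\<lambda>m. ?X (Suc m) - ?X m)"
    by (rule summable_comparison_test'[of "\<lambda>m. q ^ m" 0]) (use le q in \<open>auto intro: summable_geometric\<close>)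
  then have "(\<lambda>n. \<Sum>m<n. ?X (Suc m) - ?X m) \<longlonglongrightarrow> (\<Sum>m. ?X (Suc m) - ?X m)"
    by (rule summable_LIMSEQ)
  then have "(\<lambda>n. ?X n - ?X 0) \<longlonglongrightarrow> (\<Sum>m. ?X (Suc m) - ?X m)"
    by (simp only: sum_lessThan_telescope[of ?X])
  then have "convergent (\<lambda>n. ?X n - ?X 0 + ?X 0)"
    by (intro convergent_add convergent_const) (auto simp: convergent_def)
  then show ?thesis unfolding P0_def by (simp add: convergent_LIMSEQ_iff)
qed

lemma P0_lim_apply: "(\<lambda>m. opow S (Suc m) x) \<longlonglongrightarrow> P0 x"
  by (rule bounded_bilinear.tendsto[OF bounded_bilinear_blinfun_apply P0_lim tendsto_const])

lemma P0_lin: "clinear_op P0"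
  by (rule closed_sequentially[OF closed_clinear _ P0_lim, simplified]) (auto simp: S_lin)

lemma inner_P0: "inner (P0 x) y = inner x (P0 y)"
proof (rule LIMSEQ_unique)
  show "(\<lambda>m. inner (opow S (Suc m) x) y) \<longlonglongrightarrow> inner (P0 x) y"
    by (intro tendsto_inner tendsto_const P0_lim_apply)
  show "(\<lambda>m. inner (opow S (Suc m) x) y) \<longlonglongrightarrow> inner x (P0 y)"
    unfolding Spow_inner by (intro tendsto_inner tendsto_const P0_lim_apply)
qed

lemma P0_adj: "adj_op P0 = P0"
  by (rule adj_eqI[OF P0_lin]) (rule inner_P0)

lemma P0_T: "P0 (T x) = 0"
proof (rule LIMSEQ_unique[OF P0_lim_apply])
  show "(\<lambda>m. opow S (Suc m) (T x)) \<longlonglongrightarrow> 0"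
  proof (rule Lim_null_comparison)
    show "\<forall>\<^sub>F m in sequentially. norm (opow S (Suc m) (T x)) \<le> q ^ Suc m * norm x"
      by (intro always_eventually allI norm_Spow_T)
    show "(\<lambda>m. q ^ Suc m * norm x) \<longlonglongrightarrow> 0"
      using q by (intro tendsto_mult_left_zero LIMSEQ_Suc LIMSEQ_power_zero) simp
  qed
qed

lemma T'_P0: "T' (P0 x) = 0"
proof -
  have "inner (T' (P0 x)) (T' (P0 x)) = inner x (P0 (T (T' (P0 x))))"
    by (simp only: inner_T inner_P0)
  then show ?thesis by (simp add: P0_T)
qed

lemma P0_commute:
  fixes A :: "'i op"
  assumes "\<And>x. A (S x) = S (A x)"
  shows "P0 (A x) = A (P0 x)"
proof (rule LIMSEQ_unique[OF P0_lim_apply])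
  have "A (opow S m x) = opow S m (A x)" for m by (induction m) (simp_all add: assms)
  then show "(\<lambda>m. opow S (Suc m) (A x)) \<longlonglongrightarrow> A (P0 x)"
    using blinfun.tendsto[OF tendsto_const[of A] P0_lim_apply[of x]] by (simp add: assms)
qed

lemma E_P0: "E (P0 x) = P0 x" "P0 (E x) = P0 x"
proof -
  show "P0 (E x) = P0 x"
    by (rule LIMSEQ_unique[OF P0_lim_apply]) (use P0_lim_apply[of x] in \<open>simp add: opow_shift[symmetric] E_S\<close>)
  then show "E (P0 x) = P0 x" using P0_commute[of E x] by (simp add: E_S)
qed

lemma S_P0: "S (P0 x) = P0 x" "P0 (S x) = P0 x"
  by (simp_all add: S_apply T'_P0 P0_T E_P0 blinfun.bilinear_simps)

lemma P0_P0: "P0 (P0 x) = P0 x"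
proof (rule LIMSEQ_unique[OF P0_lim_apply])
  have "opow S m (P0 x) = P0 x" for m by (induction m) (simp_all add: S_P0)
  then show "(\<lambda>m. opow S (Suc m) (P0 x)) \<longlonglongrightarrow> P0 x" by (simp del: opow.simps opow_apply)
qed

lemma P0_projection: "is_projection P0"
  using P0_lin P0_adj by (auto simp: is_projection_def P0_P0 intro!: blinfun_eqI)

text \<open>Sum the geometric estimates for the differences \<open>S\<^sup>j - S\<^bsup>j+1\<^esup> = S\<^sup>j T T\<^sup>*\<close> that made the powers of \<open>S\<close> converge.\<close>

lemma T'_lower_bound: "(1 - q) * norm (E x - P0 x) \<le> norm (T' x)"
proof -
  have le: "norm (E x - opow S (Suc m) x) \<le> (\<Sum>j<Suc m. q ^ j) * norm (T' x)" for m
  proof (induction m)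
    case 0
    then show ?case using norm_Tx[of "T' x"] by (simp add: S_apply)
  next
    case (Suc m)
    have "E x - opow S (Suc (Suc m)) x = (E x - opow S (Suc m) x) + opow S (Suc m) (T (T' x))"
      by (simp only: Spow_diff[of "Suc m" x] opow_Suc_right[of S m] blinfun_apply_blinfun_compose E_S) simp
    also have "norm \<dots> \<le> (\<Sum>j<Suc m. q ^ j) * norm (T' x) + q ^ Suc m * norm (T' x)"
      by (intro order.trans[OF norm_triangle_ineq] add_mono Suc norm_Spow_T)
    also have "\<dots> = (\<Sum>j<Suc (Suc m). q ^ j) * norm (T' x)" by (simp add: algebra_simps)
    finally show ?case .
  qed
  have "norm (E x - P0 x) \<le> norm (T' x) / (1 - q)"
  proof (rule LIMSEQ_le)
    show "(\<lambda>m. norm (E x - opow S (Suc m) x)) \<longlonglongrightarrow> norm (E x - P0 x)"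
      by (intro tendsto_norm tendsto_diff tendsto_const P0_lim_apply)
    show "(\<lambda>m. norm (T' x) / (1 - q)) \<longlonglongrightarrow> norm (T' x) / (1 - q)" by simp
    have "norm (E x - opow S (Suc m) x) \<le> norm (T' x) / (1 - q)" for m
    proof -
      have "(\<Sum>j<Suc m. q ^ j) \<le> 1 / (1 - q)"
        using q by (subst sum_gp_strict) (simp add: divide_right_mono)
      then show ?thesis
        using le[of m] mult_right_mono[of "\<Sum>j<Suc m. q ^ j" "1 / (1 - q)" "norm (T' x)"] by simp
    qed
    then show "\<exists>N. \<forall>m\<ge>N. norm (E x - opow S (Suc m) x) \<le> norm (T' x) / (1 - q)" by blast
  qed
  then show ?thesis using q by (simp add: field_simps)
qed

lemma S_Tpow_P0: "S (opow T k (P0 x)) = q ^ k *\<^sub>R opow T k (P0 x)"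
  by (induction k) (simp_all add: S_T S_P0 blinfun.bilinear_simps)

lemma E_Tpow_P0: "E (opow T k (P0 x)) = opow T k (P0 x)"
  by (cases k) (simp_all add: E_P0 E_T)

lemma T'_Tpow_P0: "T' (opow T (Suc k) (P0 x)) = (1 - q ^ Suc k) *\<^sub>R opow T k (P0 x)"
  by (simp add: T'_T_S S_Tpow_P0 E_Tpow_P0 algebra_simps)

lemma T'pow_Tpow_P0: "qfac q j *\<^sub>R opow T' k (opow T (k + j) (P0 x)) = qfac q (k + j) *\<^sub>R opow T j (P0 x)"
proof (induction k)
  case (Suc k)
  have "qfac q j *\<^sub>R opow T' (Suc k) (opow T (Suc (k + j)) (P0 x)) =
      qfac q j *\<^sub>R opow T' k (T' (opow T (Suc (k + j)) (P0 x)))"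
    by (simp only: opow_apply opow_shift)
  also have "\<dots> = (1 - q ^ Suc (k + j)) *\<^sub>R (qfac q j *\<^sub>R opow T' k (opow T (k + j) (P0 x)))"
    by (simp only: T'_Tpow_P0 blinfun.scaleR_right scaleR_left_commute)
  also have "\<dots> = qfac q (Suc (k + j)) *\<^sub>R opow T j (P0 x)"
    by (simp only: Suc) (simp add: mult.commute)
  finally show ?case by simp
qed simp

lemma T'pow_P0: "opow T' (Suc k) (P0 x) = 0"
  by (simp add: opow_shift[symmetric] T'_P0 blinfun.zero_right)

lemma Tpow_inner: "inner (opow T k x) y = inner x (opow T' k y)"
  using inner_adj_right[OF clinear_opow[OF T(1)], of x k y] by (simp add: adj_opow T)

text \<open>The projection onto the image under \<open>T\<^sup>k\<close> of the kernel of \<open>T'\<close>, which is the eigenspace of \<open>S\<close> for \<open>q\<^sup>k\<close>.\<close>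
definition "P k = (1 / qfac q k) *\<^sub>R (opow T k o\<^sub>L P0 o\<^sub>L opow T' k)"

lemma P_apply: "P k x = (1 / qfac q k) *\<^sub>R opow T k (P0 (opow T' k x))"
  by (simp add: P_def scaleR_blinfun.rep_eq)

lemma P_lin: "clinear_op (P k)"
  by (auto simp: P_def T P0_lin)

lemma qfac_nonzero: "qfac q k \<noteq> 0"
  using qfac_pos[of q k] q by simp

lemma inner_P: "inner (P k x) y = inner x (P k y)"
proof -
  have *: "inner (P k x) y = (1 / qfac q k) * inner (P0 (opow T' k x)) (opow T' k y)" for x y
    by (simp add: P_apply Tpow_inner)
  show ?thesis
    using *[of x y] *[of y x] inner_P0[of "opow T' k x" "opow T' k y"]
    by (simp only: inner_commute[of x] inner_commute[of "P0 (opow T' k y)"])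
qed

lemma P0_T'pow_Tpow_P0: "P0 (opow T' k (opow T l (P0 x))) = (if k = l then qfac q k *\<^sub>R P0 x else 0)"
proof (cases "k \<le> l")
  case True
  then obtain j where l: "l = k + j" using le_Suc_ex by blast
  have *: "qfac q j *\<^sub>R P0 (opow T' k (opow T l (P0 x))) = qfac q (k + j) *\<^sub>R P0 (opow T j (P0 x))"
    using arg_cong[OF T'pow_Tpow_P0[of j k x], of P0] by (simp add: l blinfun.bilinear_simps)
  show ?thesis
  proof (cases j)
    case 0 then show ?thesis using * by (simp add: l P0_P0)
  next
    case (Suc j')
    then have "P0 (opow T j (P0 x)) = 0" by (simp add: P0_T)
    then show ?thesis using * Suc qfac_nonzero[of j] by (simp add: l)
  qed
next
  case False
  then obtain j where k: "k = Suc j + l" by (metis add.commute add_Suc_right less_imp_Suc_add not_le)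
  have "opow T' l (opow T l (P0 x)) = qfac q l *\<^sub>R P0 x" using T'pow_Tpow_P0[of 0 l x] by simp
  then have "opow T' k (opow T l (P0 x)) = qfac q l *\<^sub>R opow T' (Suc j) (P0 x)"
    unfolding k opow_add by (simp only: blinfun.scaleR_right)
  then show ?thesis using False by (simp only: T'pow_P0) (simp add: blinfun.bilinear_simps)
qed

lemma P_P: "P k (P l x) = (if k = l then P k x else 0)"
  by (simp add: P_apply blinfun.scaleR_right P0_T'pow_Tpow_P0 blinfun.zero_right qfac_nonzero)

lemma norm_P: "(norm (P k x))\<^sup>2 = inner x (P k x)" "(norm (P k x))\<^sup>2 = (norm (P0 (opow T' k x)))\<^sup>2 / qfac q k"
proof -
  show *: "(norm (P k x))\<^sup>2 = inner x (P k x)"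
    by (simp add: power2_norm_eq_inner inner_P P_P)
  have "inner (P k x) x = (1 / qfac q k) * inner (P0 (opow T' k x)) (opow T' k x)"
    by (simp add: P_apply Tpow_inner)
  then show "(norm (P k x))\<^sup>2 = (norm (P0 (opow T' k x)))\<^sup>2 / qfac q k"
    using inner_commute[of x "P k x"] inner_commute[of "P0 (opow T' k x)" "opow T' k x"]
    by (simp add: * projection_norm(1)[OF P0_projection])
qed

lemma T'pow_E: "P0 (opow T' k (E x)) = P0 (opow T' k x)"
proof (cases k)
  case (Suc j)
  then have "opow T' k (E x) = opow T' j (T' (E x))" by (simp only: opow_apply opow_shift)
  then show ?thesis by (simp only: E_T) (simp add: Suc opow_shift)
qed (simp add: E_P0)

lemma E_P: "E (P k x) = P k x" "P k (E x) = P k x"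
proof -
  show "E (P k x) = P k x" by (simp add: P_apply blinfun.scaleR_right E_Tpow_P0)
  show "P k (E x) = P k x" by (simp add: P_apply T'pow_E)
qed

lemma P_orthogonal: "k \<noteq> l \<Longrightarrow> inner (P k x) (P l x) = 0"
  by (simp add: inner_P P_P)

lemma P_summable: "summable (\<lambda>k. P k x)"
proof -
  have le: "(\<Sum>k<m. (norm (P k x))\<^sup>2) \<le> (norm x)\<^sup>2" for m
  proof -
    let ?s = "\<Sum>k<m. P k x"
    have 1: "(\<Sum>k<m. (norm (P k x))\<^sup>2) = inner x ?s" by (simp add: norm_P(1) inner_sum_right)
    have "inner ?s ?s = (\<Sum>k<m. \<Sum>l<m. inner (P l x) (P k x))"
      by (simp add: inner_sum_left inner_sum_right)
    also have "\<dots> = (\<Sum>k<m. (norm (P k x))\<^sup>2)"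
    proof (rule sum.cong[OF refl])
      fix k assume "k \<in> {..<m}"
      have "(\<Sum>l<m. inner (P l x) (P k x)) = (\<Sum>l<m. if l = k then (norm (P k x))\<^sup>2 else 0)"
        by (rule sum.cong) (auto simp: P_orthogonal power2_norm_eq_inner)
      then show "(\<Sum>l<m. inner (P l x) (P k x)) = (norm (P k x))\<^sup>2" using \<open>k \<in> _\<close> by simp
    qed
    finally have 2: "(norm ?s)\<^sup>2 = inner x ?s" using 1 by (simp add: power2_norm_eq_inner)
    then have "norm ?s * norm ?s \<le> norm x * norm ?s"
      using norm_cauchy_schwarz[of x ?s] by (simp add: power2_eq_square)
    then have "norm ?s \<le> norm x" by (cases "norm ?s = 0") auto
    then show ?thesis using 1 2 by (metis norm_ge_zero power_mono)
  qed
  have "summable (\<lambda>k. (norm (P k x))\<^sup>2)"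
    by (rule bounded_imp_summable[of _ "(norm x)\<^sup>2"]) (simp, simp only: lessThan_Suc_atMost[symmetric] le)
  then show "summable (\<lambda>k. P k x)" by (rule orthogonal_series[rotated]) (rule P_orthogonal)
qed

text \<open>
  The projection onto the part where \<open>T\<close> is unitary. The series \<open>\<Sum> P\<^sub>k\<close> converges only strongly, hence
  it is formed vector by vector.
\<close>
definition "Pu = E - Blinfun (\<lambda>x. \<Sum>k. P k x)"

lemma
  shows Pu_apply: "Pu x = E x - (\<Sum>k. P k x)"
    and inner_Pu: "inner (Pu x) y = inner x (Pu y)"
    and Pu_Pu: "Pu (Pu x) = Pu x"
    and E_Pu: "E (Pu x) = Pu x" "Pu (E x) = Pu x"
    and P_Pu: "P k (Pu x) = 0"
    and Pu_lin: "clinear_op Pu"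
    and norm_Pu: "(\<lambda>k. (norm (P0 (opow T' k x)))\<^sup>2 / qfac q k) sums ((norm (E x))\<^sup>2 - (norm (Pu x))\<^sup>2)"
proof -
  let ?Q = "\<lambda>x. \<Sum>k. P k x"
  have innerQ: "(\<lambda>k. inner y (P k x)) sums inner y (?Q x)" for x y
    by (rule bounded_linear.sums[OF bounded_linear_inner_right summable_sums[OF P_summable]])
  have PQ: "P k (?Q x) = P k x" for k x
  proof (rule sums_unique2)
    show "(\<lambda>l. P k (P l x)) sums P k (?Q x)"
      by (rule bounded_linear.sums[OF blinfun.bounded_linear_right summable_sums[OF P_summable]])
    show "(\<lambda>l. P k (P l x)) sums P k x" unfolding P_P using sums_single[of k "\<lambda>_. P k x"] by (simp add: eq_commute)
  qed
  have normQ: "(norm (?Q x))\<^sup>2 = inner x (?Q x)" for x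
  proof -
    have "(\<lambda>k. inner (?Q x) (P k x)) sums inner (?Q x) (?Q x)" by (rule innerQ)
    moreover have "inner (?Q x) (P k x) = inner x (P k x)" for k
      using inner_P[of k "?Q x" x] PQ[of k x] inner_P[of k x x] by (simp add: inner_commute)
    ultimately have "(\<lambda>k. inner x (P k x)) sums inner (?Q x) (?Q x)" by simp
    then show ?thesis using sums_unique2[OF innerQ[of x x]] by (simp add: power2_norm_eq_inner)
  qed
  have leQ: "norm (?Q x) \<le> norm x" for x
  proof -
    have "norm (?Q x) * norm (?Q x) \<le> norm x * norm (?Q x)"
      using normQ[of x] norm_cauchy_schwarz[of x "?Q x"] by (simp add: power2_eq_square)
    then show ?thesis by (cases "norm (?Q x) = 0") auto
  qed
  have "bounded_linear ?Q"
  proof (rule bounded_linear_intro[where K=1])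
    show "?Q (x + y) = ?Q x + ?Q y" for x y
      by (simp add: blinfun.add_right suminf_add[OF P_summable P_summable])
    show "?Q (r *\<^sub>R x) = r *\<^sub>R ?Q x" for r x
      by (simp add: blinfun.scaleR_right suminf_scaleR_right[OF P_summable])
  qed (use leQ in simp)
  then have app: "Blinfun ?Q x = ?Q x" for x by (simp add: bounded_linear_Blinfun_apply)
  show Pu: "Pu x = E x - ?Q x" for x by (simp add: Pu_def minus_blinfun.rep_eq app)
  have linQ: "clinear_op (Blinfun ?Q)"
    unfolding clinear_op_def app
  proof (intro allI)
    fix c x
    have "(\<lambda>k. scalar_op c (P k x)) sums scalar_op c (?Q x)"
      by (rule bounded_linear.sums[OF blinfun.bounded_linear_right summable_sums[OF P_summable]])
    then show "?Q (cscale_ell2 c x) = cscale_ell2 c (?Q x)"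
      by (simp add: scalar_op.rep_eq clinear_opD[OF P_lin] sums_iff)
  qed
  then show "clinear_op Pu" unfolding Pu_def using E_lin by auto
  have symQ: "inner (?Q x) y = inner x (?Q y)" for x y
  proof (rule sums_unique2)
    show "(\<lambda>k. inner (P k x) y) sums inner (?Q x) y"
      using innerQ[of y x] by (simp add: inner_commute)
    show "(\<lambda>k. inner (P k x) y) sums inner x (?Q y)" unfolding inner_P by (rule innerQ)
  qed
  then show sym: "inner (Pu x) y = inner x (Pu y)" for x y by (simp add: Pu inner_diff_left inner_diff_right inner_E)
  show PPu: "P k (Pu x) = 0" for k x by (simp add: Pu blinfun.diff_right PQ E_P)
  have EQ: "E (?Q x) = ?Q x" for x
  proof (rule sums_unique2)
    show "(\<lambda>k. E (P k x)) sums E (?Q x)"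
      by (rule bounded_linear.sums[OF blinfun.bounded_linear_right summable_sums[OF P_summable]])
    show "(\<lambda>k. E (P k x)) sums ?Q x" unfolding E_P by (rule summable_sums[OF P_summable])
  qed
  show EPu: "E (Pu x) = Pu x" by (simp add: Pu blinfun.diff_right EQ E_T)
  show "Pu (E x) = Pu x" by (simp add: Pu E_P E_T)
  show PuPu: "Pu (Pu x) = Pu x"
    by (subst Pu[of "Pu x"]) (simp add: PPu EPu)
  have "inner x (E x) - inner x (?Q x) = (norm (Pu x))\<^sup>2"
    using sym[of x "Pu x"] by (simp add: PuPu power2_norm_eq_inner) (simp add: Pu inner_diff_right)
  then have "inner x (?Q x) = (norm (E x))\<^sup>2 - (norm (Pu x))\<^sup>2"
    by (simp add: projection_norm(1)[OF E])
  then show "(\<lambda>k. (norm (P0 (opow T' k x)))\<^sup>2 / qfac q k) sums ((norm (E x))\<^sup>2 - (norm (Pu x))\<^sup>2)"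
    using innerQ[of x x] by (simp add: norm_P[symmetric])
qed

end

lemma inner_ext: "(\<And>y. inner x y = inner x' y) \<Longrightarrow> x = x'" for x :: "'a :: real_inner"
  by (metis inner_diff_left inner_eq_zero_iff right_minus_eq)

context q_oscillator
begin

lemma Pu_fixed_iff: "Pu y = y \<longleftrightarrow> E y = y \<and> (\<forall>k. P0 (opow T' k y) = 0)"
proof
  assume y: "Pu y = y"
  have "P0 (opow T' k y) = 0" for k
  proof -
    have "P k y = 0" using P_Pu[of k y] y by simp
    then show ?thesis using norm_P(2)[of k y] qfac_nonzero[of k] by simp
  qed
  then show "E y = y \<and> (\<forall>k. P0 (opow T' k y) = 0)" using E_Pu(1)[of y] y by simp
next
  assume "E y = y \<and> (\<forall>k. P0 (opow T' k y) = 0)"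
  then show "Pu y = y" by (simp add: Pu_apply P_apply blinfun.zero_right)
qed

lemma T'pow_Spow: "opow T' k (opow S m y) = q ^ (k * m) *\<^sub>R opow S m (opow T' k y)"
proof (induction k)
  case (Suc k)
  have "T' (opow S m y) = q ^ m *\<^sub>R opow S m (T' y)" for y
    by (induction m) (simp_all add: T'_S blinfun.scaleR_right)
  then show ?case by (simp add: Suc blinfun.scaleR_right power_add)
qed simp

text \<open>
  For \<open>y\<close> in the unitary part, \<open>v = S\<^sup>m y\<close> is also annihilated by all \<open>P0 T'\<^sup>k\<close>, so that the lower bound
  for \<open>T'\<close> gives \<open>(1 - q)\<^sup>k \<parallel>v\<parallel> \<le> \<parallel>T'\<^sup>k S\<^sup>m y\<parallel> = q\<^bsup>k m\<^esup> \<parallel>S\<^sup>m T'\<^sup>k y\<parallel> \<le> q\<^bsup>k m\<^esup> \<parallel>y\<parallel>\<close>. If \<open>m\<close> is so large that \<open>q\<^sup>m < 1 - q\<close>,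
  then \<open>k \<rightarrow> \<infinity>\<close> shows \<open>v = 0\<close>, and then \<open>S y = 0\<close> since \<open>S\<close> is self-adjoint.
\<close>
lemma S_Pu: "S (Pu x) = 0"
proof -
  define y where "y = Pu x"
  have y: "E y = y" "\<And>k. P0 (opow T' k y) = 0"
    using Pu_fixed_iff[of y] Pu_Pu by (simp_all add: y_def)
  obtain m0 where "q ^ m0 < 1 - q" using real_arch_pow_inv[of "1 - q" q] q by auto
  moreover have "q ^ Suc m0 \<le> q ^ m0" using q by (simp add: mult_left_le_one_le)
  ultimately have "q ^ Suc m0 < 1 - q" by linarith
  then obtain m where m: "q ^ Suc m < 1 - q" by blast
  define v where "v = opow S (Suc m) y"
  have P0_S: "P0 (opow S j z) = P0 z" for j z
    by (induction j) (simp_all add: S_P0)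
  have step: "(1 - q) * norm (opow T' k v) \<le> norm (opow T' (Suc k) v)" for k
  proof -
    have "P0 (opow T' k v) = 0"
      by (simp only: v_def T'pow_Spow blinfun.scaleR_right P0_S y) simp
    moreover have "E (opow T' k v) = opow T' k v"
      by (cases k) (simp_all add: v_def E_S E_T)
    ultimately show ?thesis using T'_lower_bound[of "opow T' k v"] by simp
  qed
  have "(1 - q) ^ k * norm v \<le> norm (opow T' k v)" for k
  proof (induction k)
    case (Suc k)
    have "(1 - q) ^ Suc k * norm v = (1 - q) * ((1 - q) ^ k * norm v)" by simp
    also have "\<dots> \<le> (1 - q) * norm (opow T' k v)" using Suc q by (intro mult_left_mono) auto
    finally show ?case using step[of k] by simp
  qed simp
  moreover have "norm (opow T' k v) \<le> (q ^ Suc m) ^ k * norm y" for k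
  proof -
    have "norm (opow S (Suc m) (opow T' k y)) \<le> norm y"
      by (rule order.trans[OF opow_contraction[OF norm_Sx] opow_contraction[OF norm_T'x]])
    then show ?thesis
      using q unfolding v_def T'pow_Spow
      by (simp only: norm_scaleR power_mult[symmetric] mult.commute[of k]) (simp add: mult_left_mono)
  qed
  ultimately have le: "(1 - q) ^ k * norm v \<le> (q ^ Suc m) ^ k * norm y" for k
    using order_trans by blast
  have "norm v \<le> (q ^ Suc m / (1 - q)) ^ k * norm y" for k
    using le[of k] q by (simp add: power_divide field_simps del: power_Suc)
  moreover have "(\<lambda>k. (q ^ Suc m / (1 - q)) ^ k * norm y) \<longlonglongrightarrow> 0"
    using q m by (intro tendsto_mult_left_zero LIMSEQ_power_zero) (simp add: abs_mult)
  ultimately have "norm v \<le> 0" by (intro LIMSEQ_le_const) auto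
  then have "opow S (Suc m) y = 0" by (simp add: v_def)
  then show "S (Pu x) = 0"
    unfolding y_def[symmetric]
  proof (induction m)
    case (Suc m)
    have "(norm (opow S (Suc m) y))\<^sup>2 = inner (opow S m y) (opow S (Suc (Suc m)) y)"
      unfolding power2_norm_eq_inner by (simp add: inner_S)
    then show ?case using Suc by simp
  qed simp
qed

lemma T_Pu: "Pu (T (Pu x)) = T (Pu x)" and T'_Pu: "Pu (T' (Pu x)) = T' (Pu x)"
  and T_T'_Pu: "T (T' (Pu x)) = Pu x"
proof -
  define y where "y = Pu x"
  have y: "E y = y" "\<And>k. P0 (opow T' k y) = 0"
    using Pu_fixed_iff[of y] Pu_Pu by (simp_all add: y_def)
  have Sy: "S y = 0" by (simp add: y_def S_Pu)
  have "T' (T y) = y" by (simp add: T'_T_S Sy y)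
  then have "P0 (opow T' k (T y)) = 0" for k
    using y by (cases k) (simp_all add: P0_T opow_shift[symmetric])
  then show "Pu (T (Pu x)) = T (Pu x)"
    unfolding Pu_fixed_iff y_def[symmetric] by (simp add: E_T)
  have "P0 (opow T' k (T' y)) = 0" for k
    using y(2)[of "Suc k"] by (simp add: opow_shift)
  then show "Pu (T' (Pu x)) = T' (Pu x)"
    unfolding Pu_fixed_iff y_def[symmetric] by (simp add: E_T)
  show "T (T' (Pu x)) = Pu x"
    using Sy y(1) unfolding S_apply y_def by simp
qed

lemma Pu_commute:
  fixes A :: "'i op"
  assumes A: "clinear_op A" and "\<And>x. Pu (A (Pu x)) = A (Pu x)" "\<And>x. Pu (adj_op A (Pu x)) = adj_op A (Pu x)"
  shows "Pu (A x) = A (Pu x)"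
proof -
  have "inner (Pu (A x)) y = inner (A (Pu x)) y" for y
  proof -
    have "inner (Pu (A x)) y = inner x (adj_op A (Pu y))"
      by (simp add: inner_Pu inner_adj_right[OF A])
    also have "\<dots> = inner (A (Pu x)) y"
      by (subst assms(3)[symmetric]) (simp add: inner_Pu[symmetric] inner_adj_right[OF A] assms(2))
    finally show ?thesis .
  qed
  then show ?thesis by (rule inner_ext)
qed

lemma Pu_T'pow: "Pu (opow T' k x) = opow T' k (Pu x)"
proof -
  have "Pu (T' x) = T' (Pu x)" for x
    by (rule Pu_commute) (simp_all add: T'_lin T T_Pu T'_Pu)
  then show ?thesis by (induction k) simp_all
qed

lemma norm_T'pow_Pu: "norm (opow T' k (Pu x)) = norm (Pu x)"
proof (induction k)
  case (Suc k)
  have "(norm (T' (Pu z)))\<^sup>2 = (norm (Pu z))\<^sup>2" for z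
    by (simp add: power2_norm_eq_inner inner_T T_T'_Pu)
  then have "norm (T' (Pu z)) = norm (Pu z)" for z by (simp add: power2_eq_iff_nonneg)
  from this[of "opow T' k x"] show ?case using Suc by (simp add: Pu_T'pow)
qed simp

lemma P0_Pu: "P0 (Pu x) = 0"
  using Pu_fixed_iff[of "Pu x"] Pu_Pu[of x] by (auto dest: spec[of _ 0])

lemma Pu_T'pow_norm: "norm (Pu (opow T' k x)) = norm (Pu x)"
  by (simp add: Pu_T'pow norm_T'pow_Pu)

end

section \<open>Representations of the ball relations\<close>

text \<open>
  The unit is an arbitrary projection \<open>E\<close>, as the induction on \<open>n\<close> passes to the corner of the projection
  onto the kernel of the adjoint of the last generator.
\<close>
definition ball_rep :: "real \<Rightarrow> nat \<Rightarrow> 'i op \<Rightarrow> (nat \<Rightarrow> 'i op) \<Rightarrow> bool" where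
  "ball_rep q n E T \<longleftrightarrow> is_projection E \<and>
     (\<forall>i\<in>{1..n}. clinear_op (T i) \<and> E o\<^sub>L T i = T i \<and> T i o\<^sub>L E = T i) \<and>
     (\<forall>i\<in>{1..n}. \<forall>j\<in>{1..n}. i < j \<longrightarrow>
        T i o\<^sub>L T j = sqrt q *\<^sub>R (T j o\<^sub>L T i) \<and>
        T i o\<^sub>L adj_op (T j) = inverse (sqrt q) *\<^sub>R (adj_op (T j) o\<^sub>L T i)) \<and>
     (\<forall>i\<in>{1..n}. (adj_op (T i) o\<^sub>L T i) - q *\<^sub>R (T i o\<^sub>L adj_op (T i)) =
        (1 - q) *\<^sub>R (E - (\<Sum>j\<in>{i+1..n}. T j o\<^sub>L adj_op (T j))))"

locale ball_step =
  fixes q :: real and n :: nat and E :: "'i op" and z :: "nat \<Rightarrow> 'i op"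
  assumes q01: "0 < q" "q < 1" and rep: "ball_rep q (Suc n) E z"
begin

lemma rep_z: "i \<in> {1..Suc n} \<Longrightarrow> clinear_op (z i)" "i \<in> {1..Suc n} \<Longrightarrow> E o\<^sub>L z i = z i"
    "i \<in> {1..Suc n} \<Longrightarrow> z i o\<^sub>L E = z i"
    "i \<in> {1..Suc n} \<Longrightarrow> j \<in> {1..Suc n} \<Longrightarrow> i < j \<Longrightarrow> z i o\<^sub>L z j = sqrt q *\<^sub>R (z j o\<^sub>L z i)"
    "i \<in> {1..Suc n} \<Longrightarrow> j \<in> {1..Suc n} \<Longrightarrow> i < j \<Longrightarrow>
      z i o\<^sub>L adj_op (z j) = inverse (sqrt q) *\<^sub>R (adj_op (z j) o\<^sub>L z i)"
    "i \<in> {1..Suc n} \<Longrightarrow> (adj_op (z i) o\<^sub>L z i) - q *\<^sub>R (z i o\<^sub>L adj_op (z i)) =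
        (1 - q) *\<^sub>R (E - (\<Sum>j\<in>{i+1..Suc n}. z j o\<^sub>L adj_op (z j)))"
  using rep unfolding ball_rep_def by blast+

sublocale q_oscillator q E "z (Suc n)"
proof
  show "is_projection E" using rep unfolding ball_rep_def by blast
  show "(adj_op (z (Suc n)) o\<^sub>L z (Suc n)) - q *\<^sub>R (z (Suc n) o\<^sub>L adj_op (z (Suc n))) = (1 - q) *\<^sub>R E"
    using rep_z(6)[of "Suc n"] by simp
qed (use q01 rep_z[of "Suc n"] in auto)

abbreviation "t \<equiv> z (Suc n)"

context
  fixes i assumes i: "i \<in> {1..n}"
begin

lemma i_Suc: "i \<in> {1..Suc n}" "i < Suc n"
  using i by auto

lemma zi_lin: "clinear_op (z i)"
  by (rule rep_z(1)[OF i_Suc(1)])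

lemma zi_E: "E (z i x) = z i x" "z i (E x) = z i x" "E (adj_op (z i) x) = adj_op (z i) x" "adj_op (z i) (E x) = adj_op (z i) x"
proof -
  show "E (z i x) = z i x" "z i (E x) = z i x"
    using rep_z(2,3)[OF i_Suc(1)] by (metis blinfun_apply_blinfun_compose)+
  have "E o\<^sub>L adj_op (z i) = adj_op (z i)" "adj_op (z i) o\<^sub>L E = adj_op (z i)"
    using adj_compose[OF zi_lin E_lin] adj_compose[OF E_lin zi_lin] rep_z(2,3)[OF i_Suc(1)] E_adj by simp_all
  then show "E (adj_op (z i) x) = adj_op (z i) x" "adj_op (z i) (E x) = adj_op (z i) x"
    by (metis blinfun_apply_blinfun_compose)+
qed

lemma sqrt_q: "sqrt q > 0" "sqrt q \<noteq> 0" "sqrt q * sqrt q = q"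
  using q01 by simp_all

lemma zi_t: "z i (t x) = sqrt q *\<^sub>R t (z i x)" and zi_t': "T' (z i x) = sqrt q *\<^sub>R z i (T' x)"
proof -
  show "z i (t x) = sqrt q *\<^sub>R t (z i x)"
    using arg_cong[OF rep_z(4)[OF i_Suc(1) _ i_Suc(2)], of "\<lambda>X. blinfun_apply X x"]
    by (simp add: scaleR_blinfun.rep_eq)
  have "z i (T' x) = inverse (sqrt q) *\<^sub>R T' (z i x)"
    using arg_cong[OF rep_z(5)[OF i_Suc(1) _ i_Suc(2)], of "\<lambda>X. blinfun_apply X x"]
    by (simp add: scaleR_blinfun.rep_eq)
  then show "T' (z i x) = sqrt q *\<^sub>R z i (T' x)" using sqrt_q by simp
qed

lemma zi'_t': "T' (adj_op (z i) x) = sqrt q *\<^sub>R adj_op (z i) (T' x)"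
  and zi'_t: "adj_op (z i) (t x) = sqrt q *\<^sub>R t (adj_op (z i) x)"
proof -
  have *: "inner (T' (adj_op (z i) x)) y = inner (sqrt q *\<^sub>R adj_op (z i) (T' x)) y"
    "inner (adj_op (z i) (t x)) y = inner (sqrt q *\<^sub>R t (adj_op (z i) x)) y" for y
    using zi_t[of y] zi_t'[of y] by (simp_all add: inner_T inner_adj[OF zi_lin])
  show "T' (adj_op (z i) x) = sqrt q *\<^sub>R adj_op (z i) (T' x)" "adj_op (z i) (t x) = sqrt q *\<^sub>R t (adj_op (z i) x)"
    by (rule inner_ext, rule *)+
qed

lemma zi_S: "z i (S x) = S (z i x)" and zi'_S: "adj_op (z i) (S x) = S (adj_op (z i) x)"
  using sqrt_q
  by (simp_all add: S_apply zi_E zi_t zi_t' zi'_t zi'_t' blinfun.bilinear_simps)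

lemma P0_zi: "P0 (z i x) = z i (P0 x)" and P0_zi': "P0 (adj_op (z i) x) = adj_op (z i) (P0 x)"
  by (rule P0_commute, rule zi_S) (rule P0_commute, rule zi'_S)

lemma T'pow_zi: "opow T' k (z i x) = sqrt q ^ k *\<^sub>R z i (opow T' k x)"
  and T'pow_zi': "opow T' k (adj_op (z i) x) = sqrt q ^ k *\<^sub>R adj_op (z i) (opow T' k x)"
  by (induction k) (simp_all add: zi_t' zi'_t' blinfun.scaleR_right)

lemma zi_Pu_invariant: "Pu (z i (Pu x)) = z i (Pu x)" "Pu (adj_op (z i) (Pu x)) = adj_op (z i) (Pu x)"
proof -
  have "P0 (opow T' k (Pu x)) = 0" for k
    using Pu_fixed_iff[of "Pu x"] Pu_Pu[of x] by simp
  then show "Pu (z i (Pu x)) = z i (Pu x)" "Pu (adj_op (z i) (Pu x)) = adj_op (z i) (Pu x)"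
    unfolding Pu_fixed_iff by (simp_all add: zi_E T'pow_zi T'pow_zi' blinfun.scaleR_right P0_zi P0_zi' blinfun.zero_right)
qed

text \<open>
  On the unitary part \<open>S = E - t t\<^sup>*\<close> vanishes, so that the relation for \<open>z i\<close> yields \<open>\<parallel>R x\<parallel>\<^sup>2 \<le> q \<parallel>R\<^sup>* x\<parallel>\<^sup>2\<close> for
  the restriction \<open>R\<close> of \<open>z i\<close>; as \<open>q < 1\<close>, this forces \<open>R = 0\<close>.
\<close>
lemma zi_Pu: "z i (Pu x) = 0" and Pu_zi': "Pu (adj_op (z i) x) = 0"
proof -
  let ?R = "z i o\<^sub>L Pu"
  have R: "clinear_op ?R" using zi_lin Pu_lin by auto
  have "adj_op Pu = Pu" by (rule adj_eqI[OF Pu_lin]) (rule inner_Pu)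
  then have R': "adj_op ?R = Pu o\<^sub>L adj_op (z i)" using zi_lin Pu_lin by simp
  have comm: "Pu (adj_op (z i) x) = adj_op (z i) (Pu x)" for x
    by (rule Pu_commute) (simp_all add: zi_lin zi_Pu_invariant)
  have le: "norm (z i (Pu x)) \<le> sqrt q * norm (adj_op (z i) (Pu x))" for x
  proof (rule power2_le_imp_le)
    let ?y = "Pu x"
    have "(norm (z i ?y))\<^sup>2 - q * (norm (adj_op (z i) ?y))\<^sup>2 =
        inner ?y (((adj_op (z i) o\<^sub>L z i) - q *\<^sub>R (z i o\<^sub>L adj_op (z i))) ?y)"
      using inner_adj[OF zi_lin, of ?y "adj_op (z i) ?y"] inner_adj_right[OF zi_lin, of ?y "z i ?y"]
      by (simp add: minus_blinfun.rep_eq scaleR_blinfun.rep_eq inner_diff_right power2_norm_eq_inner)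
    also have "\<dots> = (1 - q) * inner ?y ((E - (\<Sum>j\<in>{i+1..Suc n}. z j o\<^sub>L adj_op (z j))) ?y)"
      unfolding rep_z(6)[OF i_Suc(1)] by (simp add: scaleR_blinfun.rep_eq)
    also have "inner ?y ((E - (\<Sum>j\<in>{i+1..Suc n}. z j o\<^sub>L adj_op (z j))) ?y) =
        inner ?y (S ?y) - (\<Sum>j\<in>{i+1..n}. (norm (adj_op (z j) ?y))\<^sup>2)"
    proof -
      have "{i+1..Suc n} = insert (Suc n) {i+1..n}" using i by auto
      moreover have "inner ?y (z j (adj_op (z j) ?y)) = (norm (adj_op (z j) ?y))\<^sup>2" if "j \<in> {i+1..n}" for j
        using inner_adj[OF rep_z(1), of j] that by (simp add: power2_norm_eq_inner)
      ultimately show ?thesis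
        by (simp add: S_def minus_blinfun.rep_eq plus_blinfun.rep_eq blinfun.sum_left inner_diff_right inner_add_right
            inner_sum_right)
    qed
    also have "(1 - q) * \<dots> \<le> 0"
      using q01 by (intro mult_nonneg_nonpos) (simp_all add: S_Pu sum_nonneg)
    finally show "(norm (z i ?y))\<^sup>2 \<le> (sqrt q * norm (adj_op (z i) ?y))\<^sup>2"
      using q01 by (simp add: power_mult_distrib)
  qed (use q01 in simp)
  have "norm ?R \<le> sqrt q * norm ?R"
  proof (rule norm_blinfun_bound)
    fix x
    have "norm (?R x) \<le> sqrt q * norm (adj_op ?R x)" using le[of x] by (simp add: R' comm)
    also have "\<dots> \<le> sqrt q * (norm (adj_op ?R) * norm x)"
      using q01 by (intro mult_left_mono norm_blinfun) simp
    finally show "norm (?R x) \<le> sqrt q * norm ?R * norm x" using R by simp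
  qed (use q01 in simp)
  moreover have "sqrt q < 1" using q01 by simp
  ultimately have "norm ?R = 0"
    by (metis mult_less_cancel_right2 norm_ge_zero not_less order.order_iff_strict)
  then have R0: "?R = 0" by simp
  show "z i (Pu x) = 0" using arg_cong[OF R0, of "\<lambda>X. blinfun_apply X x"] by simp
  have "Pu o\<^sub>L adj_op (z i) = 0" using R' R0 by simp
  from arg_cong[OF this, of "\<lambda>X. blinfun_apply X x"] show "Pu (adj_op (z i) x) = 0" by simp
qed

end

text \<open>The representation of the smaller ball on the kernel of \<open>T'\<close>.\<close>
definition "w i = z i o\<^sub>L P0"

lemma adj_w: "i \<in> {1..n} \<Longrightarrow> adj_op (w i) = P0 o\<^sub>L adj_op (z i)"
  by (simp add: w_def zi_lin P0_lin P0_adj)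

lemma ball_rep_w: "ball_rep q n P0 w"
  unfolding ball_rep_def
proof (intro conjI ballI impI P0_projection)
  fix i assume i: "i \<in> {1..n}"
  note iS = i_Suc[OF i] and comm = P0_zi[OF i] P0_zi'[OF i]
  show "clinear_op (w i)" by (auto simp: w_def zi_lin[OF i] P0_lin)
  show "P0 o\<^sub>L w i = w i" "w i o\<^sub>L P0 = w i"
    by (rule blinfun_eqI, simp add: w_def comm P0_P0)+
  {
    fix j assume j: "j \<in> {1..n}" and ij: "i < j"
    note jS = i_Suc[OF j] and commj = P0_zi[OF j] P0_zi'[OF j]
    show "w i o\<^sub>L w j = sqrt q *\<^sub>R (w j o\<^sub>L w i)"
      using arg_cong[OF rep_z(4)[OF iS(1) jS(1) ij], of "\<lambda>X. blinfun_apply X (P0 _)"]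
      by (intro blinfun_eqI) (simp add: w_def comm commj P0_P0 scaleR_blinfun.rep_eq)
    show "w i o\<^sub>L adj_op (w j) = inverse (sqrt q) *\<^sub>R (adj_op (w j) o\<^sub>L w i)"
      unfolding adj_w[OF j]
      using arg_cong[OF rep_z(5)[OF iS(1) jS(1) ij], of "\<lambda>X. blinfun_apply X (P0 _)"]
      by (intro blinfun_eqI) (simp add: w_def comm commj P0_P0 scaleR_blinfun.rep_eq)
  }
  show "(adj_op (w i) o\<^sub>L w i) - q *\<^sub>R (w i o\<^sub>L adj_op (w i)) =
        (1 - q) *\<^sub>R (P0 - (\<Sum>j\<in>{i+1..n}. w j o\<^sub>L adj_op (w j)))"
  proof (rule blinfun_eqI)
    fix x
    have split: "{i+1..Suc n} = insert (Suc n) {i+1..n}" using i by auto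
    have "((adj_op (w i) o\<^sub>L w i) - q *\<^sub>R (w i o\<^sub>L adj_op (w i))) x =
        ((adj_op (z i) o\<^sub>L z i) - q *\<^sub>R (z i o\<^sub>L adj_op (z i))) (P0 x)"
      unfolding adj_w[OF i] by (simp add: w_def comm P0_P0 minus_blinfun.rep_eq scaleR_blinfun.rep_eq)
    also have "\<dots> = ((1 - q) *\<^sub>R (E - (\<Sum>j\<in>{i+1..Suc n}. z j o\<^sub>L adj_op (z j)))) (P0 x)"
      by (simp only: rep_z(6)[OF iS(1)])
    also have "\<dots> = ((1 - q) *\<^sub>R (P0 - (\<Sum>j\<in>{i+1..n}. w j o\<^sub>L adj_op (w j)))) x"
    proof -
      have "(w j o\<^sub>L adj_op (w j)) x = z j (adj_op (z j) (P0 x))" if "j \<in> {i+1..n}" for j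
      proof -
        have j: "j \<in> {1..n}" using that by auto
        show ?thesis unfolding adj_w[OF j] by (simp add: w_def P0_zi'[OF j] P0_P0)
      qed
      then show ?thesis
        unfolding split
        by (simp add: minus_blinfun.rep_eq scaleR_blinfun.rep_eq plus_blinfun.rep_eq blinfun.sum_left E_P0 T'_P0
            blinfun.zero_right)
    qed
    finally show "((adj_op (w i) o\<^sub>L w i) - q *\<^sub>R (w i o\<^sub>L adj_op (w i))) x =
        ((1 - q) *\<^sub>R (P0 - (\<Sum>j\<in>{i+1..n}. w j o\<^sub>L adj_op (w j)))) x" .
  qed
qed

end

section \<open>Poisson families\<close>

text \<open>
  The adjoint of the \<open>i\<close>-th generator of the model sends a family \<open>x\<close> on words to
  \<open>a \<mapsto> wt q n i a \<cdot> x (bump n i a)\<close>, where \<open>bump\<close> raises the entry that belongs to \<open>i\<close>. The head of a word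
  of length \<open>n\<close> belongs to the last generator.
\<close>
primrec wt :: "real \<Rightarrow> nat \<Rightarrow> nat \<Rightarrow> nat list \<Rightarrow> real" where
  "wt q 0 i a = 0"
| "wt q (Suc n) i a = (case a of [] \<Rightarrow> 0 | k # b \<Rightarrow>
     if i = Suc n then (if length b = n then sqrt (1 - q ^ Suc k) else 0) else sqrt q ^ k * wt q n i b)"

primrec bump :: "nat \<Rightarrow> nat \<Rightarrow> nat list \<Rightarrow> nat list" where
  "bump 0 i a = a"
| "bump (Suc n) i a = (case a of [] \<Rightarrow> [] | k # b \<Rightarrow> if i = Suc n then Suc k # b else k # bump n i b)"

lemma wt_length: "length a \<noteq> n \<Longrightarrow> wt q n i a = 0"
  by (induction n arbitrary: a) (auto split: list.splits)

lemma bump_nonzero: "i \<in> {1..n} \<Longrightarrow> length a = n \<Longrightarrow> bump n i a \<noteq> replicate n 0"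
proof (induction n arbitrary: a)
  case (Suc n)
  then show ?case by (cases a) auto
qed simp

text \<open>
  The components \<open>A a\<close>, for words \<open>a\<close>, of an isometry of the range of \<open>E\<close> into \<open>\<ell>\<^sup>2(\<nat>\<^sup>n) \<otimes> H\<close> that intertwines
  the adjoints of the generators with those of the model up to an error whose squared norm is at most \<open>e\<close>.
\<close>
definition poisson :: "real \<Rightarrow> nat \<Rightarrow> 'i op \<Rightarrow> (nat \<Rightarrow> 'i op) \<Rightarrow> real \<Rightarrow> (nat list \<Rightarrow> 'i op) \<Rightarrow> bool" where
  "poisson q n E z e A \<longleftrightarrow>
     (\<forall>a. clinear_op (A a)) \<and> (\<forall>a x. E (A a x) = A a x) \<and> (\<forall>a. length a \<noteq> n \<longrightarrow> A a = 0) \<and>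
     (\<forall>x. ((\<lambda>a. (norm (A a x))\<^sup>2) has_sum (norm (E x))\<^sup>2) UNIV) \<and>
     (\<forall>i\<in>{1..n}. \<forall>x. \<exists>s\<le>e * (norm x)\<^sup>2.
        ((\<lambda>a. (norm (A a (adj_op (z i) x) - wt q n i a *\<^sub>R A (bump n i a) x))\<^sup>2) has_sum s) UNIV)"

lemma has_sum_if:
  fixes v :: real
  shows "((\<lambda>b. if b = a then v else 0) has_sum v) UNIV"
proof -
  have "((\<lambda>b. v) has_sum (\<Sum>b\<in>{a}. v)) {a}" by (rule has_sum_finite) simp
  also have "?this \<longleftrightarrow> ((\<lambda>b. if b = a then v else 0) has_sum (\<Sum>b\<in>{a}. v)) UNIV"
    by (rule has_sum_cong_neutral) auto
  finally show ?thesis by simp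
qed

lemma has_sum_Cons:
  fixes f :: "nat list \<Rightarrow> real"
  assumes "\<And>k. ((\<lambda>b. f (k # b)) has_sum g k) UNIV" "(g has_sum S) UNIV" "\<And>a. f a \<ge> 0" "f [] = 0"
  shows "(f has_sum S) UNIV"
  by (rule has_sum_blocks[OF inj_lft, of f g]) (use assms notin_lft in auto)

lemma poisson_0:
  assumes "is_projection E" shows "poisson q 0 E z e (\<lambda>a. if a = [] then E else 0)"
proof -
  have E: "clinear_op E" "E (E x) = E x" for x
    using assms projection_norm(3)[OF assms] by (auto simp: is_projection_def)
  have "((\<lambda>a. (norm ((if a = [] then E else 0) x))\<^sup>2) has_sum (norm (E x))\<^sup>2) (UNIV :: nat list set)" for x
  proof -
    have "(\<lambda>a :: nat list. (norm ((if a = [] then E else 0) x))\<^sup>2) = (\<lambda>a. if a = [] then (norm (E x))\<^sup>2 else 0)" by auto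
    then show ?thesis using has_sum_if[of "[] :: nat list" "(norm (E x))\<^sup>2"] by simp
  qed
  then show ?thesis unfolding poisson_def using E by (auto simp: blinfun.zero_right)
qed

context ball_step
begin

context
  \<comment> \<open>The bound on \<open>r\<close> estimates the error made by replacing the unitary part with a shift.\<close>
  fixes r e :: real and A :: "nat list \<Rightarrow> 'i op"
  assumes r: "0 < r" "r < 1" and re: "4 * (1 - r\<^sup>2) / (1 - q\<^sup>2) \<le> e" and A: "poisson q n P0 w e A"
begin

text \<open>
  On the part spanned by the \<open>T\<^sup>k\<close>-images of the kernel of \<open>T'\<close>, a Poisson family is obtained from the
  coefficients \<open>P0 T'\<^sup>k x\<close>, normalised by \<open>pure_coeff\<close>, and the given family \<open>A\<close> on the kernel. On the
  unitary part, where the other generators vanish, geometric weights \<open>unitary_coeff\<close> are used and the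
  word of the smaller ball is constantly zero.
\<close>
definition "pure_coeff k = 1 / sqrt (qfac q k)"
definition "unitary_coeff k = r ^ k * sqrt (1 - r\<^sup>2)"

primrec step_family :: "nat list \<Rightarrow> 'i op" where
  "step_family [] = 0"
| "step_family (k # b) = pure_coeff k *\<^sub>R (A b o\<^sub>L P0 o\<^sub>L opow T' k) + (if b = replicate n 0 then unitary_coeff k *\<^sub>R (Pu o\<^sub>L opow T' k) else 0)"

lemma A_props: "clinear_op (A b)" "P0 (A b x) = A b x" "length b \<noteq> n \<Longrightarrow> A b = 0"
    "((\<lambda>b. (norm (A b x))\<^sup>2) has_sum (norm (P0 x))\<^sup>2) UNIV"
  using A unfolding poisson_def by blast+

lemma r2: "0 < 1 - r\<^sup>2" "1 - r\<^sup>2 < 1" "r\<^sup>2 < 1"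
  using r by (simp_all add: power_less_one_iff)

lemma e_pos: "0 \<le> e"
proof -
  have "q\<^sup>2 < 1" using q01 by (simp add: power_less_one_iff)
  then have "0 \<le> 4 * (1 - r\<^sup>2) / (1 - q\<^sup>2)" using r2 by simp
  then show ?thesis using re by linarith
qed

lemma step_family_apply: "step_family (k # b) x = pure_coeff k *\<^sub>R A b (P0 (opow T' k x)) +
    (if b = replicate n 0 then unitary_coeff k *\<^sub>R Pu (opow T' k x) else 0)"
  by (simp add: plus_blinfun.rep_eq scaleR_blinfun.rep_eq)

declare step_family.simps [simp del]

lemma c_sq: "(pure_coeff k)\<^sup>2 = 1 / qfac q k"
  using qfac_pos[OF q01, of k] by (simp add: pure_coeff_def power_divide)

lemma d_sq: "(unitary_coeff k)\<^sup>2 = (r\<^sup>2) ^ k * (1 - r\<^sup>2)"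
  using r2 by (simp add: unitary_coeff_def power_mult_distrib power_mult[symmetric] mult.commute)

lemma norm_step_family_sq: "(norm (step_family (k # b) x))\<^sup>2 = (norm (A b (P0 (opow T' k x))))\<^sup>2 / qfac q k +
    (if b = replicate n 0 then (unitary_coeff k)\<^sup>2 * (norm (Pu x))\<^sup>2 else 0)"
proof -
  have orth: "inner (A b y) (Pu u) = 0" for y u
    by (subst A_props(2)[symmetric]) (simp add: inner_P0 P0_Pu)
  have "(norm (pure_coeff k *\<^sub>R A b y + unitary_coeff k *\<^sub>R Pu u))\<^sup>2 = (pure_coeff k)\<^sup>2 * (norm (A b y))\<^sup>2 + (unitary_coeff k)\<^sup>2 * (norm (Pu u))\<^sup>2" for y u
    using orth[of y u] inner_commute[of "Pu u" "A b y"]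
    by (simp only: power2_norm_eq_inner) (simp add: inner_add_left inner_add_right power2_eq_square)
  from this[of "P0 (opow T' k x)" "opow T' k x"] show ?thesis
    by (cases "b = replicate n 0") (simp_all add: step_family_apply c_sq Pu_T'pow_norm power_mult_distrib)
qed

lemma A_sum: "((\<lambda>b. (norm (A b (P0 y)))\<^sup>2) has_sum (norm (P0 y))\<^sup>2) UNIV"
  using A_props(4)[of "P0 y"] by (simp add: P0_P0)

lemma sums_has_sum: "((\<lambda>k. (norm (P0 (opow T' k x)))\<^sup>2 / qfac q k) has_sum ((norm (E x))\<^sup>2 - (norm (Pu x))\<^sup>2)) UNIV"
  by (rule sums_nonneg_imp_has_sum[OF norm_Pu]) (simp add: qfac_pos[OF q01] less_imp_le)

lemma step_family_isometry: "((\<lambda>a. (norm (step_family a x))\<^sup>2) has_sum (norm (E x))\<^sup>2) UNIV"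
proof (rule has_sum_Cons)
  fix k
  have 1: "((\<lambda>b. (norm (A b (P0 (opow T' k x))))\<^sup>2 / qfac q k) has_sum (norm (P0 (opow T' k x)))\<^sup>2 / qfac q k) UNIV"
    unfolding divide_inverse by (intro has_sum_cmult_left A_sum)
  have 2: "((\<lambda>b. if b = replicate n 0 then (unitary_coeff k)\<^sup>2 * (norm (Pu x))\<^sup>2 else 0) has_sum (unitary_coeff k)\<^sup>2 * (norm (Pu x))\<^sup>2) UNIV"
    by (rule has_sum_if)
  show "((\<lambda>b. (norm (step_family (k # b) x))\<^sup>2) has_sum
      ((norm (P0 (opow T' k x)))\<^sup>2 / qfac q k + (unitary_coeff k)\<^sup>2 * (norm (Pu x))\<^sup>2)) UNIV"
    unfolding norm_step_family_sq by (rule has_sum_add[OF 1 2])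
next
  have "(\<lambda>k. (r\<^sup>2) ^ k * ((1 - r\<^sup>2) * (norm (Pu x))\<^sup>2)) sums (1 / (1 - r\<^sup>2) * ((1 - r\<^sup>2) * (norm (Pu x))\<^sup>2))"
    using r2 by (intro sums_mult2 geometric_sums) simp
  then have "(\<lambda>k. (unitary_coeff k)\<^sup>2 * (norm (Pu x))\<^sup>2) sums (norm (Pu x))\<^sup>2"
    using r2 by (simp add: d_sq mult.assoc)
  then have "((\<lambda>k. (unitary_coeff k)\<^sup>2 * (norm (Pu x))\<^sup>2) has_sum (norm (Pu x))\<^sup>2) UNIV"
    by (rule sums_nonneg_imp_has_sum) simp
  from has_sum_add[OF sums_has_sum[of x] this]
  show "((\<lambda>k. (norm (P0 (opow T' k x)))\<^sup>2 / qfac q k + (unitary_coeff k)\<^sup>2 * (norm (Pu x))\<^sup>2) has_sum (norm (E x))\<^sup>2) UNIV"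
    by simp
qed (simp_all add: step_family.simps)

text \<open>
  The terms of the first kind cancel. In the terms of the second kind the factor
  \<open>1 - r (1 - q\<^bsup>k+1\<^esup>)\<^bsup>1/2\<^esup> \<le> (1 - r\<^sup>2) + q\<^sup>k\<close> remains, whose squares are summed against the weights \<open>r\<^bsup>2k\<^esup> (1 - r\<^sup>2)\<close>.
\<close>
lemma step_family_intertwines_top:
  "\<exists>s\<le>e * (norm x)\<^sup>2.
     ((\<lambda>a. (norm (step_family a (T' x) - wt q (Suc n) (Suc n) a *\<^sub>R step_family (bump (Suc n) (Suc n) a) x))\<^sup>2) has_sum s) UNIV"
proof -
  define h where "h k = unitary_coeff k * (1 - r * sqrt (1 - q ^ Suc k))" for k
  have diff: "step_family (k # b) (T' x) - wt q (Suc n) (Suc n) (k # b) *\<^sub>R step_family (bump (Suc n) (Suc n) (k # b)) x =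
      (if b = replicate n 0 then h k *\<^sub>R Pu (opow T' (Suc k) x) else 0)" for k b
  proof (cases "length b = n")
    case True
    have ck: "sqrt (1 - q ^ Suc k) * pure_coeff (Suc k) = pure_coeff k"
    proof -
      have "1 - q ^ Suc k > 0" using q01 by (simp add: power_Suc_less_one del: power_Suc)
      then show ?thesis by (simp add: pure_coeff_def real_sqrt_mult del: power_Suc)
    qed
    have dk: "unitary_coeff k - sqrt (1 - q ^ Suc k) * unitary_coeff (Suc k) = h k" by (simp add: unitary_coeff_def h_def algebra_simps)
    have "step_family (k # b) (T' x) - sqrt (1 - q ^ Suc k) *\<^sub>R step_family (Suc k # b) x =
        (pure_coeff k - sqrt (1 - q ^ Suc k) * pure_coeff (Suc k)) *\<^sub>R A b (P0 (opow T' (Suc k) x)) +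
        (if b = replicate n 0 then (unitary_coeff k - sqrt (1 - q ^ Suc k) * unitary_coeff (Suc k)) *\<^sub>R Pu (opow T' (Suc k) x) else 0)"
      by (simp only: step_family_apply opow_shift opow_apply) (simp add: algebra_simps del: power_Suc)
    then show ?thesis using True by (simp add: ck dk del: power_Suc)
  next
    case False
    then show ?thesis by (auto simp add: step_family_apply A_props(3))
  qed
  have hk: "(h k)\<^sup>2 \<le> (r\<^sup>2) ^ k * (1 - r\<^sup>2) * (2 * (1 - r\<^sup>2)\<^sup>2) + 2 * (q\<^sup>2) ^ k * (1 - r\<^sup>2)" for k
  proof -
    have s: "0 \<le> q ^ Suc k" "q ^ Suc k \<le> q ^ k" "q ^ Suc k \<le> 1"
      using q01 by (simp_all add: mult_left_le_one_le power_le_one mult_le_one)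
    have le1: "1 - q ^ Suc k \<le> sqrt (1 - q ^ Suc k)"
      by (rule real_le_rsqrt) (use s in \<open>simp add: power2_eq_square mult_left_le_one_le del: power_Suc\<close>)
    have le2: "sqrt (1 - q ^ Suc k) \<le> 1" using s by (simp del: power_Suc)
    have "1 - r * sqrt (1 - q ^ Suc k) \<le> 1 - r * (1 - q ^ Suc k)"
      using mult_left_mono[OF le1, of r] r by linarith
    also have "\<dots> \<le> (1 - r) + q ^ k"
    proof -
      have "r * q ^ Suc k \<le> 1 * q ^ k" using r s by (intro mult_mono) auto
      then show ?thesis by (simp add: algebra_simps)
    qed
    also have "\<dots> \<le> (1 - r\<^sup>2) + q ^ k"
      using r by (simp add: power2_eq_square mult_left_le_one_le)
    finally have u: "1 - r * sqrt (1 - q ^ Suc k) \<le> (1 - r\<^sup>2) + q ^ k" .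
    have "r * sqrt (1 - q ^ Suc k) \<le> 1 * 1" using r le2 s by (intro mult_mono) auto
    then have "(1 - r * sqrt (1 - q ^ Suc k))\<^sup>2 \<le> ((1 - r\<^sup>2) + q ^ k)\<^sup>2"
      by (intro power_mono u) simp
    also have "\<dots> \<le> 2 * (1 - r\<^sup>2)\<^sup>2 + 2 * (q ^ k)\<^sup>2"
      using zero_le_power2[of "(1 - r\<^sup>2) - q ^ k"] by (simp add: power2_sum power2_diff)
    finally have v: "(1 - r * sqrt (1 - q ^ Suc k))\<^sup>2 \<le> 2 * (1 - r\<^sup>2)\<^sup>2 + 2 * (q\<^sup>2) ^ k"
      by (simp add: power_mult[symmetric] mult.commute)
    have "(h k)\<^sup>2 = (unitary_coeff k)\<^sup>2 * (1 - r * sqrt (1 - q ^ Suc k))\<^sup>2" by (simp add: h_def power_mult_distrib)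
    also have "\<dots> \<le> (unitary_coeff k)\<^sup>2 * (2 * (1 - r\<^sup>2)\<^sup>2 + 2 * (q\<^sup>2) ^ k)" by (intro mult_left_mono v) simp
    also have "\<dots> = (r\<^sup>2) ^ k * (1 - r\<^sup>2) * (2 * (1 - r\<^sup>2)\<^sup>2) + (r\<^sup>2) ^ k * (2 * (q\<^sup>2) ^ k * (1 - r\<^sup>2))"
      by (simp add: d_sq algebra_simps)
    also have "(r\<^sup>2) ^ k * (2 * (q\<^sup>2) ^ k * (1 - r\<^sup>2)) \<le> 1 * (2 * (q\<^sup>2) ^ k * (1 - r\<^sup>2))"
      using r2 by (intro mult_right_mono) (simp_all add: power_le_one)
    finally show ?thesis by simp
  qed
  have q2: "q\<^sup>2 < 1" "0 \<le> q\<^sup>2" using q01 by (simp_all add: power_less_one_iff)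
  let ?M = "\<lambda>k. ((r\<^sup>2) ^ k * (1 - r\<^sup>2) * (2 * (1 - r\<^sup>2)\<^sup>2) + 2 * (q\<^sup>2) ^ k * (1 - r\<^sup>2)) * (norm (Pu x))\<^sup>2"
  have Msums: "?M sums ((1 / (1 - r\<^sup>2) * (1 - r\<^sup>2) * (2 * (1 - r\<^sup>2)\<^sup>2) + 2 * (1 / (1 - q\<^sup>2)) * (1 - r\<^sup>2)) * (norm (Pu x))\<^sup>2)"
    using r2 q2 by (intro sums_mult2 sums_add sums_mult geometric_sums) simp_all
  have M: "(?M has_sum ((2 * (1 - r\<^sup>2)\<^sup>2 + 2 * (1 - r\<^sup>2) / (1 - q\<^sup>2)) * (norm (Pu x))\<^sup>2)) UNIV"
    using sums_nonneg_imp_has_sum[OF Msums] r2 q2 by simp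
  have hM: "(h k)\<^sup>2 * (norm (Pu x))\<^sup>2 \<le> ?M k" for k by (intro mult_right_mono hk) simp
  have sm: "(\<lambda>k. (h k)\<^sup>2 * (norm (Pu x))\<^sup>2) summable_on UNIV"
    by (rule summable_on_comparison_test[OF has_sum_imp_summable[OF M]]) (use hM in auto)
  let ?s = "\<Sum>\<^sub>\<infinity>k. (h k)\<^sup>2 * (norm (Pu x))\<^sup>2"
  have "?s \<le> (2 * (1 - r\<^sup>2)\<^sup>2 + 2 * (1 - r\<^sup>2) / (1 - q\<^sup>2)) * (norm (Pu x))\<^sup>2"
    by (rule has_sum_mono[OF has_sum_infsum[OF sm] M]) (rule hM)
  also have "\<dots> \<le> e * (norm x)\<^sup>2"
  proof (rule mult_mono)
    have "(1 - r\<^sup>2)\<^sup>2 \<le> (1 - r\<^sup>2) * 1" unfolding power2_eq_square[of "1 - r\<^sup>2"] using r2 by (intro mult_left_mono) auto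
    also have "\<dots> \<le> (1 - r\<^sup>2) / (1 - q\<^sup>2)" using r2 q2 by (simp add: field_simps mult_left_le)
    finally have "(1 - r\<^sup>2)\<^sup>2 \<le> (1 - r\<^sup>2) / (1 - q\<^sup>2)" .
    then show "2 * (1 - r\<^sup>2)\<^sup>2 + 2 * (1 - r\<^sup>2) / (1 - q\<^sup>2) \<le> e"
      using re by (simp only: times_divide_eq_right[symmetric])
    have Pu_proj: "is_projection Pu"
      unfolding is_projection_def
      by (intro conjI Pu_lin adj_eqI[OF Pu_lin] inner_Pu) (rule blinfun_eqI, simp add: Pu_Pu)
    show "(norm (Pu x))\<^sup>2 \<le> (norm x)\<^sup>2" by (intro power_mono projection_norm(2)[OF Pu_proj]) simp
  qed (use e_pos in auto)
  finally have le: "?s \<le> e * (norm x)\<^sup>2" .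
  have "((\<lambda>a. (norm (step_family a (T' x) - wt q (Suc n) (Suc n) a *\<^sub>R step_family (bump (Suc n) (Suc n) a) x))\<^sup>2) has_sum ?s) UNIV"
  proof (rule has_sum_Cons)
    fix k
    have nb: "(norm (if b = replicate n 0 then h k *\<^sub>R Pu (opow T' (Suc k) x) else 0))\<^sup>2 =
        (if b = replicate n 0 then (h k)\<^sup>2 * (norm (Pu x))\<^sup>2 else 0)" for b
      by (simp add: Pu_T'pow_norm power_mult_distrib del: opow_apply opow.simps)
    show "((\<lambda>b. (norm (step_family (k # b) (T' x) - wt q (Suc n) (Suc n) (k # b) *\<^sub>R
        step_family (bump (Suc n) (Suc n) (k # b)) x))\<^sup>2) has_sum (h k)\<^sup>2 * (norm (Pu x))\<^sup>2) UNIV"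
      unfolding diff nb by (rule has_sum_if)
  qed (use sm in \<open>simp_all add: step_family.simps del: opow_apply\<close>)
  then show ?thesis using le by blast
qed

text \<open>
  Passing \<open>z i\<close> through \<open>T'\<^sup>k\<close> costs the factor \<open>q\<^bsup>k/2\<^esup>\<close> that the model has at \<open>k # b\<close>, so that only the errors of \<open>A\<close>
  remain. The second summand does not contribute, because \<open>Pu\<close> annihilates the range of the adjoint of
  \<open>z i\<close> and \<open>bump\<close> never yields the zero word.
\<close>
lemma step_family_intertwines_lower:
  assumes i: "i \<in> {1..n}"
  shows "\<exists>s\<le>e * (norm x)\<^sup>2.
     ((\<lambda>a. (norm (step_family a (adj_op (z i) x) - wt q (Suc n) i a *\<^sub>R step_family (bump (Suc n) i a) x))\<^sup>2) has_sum s) UNIV"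
proof -
  have iSuc: "i \<noteq> Suc n" using i by auto
  define y where "y k = P0 (opow T' k x)" for k
  define F where "F k b = (norm (A b (adj_op (w i) (y k)) - wt q n i b *\<^sub>R A (bump n i b) (y k)))\<^sup>2" for k b
  have "\<exists>s\<le>e * (norm (y k))\<^sup>2. (F k has_sum s) UNIV" for k
    using A i unfolding poisson_def F_def by blast
  then have "\<forall>k. \<exists>s. s \<le> e * (norm (y k))\<^sup>2 \<and> (F k has_sum s) UNIV" by blast
  from choice[OF this] obtain s where s: "\<And>k. s k \<le> e * (norm (y k))\<^sup>2" "\<And>k. (F k has_sum s k) UNIV"
    by blast
  have diff: "step_family (k # b) (adj_op (z i) x) - wt q (Suc n) i (k # b) *\<^sub>R step_family (bump (Suc n) i (k # b)) x =
      (pure_coeff k * sqrt q ^ k) *\<^sub>R (A b (adj_op (w i) (y k)) - wt q n i b *\<^sub>R A (bump n i b) (y k))" for k b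
  proof -
    have 1: "P0 (opow T' k (adj_op (z i) x)) = sqrt q ^ k *\<^sub>R adj_op (w i) (y k)"
      unfolding adj_w[OF i] y_def
      by (simp add: T'pow_zi'[OF i] blinfun.scaleR_right P0_zi'[OF i] P0_P0)
    have 2: "Pu (opow T' k (adj_op (z i) x)) = 0"
      by (simp add: T'pow_zi'[OF i] blinfun.scaleR_right Pu_zi'[OF i])
    have "wt q n i b *\<^sub>R (if bump n i b = replicate n 0 then u else 0) = 0" for u :: "'i ell2"
      using bump_nonzero[OF i, of b] wt_length[of b n q i] by (cases "length b = n") auto
    then have 3: "wt q n i b *\<^sub>R step_family (k # bump n i b) x = (pure_coeff k * wt q n i b) *\<^sub>R A (bump n i b) (y k)"
      unfolding step_family_apply y_def[symmetric] scaleR_add_right by (simp add: mult.commute)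
    have "wt q (Suc n) i (k # b) *\<^sub>R step_family (bump (Suc n) i (k # b)) x =
        sqrt q ^ k *\<^sub>R (wt q n i b *\<^sub>R step_family (k # bump n i b) x)"
      using iSuc by (simp)
    then show ?thesis
      unfolding 3 by (simp add: step_family_apply 1 2 blinfun.scaleR_right scaleR_diff_right mult_ac del: wt.simps bump.simps)
  qed
  let ?g = "\<lambda>k. (pure_coeff k * sqrt q ^ k)\<^sup>2 * s k"
  have inner_sum: "((\<lambda>b. (norm (step_family (k # b) (adj_op (z i) x) -
      wt q (Suc n) i (k # b) *\<^sub>R step_family (bump (Suc n) i (k # b)) x))\<^sup>2) has_sum ?g k) UNIV" for k
    using has_sum_cmult_right[OF s(2), of "(pure_coeff k * sqrt q ^ k)\<^sup>2" k]
    unfolding diff norm_scaleR power_mult_distrib[of "\<bar>_\<bar>"] power2_abs F_def .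
  have s_nonneg: "0 \<le> s k" for k by (rule has_sum_nonneg[OF s(2)]) (simp add: F_def)
  have M: "((\<lambda>k. e * ((norm (P0 (opow T' k x)))\<^sup>2 / qfac q k)) has_sum e * ((norm (E x))\<^sup>2 - (norm (Pu x))\<^sup>2)) UNIV"
    by (intro has_sum_cmult_right sums_has_sum)
  have gM: "?g k \<le> e * ((norm (P0 (opow T' k x)))\<^sup>2 / qfac q k)" for k
  proof -
    have "(pure_coeff k * sqrt q ^ k)\<^sup>2 \<le> (pure_coeff k)\<^sup>2 * 1"
      unfolding power_mult_distrib using q01
      by (intro mult_left_mono) (simp_all add: power_le_one power_mult[symmetric])
    then have "?g k \<le> (pure_coeff k)\<^sup>2 * (e * (norm (y k))\<^sup>2)"
      using s(1)[of k] s_nonneg[of k] by (intro mult_mono) auto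
    then show ?thesis by (simp add: c_sq y_def)
  qed
  have sm: "?g summable_on UNIV"
    by (rule summable_on_comparison_test[OF has_sum_imp_summable[OF M]]) (use gM s_nonneg in auto)
  have "infsum ?g UNIV \<le> e * ((norm (E x))\<^sup>2 - (norm (Pu x))\<^sup>2)"
    by (rule has_sum_mono[OF has_sum_infsum[OF sm] M]) (rule gM)
  also have "\<dots> \<le> e * (norm x)\<^sup>2"
  proof (rule mult_left_mono[OF _ e_pos])
    have "(norm (E x))\<^sup>2 \<le> (norm x)\<^sup>2" by (intro power_mono norm_E) simp
    then show "(norm (E x))\<^sup>2 - (norm (Pu x))\<^sup>2 \<le> (norm x)\<^sup>2" using zero_le_power2[of "norm (Pu x)"] by linarith
  qed
  finally have "infsum ?g UNIV \<le> e * (norm x)\<^sup>2" .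
  moreover have "((\<lambda>a. (norm (step_family a (adj_op (z i) x) - wt q (Suc n) i a *\<^sub>R step_family (bump (Suc n) i a) x))\<^sup>2)
      has_sum infsum ?g UNIV) UNIV"
    by (rule has_sum_Cons[OF inner_sum has_sum_infsum[OF sm]]) (simp_all add: step_family.simps)
  ultimately show ?thesis by blast
qed

lemma poisson_step_family: "poisson q (Suc n) E z e step_family"
  unfolding poisson_def
proof (intro conjI allI ballI impI)
  show "clinear_op (step_family a)" for a by (cases a) (auto simp: step_family.simps A_props P0_lin Pu_lin T'_lin)
  show "E (step_family a x) = step_family a x" for a x
  proof (cases a)
    case (Cons k b)
    have "E (A b y) = A b y" for y by (metis A_props(2) E_P0(1))
    then show ?thesis unfolding Cons by (simp add: step_family_apply blinfun.bilinear_simps E_Pu)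
  qed (simp add: step_family.simps blinfun.zero_right)
  show "step_family a = 0" if "length a \<noteq> Suc n" for a
    using that A_props(3) by (cases a) (auto simp: step_family.simps)
  show "((\<lambda>a. (norm (step_family a x))\<^sup>2) has_sum (norm (E x))\<^sup>2) UNIV" for x by (rule step_family_isometry)
  fix i x assume "i \<in> {1..Suc n}"
  then consider "i = Suc n" | "i \<in> {1..n}" by fastforce
  then show "\<exists>s\<le>e * (norm x)\<^sup>2.
     ((\<lambda>a. (norm (step_family a (adj_op (z i) x) - wt q (Suc n) i a *\<^sub>R step_family (bump (Suc n) i a) x))\<^sup>2) has_sum s) UNIV"
    using step_family_intertwines_top step_family_intertwines_lower by cases blast+
qed

end
end

theorem poisson_exists:
  assumes q: "0 < q" "q < 1" and e: "e > 0" and rep: "ball_rep q n E z"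
  shows "\<exists>A. poisson q n E z e A"
  using rep
proof (induction n arbitrary: E z)
  case 0
  then show ?case using poisson_0 unfolding ball_rep_def by blast
next
  case (Suc n)
  interpret ball_step q n E z by unfold_locales (use q Suc.prems in auto)
  obtain A where A: "poisson q n P0 w e A" using Suc.IH[OF ball_rep_w] by blast
  have q2: "q\<^sup>2 < 1" using q by (simp add: power_less_one_iff)
  \<comment> \<open>\<open>s\<close> is the value of \<open>1 - r\<^sup>2\<close>.\<close>
  define s where "s = min (1/2) (e * (1 - q\<^sup>2) / 4)"
  have s: "0 < s" "s < 1" "s \<le> e * (1 - q\<^sup>2) / 4" using e q2 by (auto simp: s_def min_def)
  define r where "r = sqrt (1 - s)"
  have "0 < r" "r < 1" "1 - r\<^sup>2 = s" using s by (auto simp: r_def)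
  moreover have "4 * s / (1 - q\<^sup>2) \<le> e" using s q2 by (simp add: field_simps)
  ultimately have "poisson q (Suc n) E z e (step_family r A)" by (intro poisson_step_family A) auto
  then show ?case by blast
qed

section \<open>The model representation\<close>

lemma is_projection_proj: "is_projection (proj_op I)"
  by (simp add: is_projection_def)

lemma id_compose [simp]: "id_blinfun o\<^sub>L X = X" "X o\<^sub>L id_blinfun = X"
  by (rule blinfun_eqI, simp)+

text \<open>The default value for unbounded \<open>f\<close> only serves to make this a total function.\<close>
lift_definition diag_ell2 :: "(nat \<Rightarrow> real) \<Rightarrow> nat ell2 \<Rightarrow> nat ell2" is
  "\<lambda>f x k. if bounded (range f) then complex_of_real (f k) * x k else 0"
proof -
  fix f :: "nat \<Rightarrow> real" and x :: "nat \<Rightarrow> complex"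
  assume x: "(\<lambda>i. (cmod (x i))\<^sup>2) summable_on UNIV"
  show "(\<lambda>k. (cmod (if bounded (range f) then complex_of_real (f k) * x k else 0))\<^sup>2) summable_on UNIV"
  proof (cases "bounded (range f)")
    case True
    then obtain M where M: "\<And>k. \<bar>f k\<bar> \<le> M" by (auto simp: bounded_iff)
    show ?thesis
    proof (rule summable_on_comparison_test[OF summable_on_cmult_right[OF x, of "M\<^sup>2"]])
      fix k
      have "\<bar>f k\<bar>\<^sup>2 * (cmod (x k))\<^sup>2 \<le> M\<^sup>2 * (cmod (x k))\<^sup>2"
        using M by (intro mult_right_mono power_mono) auto
      then show "(cmod (if bounded (range f) then complex_of_real (f k) * x k else 0))\<^sup>2 \<le> M\<^sup>2 * (cmod (x k))\<^sup>2"
        using True by (simp add: norm_mult power_mult_distrib)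
    qed simp
  qed simp
qed

definition diag_op :: "(nat \<Rightarrow> real) \<Rightarrow> nat op" where
  "diag_op f = Blinfun (diag_ell2 f)"

lemma
  assumes f: "\<And>k. \<bar>f k\<bar> \<le> M"
  shows coord_diag: "coord (diag_op f x) k = complex_of_real (f k) * coord x k"
    and norm_diag_le: "norm (diag_op f) \<le> M"
proof -
  have bdd: "bounded (range f)" using f by (auto simp: bounded_iff)
  have c: "coord (diag_ell2 f x) k = complex_of_real (f k) * coord x k" for x k
    using bdd by (simp add: diag_ell2.rep_eq)
  have M: "M \<ge> 0" using f[of 0] by linarith
  have le: "norm (diag_ell2 f x) \<le> M * norm x" for x
  proof (rule power2_le_imp_le)
    have "(norm (diag_ell2 f x))\<^sup>2 = (\<Sum>\<^sub>\<infinity>k. (cmod (coord (diag_ell2 f x) k))\<^sup>2)" by (rule norm_ell2_square)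
    also have "\<dots> \<le> (\<Sum>\<^sub>\<infinity>k. M\<^sup>2 * (cmod (coord x k))\<^sup>2)"
    proof (rule infsum_mono[OF coord_square_summable summable_on_cmult_right[OF coord_square_summable]])
      fix k
      show "(cmod (coord (diag_ell2 f x) k))\<^sup>2 \<le> M\<^sup>2 * (cmod (coord x k))\<^sup>2"
        unfolding c norm_mult power_mult_distrib norm_of_real
        using f by (intro mult_right_mono power_mono) auto
    qed
    also have "\<dots> = (M * norm x)\<^sup>2"
      by (simp add: infsum_cmult_right' norm_ell2_square power_mult_distrib)
    finally show "(norm (diag_ell2 f x))\<^sup>2 \<le> (M * norm x)\<^sup>2" .
  qed (use M in simp)
  have "bounded_linear (diag_ell2 f)"
    by (rule bounded_linear_intro[where K=M])
      (use le in \<open>auto intro!: ell2_eqI simp: c coord_simps coord_scaleR algebra_simps\<close>)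
  then have app: "diag_op f x = diag_ell2 f x" for x by (simp add: diag_op_def bounded_linear_Blinfun_apply)
  show "coord (diag_op f x) k = complex_of_real (f k) * coord x k" by (simp add: app c)
  show "norm (diag_op f) \<le> M" by (rule norm_blinfun_bound) (use M le in \<open>simp_all add: app\<close>)
qed

lemma diag_ket:
  assumes "\<And>k. \<bar>f k\<bar> \<le> M" shows "diag_op f (ket k) = f k *\<^sub>R ket k"
  by (rule ell2_eqI) (simp add: coord_diag[OF assms] coord_simps coord_scaleR)

lemma clinear_diag: "(\<And>k. \<bar>f k\<bar> \<le> M) \<Longrightarrow> clinear_op (diag_op f)"
  unfolding clinear_op_def
  by (intro allI ell2_eqI) (simp add: coord_diag[where f=f and M=M] coord_simps)

lemma adj_diag:
  assumes "\<And>k. \<bar>f k\<bar> \<le> M" shows "adj_op (diag_op f) = diag_op f"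
proof (rule blinfun_eqI, rule ell2_eqI)
  fix x k
  have "cinner (f k *\<^sub>R ket k) x = complex_of_real (f k) * coord x k"
    unfolding cscale_of_real[symmetric] by (simp add: cinner_cscale_left cinner_ket_left)
  then show "coord (adj_op (diag_op f) x) k = coord (diag_op f x) k"
    by (simp add: coord_adj[OF clinear_diag[OF assms]] diag_ket[OF assms] coord_diag[OF assms])
qed

lemma clinear_shift: "clinear_op unilateral_shift"
  unfolding clinear_op_def by (auto intro!: ell2_eqI simp: coord_unilateral_shift coord_simps split: nat.splits)

lemma coord_adj_shift: "coord (adj_op unilateral_shift x) k = coord x (Suc k)"
  by (simp add: coord_adj[OF clinear_shift] unilateral_shift_ket cinner_ket_left)

abbreviation words :: "nat \<Rightarrow> nat list set" where
  "words n \<equiv> {xs. length xs = n}"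

context
  fixes q :: real
  assumes q: "0 < q" "q < 1"
begin

definition "shift_weight k = sqrt (1 - q ^ Suc k)"
definition "weighted_shift = unilateral_shift o\<^sub>L diag_op shift_weight"
definition "damping = diag_op (\<lambda>k. sqrt q ^ k)"

lemma shift_weight_bound: "\<bar>shift_weight k\<bar> \<le> 1" and shift_weight_pos: "shift_weight k > 0" and shift_weight_sq: "shift_weight k * shift_weight k = 1 - q ^ Suc k"
    and shift_weight_le: "shift_weight k \<le> 1"
proof -
  have "0 < q ^ Suc k" "q ^ Suc k < 1" using q by (simp_all add: power_Suc_less_one del: power_Suc)
  then show "\<bar>shift_weight k\<bar> \<le> 1" "shift_weight k > 0" "shift_weight k * shift_weight k = 1 - q ^ Suc k" "shift_weight k \<le> 1"
    by (simp_all add: shift_weight_def del: power_Suc)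
qed

lemma shift_weight_sq_complex: "complex_of_real (shift_weight k) * complex_of_real (shift_weight k) = 1 - complex_of_real (q ^ Suc k)"
  unfolding of_real_mult[symmetric] shift_weight_sq by simp

lemma sqrt_pow_bound: "\<bar>sqrt q ^ k\<bar> \<le> 1" and sqrt_pow_sq: "sqrt q ^ k * sqrt q ^ k = q ^ k"
  using q by (simp_all add: abs_mult power_abs power_le_one power_mult_distrib[symmetric])

lemma coord_damping: "coord (damping x) k = complex_of_real (sqrt q ^ k) * coord x k"
  unfolding damping_def by (rule coord_diag[OF sqrt_pow_bound])

lemma damping_lin: "clinear_op damping" and damping_adj: "adj_op damping = damping"
  unfolding damping_def by (rule clinear_diag[OF sqrt_pow_bound]) (rule adj_diag[OF sqrt_pow_bound])

lemma weighted_shift_lin: "clinear_op weighted_shift"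
  unfolding weighted_shift_def by (intro clinear_compose clinear_shift clinear_diag[OF shift_weight_bound])

lemma coord_weighted_shift: "coord (weighted_shift x) 0 = 0" "coord (weighted_shift x) (Suc k) = complex_of_real (shift_weight k) * coord x k"
  by (simp_all add: weighted_shift_def coord_unilateral_shift coord_diag[OF shift_weight_bound])

lemma adj_weighted_shift: "adj_op weighted_shift = diag_op shift_weight o\<^sub>L adj_op unilateral_shift"
  unfolding weighted_shift_def by (simp add: clinear_shift clinear_diag[OF shift_weight_bound] adj_diag[OF shift_weight_bound])

lemma coord_adj_weighted_shift: "coord (adj_op weighted_shift x) k = complex_of_real (shift_weight k) * coord x (Suc k)"
  by (simp add: adj_weighted_shift coord_diag[OF shift_weight_bound] coord_adj_shift)

lemma coord_scaleR_op: "coord (blinfun_apply (r *\<^sub>R X) x) k = complex_of_real r * coord (blinfun_apply X x) k"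
  by (simp add: scaleR_blinfun.rep_eq coord_scaleR)

lemma damping_weighted_shift: "damping o\<^sub>L weighted_shift = sqrt q *\<^sub>R (weighted_shift o\<^sub>L damping)"
proof (rule blinfun_eqI, rule ell2_eqI)
  show "coord ((damping o\<^sub>L weighted_shift) x) k = coord ((sqrt q *\<^sub>R (weighted_shift o\<^sub>L damping)) x) k" for x k
    by (cases k) (simp_all add: coord_scaleR_op coord_damping coord_weighted_shift)
qed

lemma damping_adj_weighted_shift: "damping o\<^sub>L adj_op weighted_shift = inverse (sqrt q) *\<^sub>R (adj_op weighted_shift o\<^sub>L damping)"
proof (rule blinfun_eqI, rule ell2_eqI)
  show "coord ((damping o\<^sub>L adj_op weighted_shift) x) k = coord ((inverse (sqrt q) *\<^sub>R (adj_op weighted_shift o\<^sub>L damping)) x) k" for x k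
    using q by (simp add: coord_scaleR_op coord_damping coord_adj_weighted_shift)
qed

lemma weighted_shift_relation: "(adj_op weighted_shift o\<^sub>L weighted_shift) - q *\<^sub>R (weighted_shift o\<^sub>L adj_op weighted_shift) = (1 - q) *\<^sub>R id_blinfun"
proof (rule blinfun_eqI, rule ell2_eqI)
  show "coord (((adj_op weighted_shift o\<^sub>L weighted_shift) - q *\<^sub>R (weighted_shift o\<^sub>L adj_op weighted_shift)) x) k = coord (((1 - q) *\<^sub>R id_blinfun) x) k" for x k
    by (cases k) (simp_all add: minus_blinfun.rep_eq coord_diff coord_scaleR_op coord_adj_weighted_shift coord_weighted_shift shift_weight_sq_complex algebra_simps)
qed

lemma damping_damping: "damping o\<^sub>L damping = id_blinfun - (weighted_shift o\<^sub>L adj_op weighted_shift)"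
proof (rule blinfun_eqI, rule ell2_eqI)
  have **: "complex_of_real (sqrt q ^ k) * (complex_of_real (sqrt q ^ k) * c) = complex_of_real (q ^ k) * c" for k c
    by (simp only: sqrt_pow_sq[symmetric] of_real_mult mult.assoc)
  show "coord ((damping o\<^sub>L damping) x) k = coord ((id_blinfun - (weighted_shift o\<^sub>L adj_op weighted_shift)) x) k" for x k
    unfolding blinfun_apply_blinfun_compose coord_damping **
    by (cases k) (simp_all add: minus_blinfun.rep_eq coord_diff coord_adj_weighted_shift coord_weighted_shift shift_weight_sq_complex algebra_simps)
qed

text \<open>The canonical solution of the relations on \<open>\<ell>\<^sup>2(\<nat>\<^sup>n)\<close>.\<close>
primrec model :: "nat \<Rightarrow> nat \<Rightarrow> nat list op" where
  "model 0 i = 0"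
| "model (Suc n) i = (if i = Suc n then tensor_op (proj_op (words n)) weighted_shift else tensor_op (model n i) damping)"

lemma model_lin: "clinear_op (model n i)"
  by (induction n) (auto simp: weighted_shift_lin damping_lin)

lemma adj_weighted_shift_lin: "clinear_op (adj_op weighted_shift)" using weighted_shift_lin by auto

lemma coord_adj_model: "i \<in> {1..n} \<Longrightarrow> coord (adj_op (model n i) x) a = complex_of_real (wt q n i a) * coord x (bump n i a)"
proof (induction n arbitrary: a x)
  case (Suc n)
  show ?case
  proof (cases a)
    case Nil
    then show ?thesis
      by (auto simp: adj_tensor weighted_shift_lin damping_lin model_lin coord_tensor_op_Nil)
  next
    case (Cons k b)
    show ?thesis
    proof (cases "i = Suc n")
      case True
      then show ?thesis
        by (simp add: Cons adj_tensor weighted_shift_lin adj_weighted_shift_lin coord_tensor_op proj_op.rep_eq coord_simps coord_slice_lft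
            coord_amp_rgt coord_adj_weighted_shift coord_slice_rgt shift_weight_def)
    next
      case False
      then have "i \<in> {1..n}" using Suc.prems by auto
      then show ?thesis
        using False
        by (simp add: Cons adj_tensor damping_lin model_lin damping_adj coord_tensor_op Suc.IH coord_slice_lft
            coord_amp_rgt coord_damping coord_slice_rgt mult_ac)
    qed
  qed
qed simp

lemma proj_L_Suc: "proj_op (words (Suc n)) = tensor_op (proj_op (words n)) id_blinfun"
  unfolding tensor_proj by (rule arg_cong[where f=proj_op]) (auto simp: length_Suc_conv)

lemma model_proj: "i \<in> {1..n} \<Longrightarrow> proj_op (words n) o\<^sub>L model n i = model n i" "i \<in> {1..n} \<Longrightarrow> model n i o\<^sub>L proj_op (words n) = model n i"
proof -
  have "i \<in> {1..n} \<Longrightarrow> proj_op (words n) o\<^sub>L model n i = model n i \<and> model n i o\<^sub>L proj_op (words n) = model n i"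
  proof (induction n)
    case (Suc n)
    then show ?case
      unfolding proj_L_Suc by (cases "i = Suc n") (auto simp: tensor_compose weighted_shift_lin damping_lin model_lin)
  qed simp
  then show "i \<in> {1..n} \<Longrightarrow> proj_op (words n) o\<^sub>L model n i = model n i" "i \<in> {1..n} \<Longrightarrow> model n i o\<^sub>L proj_op (words n) = model n i"
    by blast+
qed

text \<open>
  In the induction step the relation of the smaller ball is tensored with the square of \<open>damping\<close>, which is
  \<open>1 - W W\<^sup>*\<close>; this produces the summand for the new generator.
\<close>
lemma ball_rep_model: "ball_rep q n (proj_op (words n)) (model n)"
proof (induction n)
  case 0 then show ?case by (simp add: ball_rep_def is_projection_proj)
next
  case (Suc n)
  let ?p = "proj_op (words n)"
  have IH: "i \<in> {1..n} \<Longrightarrow> j \<in> {1..n} \<Longrightarrow> i < j \<Longrightarrow> model n i o\<^sub>L model n j = sqrt q *\<^sub>R (model n j o\<^sub>L model n i)"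
    "i \<in> {1..n} \<Longrightarrow> j \<in> {1..n} \<Longrightarrow> i < j \<Longrightarrow>
      model n i o\<^sub>L adj_op (model n j) = inverse (sqrt q) *\<^sub>R (adj_op (model n j) o\<^sub>L model n i)"
    "i \<in> {1..n} \<Longrightarrow> (adj_op (model n i) o\<^sub>L model n i) - q *\<^sub>R (model n i o\<^sub>L adj_op (model n i)) =
        (1 - q) *\<^sub>R (?p - (\<Sum>j\<in>{i+1..n}. model n j o\<^sub>L adj_op (model n j)))" for i j
    using Suc unfolding ball_rep_def by blast+
  have adj_proj_model: "i \<in> {1..n} \<Longrightarrow> ?p o\<^sub>L adj_op (model n i) = adj_op (model n i)" for i
    using arg_cong[OF model_proj(2)[of i n], of adj_op] model_lin by simp
  note lin = weighted_shift_lin damping_lin model_lin adj_weighted_shift_lin clinear_proj clinear_id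
  note ten = tensor_compose[OF _ _ _ _] adj_tensor
  show ?case
    unfolding ball_rep_def
  proof (intro conjI ballI impI is_projection_proj model_lin model_proj)
    fix i j assume i: "i \<in> {1..Suc n}" and j: "j \<in> {1..Suc n}" and ij: "i < j"
    then have i': "i \<in> {1..n}" "i \<noteq> Suc n" by auto
    show "model (Suc n) i o\<^sub>L model (Suc n) j = sqrt q *\<^sub>R (model (Suc n) j o\<^sub>L model (Suc n) i)"
    proof (cases "j = Suc n")
      case True
      then show ?thesis using i'
        by (simp add: ten lin model_proj damping_weighted_shift tensor_scaleR_right)
    next
      case False
      then have j': "j \<in> {1..n}" "j \<noteq> Suc n" using j by auto
      show ?thesis using i'(2) j'(2)
        by (simp add: ten lin IH(1)[OF i'(1) j'(1) ij] tensor_scaleR_left)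
    qed
    show "model (Suc n) i o\<^sub>L adj_op (model (Suc n) j) = inverse (sqrt q) *\<^sub>R (adj_op (model (Suc n) j) o\<^sub>L model (Suc n) i)"
    proof (cases "j = Suc n")
      case True
      then show ?thesis using i'
        by (simp add: ten lin model_proj damping_adj_weighted_shift tensor_scaleR_right)
    next
      case False
      then have j': "j \<in> {1..n}" "j \<noteq> Suc n" using j by auto
      show ?thesis using i'(2) j'(2)
        by (simp add: ten lin damping_adj IH(2)[OF i'(1) j'(1) ij] tensor_scaleR_left)
    qed
  next
    fix i assume i: "i \<in> {1..Suc n}"
    show "(adj_op (model (Suc n) i) o\<^sub>L model (Suc n) i) - q *\<^sub>R (model (Suc n) i o\<^sub>L adj_op (model (Suc n) i)) =
        (1 - q) *\<^sub>R (proj_op (words (Suc n)) - (\<Sum>j\<in>{i+1..Suc n}. model (Suc n) j o\<^sub>L adj_op (model (Suc n) j)))"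
    proof (cases "i = Suc n")
      case True
      have "(adj_op (model (Suc n) i) o\<^sub>L model (Suc n) i) - q *\<^sub>R (model (Suc n) i o\<^sub>L adj_op (model (Suc n) i)) =
          tensor_op ?p ((adj_op weighted_shift o\<^sub>L weighted_shift) - q *\<^sub>R (weighted_shift o\<^sub>L adj_op weighted_shift))"
        by (simp add: True ten lin tensor_diff_right tensor_scaleR_right)
      then show ?thesis by (simp add: weighted_shift_relation True proj_L_Suc tensor_scaleR_right lin)
    next
      case False
      then have i': "i \<in> {1..n}" using i by auto
      let ?s = "\<Sum>j\<in>{i+1..n}. model n j o\<^sub>L adj_op (model n j)"
      have s_lin: "clinear_op ?s" by (intro clinear_sum) (auto simp: lin)
      have "(adj_op (model (Suc n) i) o\<^sub>L model (Suc n) i) - q *\<^sub>R (model (Suc n) i o\<^sub>L adj_op (model (Suc n) i)) =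
          tensor_op ((adj_op (model n i) o\<^sub>L model n i) - q *\<^sub>R (model n i o\<^sub>L adj_op (model n i))) (damping o\<^sub>L damping)"
        using False by (simp add: ten lin damping_adj tensor_diff_left tensor_scaleR_left)
      also have "\<dots> = (1 - q) *\<^sub>R (tensor_op ?p (damping o\<^sub>L damping) - tensor_op ?s (damping o\<^sub>L damping))"
        unfolding IH(3)[OF i'] tensor_scaleR_left[OF clinear_minus[OF clinear_proj s_lin] clinear_compose[OF damping_lin damping_lin]]
          tensor_diff_left[OF clinear_proj s_lin clinear_compose[OF damping_lin damping_lin]] ..
      also have "tensor_op ?s (damping o\<^sub>L damping) = (\<Sum>j\<in>{i+1..n}. model (Suc n) j o\<^sub>L adj_op (model (Suc n) j))"
      proof -
        have "tensor_op ?s (damping o\<^sub>L damping) = (\<Sum>j\<in>{i+1..n}. tensor_op (model n j o\<^sub>L adj_op (model n j)) (damping o\<^sub>L damping))"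
          by (rule tensor_sum_left) (auto simp: lin)
        also have "\<dots> = (\<Sum>j\<in>{i+1..n}. model (Suc n) j o\<^sub>L adj_op (model (Suc n) j))"
          by (rule sum.cong) (auto simp: ten lin damping_adj)
        finally show ?thesis .
      qed
      also have "tensor_op ?p (damping o\<^sub>L damping) = proj_op (words (Suc n)) - (model (Suc n) (Suc n) o\<^sub>L adj_op (model (Suc n) (Suc n)))"
        by (simp add: damping_damping tensor_diff_right lin proj_L_Suc ten)
      also have "proj_op (words (Suc n)) - (model (Suc n) (Suc n) o\<^sub>L adj_op (model (Suc n) (Suc n))) -
          (\<Sum>j\<in>{i+1..n}. model (Suc n) j o\<^sub>L adj_op (model (Suc n) j)) =
          proj_op (words (Suc n)) - (\<Sum>j\<in>{i+1..Suc n}. model (Suc n) j o\<^sub>L adj_op (model (Suc n) j))"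
      proof -
        have "{i+1..Suc n} = insert (Suc n) {i+1..n}" using i' by auto
        then show ?thesis by (simp del: model.simps add: algebra_simps)
      qed
      finally show ?thesis .
    qed
  qed
qed

end

lemma ball_rep_amp:
  assumes inj: "inj \<phi>" and rep: "ball_rep q n E z"
  shows "ball_rep q n (amp \<phi> E) (\<lambda>i. amp \<phi> (z i))"
proof -
  have lin: "clinear_op E" "i \<in> {1..n} \<Longrightarrow> clinear_op (z i)" for i
    using rep unfolding ball_rep_def is_projection_def by blast+
  show ?thesis
    unfolding ball_rep_def is_projection_def
  proof (intro conjI ballI impI)
    have E: "E o\<^sub>L E = E" "adj_op E = E" using rep unfolding ball_rep_def is_projection_def by blast+
    show "clinear_op (amp \<phi> E)" "amp \<phi> E o\<^sub>L amp \<phi> E = amp \<phi> E" "adj_op (amp \<phi> E) = amp \<phi> E"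
      by (simp_all add: clinear_amp[OF inj] lin amp_compose[OF inj, symmetric] adj_amp[OF inj] E)
  next
    fix i assume i: "i \<in> {1..n}"
    have Ez: "E o\<^sub>L z i = z i" "z i o\<^sub>L E = z i" using rep i unfolding ball_rep_def by blast+
    show "clinear_op (amp \<phi> (z i))" "amp \<phi> E o\<^sub>L amp \<phi> (z i) = amp \<phi> (z i)" "amp \<phi> (z i) o\<^sub>L amp \<phi> E = amp \<phi> (z i)"
      by (simp_all add: clinear_amp[OF inj] lin(2)[OF i] amp_compose[OF inj, symmetric] Ez)
    have r: "(adj_op (z i) o\<^sub>L z i) - q *\<^sub>R (z i o\<^sub>L adj_op (z i)) =
        (1 - q) *\<^sub>R (E - (\<Sum>j\<in>{i+1..n}. z j o\<^sub>L adj_op (z j)))"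
      using rep i unfolding ball_rep_def by blast
    have "(\<Sum>j\<in>{i+1..n}. amp \<phi> (z j) o\<^sub>L adj_op (amp \<phi> (z j))) = amp \<phi> (\<Sum>j\<in>{i+1..n}. z j o\<^sub>L adj_op (z j))"
      unfolding amp_sum[OF inj]
      by (rule sum.cong) (use i in \<open>auto simp: adj_amp[OF inj] lin(2) amp_compose[OF inj]\<close>)
    then show "(adj_op (amp \<phi> (z i)) o\<^sub>L amp \<phi> (z i)) - q *\<^sub>R (amp \<phi> (z i) o\<^sub>L adj_op (amp \<phi> (z i))) =
        (1 - q) *\<^sub>R (amp \<phi> E - (\<Sum>j\<in>{i+1..n}. amp \<phi> (z j) o\<^sub>L adj_op (amp \<phi> (z j))))"
      by (simp add: adj_amp[OF inj] lin(2)[OF i] amp_compose[OF inj, symmetric] amp_scaleR[OF inj, symmetric]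
          amp_diff[OF inj, symmetric] r)
    fix j assume j: "j \<in> {1..n}" and ij: "i < j"
    have "z i o\<^sub>L z j = sqrt q *\<^sub>R (z j o\<^sub>L z i)"
        "z i o\<^sub>L adj_op (z j) = inverse (sqrt q) *\<^sub>R (adj_op (z j) o\<^sub>L z i)"
      using rep i j ij unfolding ball_rep_def by blast+
    then show "amp \<phi> (z i) o\<^sub>L amp \<phi> (z j) = sqrt q *\<^sub>R (amp \<phi> (z j) o\<^sub>L amp \<phi> (z i))"
      "amp \<phi> (z i) o\<^sub>L adj_op (amp \<phi> (z j)) = inverse (sqrt q) *\<^sub>R (adj_op (amp \<phi> (z j)) o\<^sub>L amp \<phi> (z i))"
      by (simp_all add: adj_amp[OF inj] lin(2)[OF j] amp_compose[OF inj, symmetric] amp_scaleR[OF inj, symmetric])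
  qed
qed

section \<open>The model dominates every representation\<close>

lemma ball_rep_norm:
  assumes rep: "ball_rep q n E z" and i: "i \<in> {1..n}"
  shows "(norm (z i x))\<^sup>2 = q * (norm (adj_op (z i) x))\<^sup>2 +
    (1 - q) * ((norm (E x))\<^sup>2 - (\<Sum>j\<in>{i+1..n}. (norm (adj_op (z j) x))\<^sup>2))"
proof -
  have lin: "clinear_op (z j)" if "j \<in> {1..n}" for j using rep that unfolding ball_rep_def by blast
  have E: "is_projection E" using rep unfolding ball_rep_def by blast
  have sq: "inner x (z j (adj_op (z j) x)) = (norm (adj_op (z j) x))\<^sup>2" if "j \<in> {1..n}" for j
    using inner_adj[OF lin[OF that], of x "adj_op (z j) x"] by (simp add: power2_norm_eq_inner)
  have "(norm (z i x))\<^sup>2 - q * (norm (adj_op (z i) x))\<^sup>2 =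
      inner x (((adj_op (z i) o\<^sub>L z i) - q *\<^sub>R (z i o\<^sub>L adj_op (z i))) x)"
    using sq[OF i] inner_adj_right[OF lin[OF i], of x "z i x"]
    by (simp add: minus_blinfun.rep_eq scaleR_blinfun.rep_eq inner_diff_right power2_norm_eq_inner)
  also have "(adj_op (z i) o\<^sub>L z i) - q *\<^sub>R (z i o\<^sub>L adj_op (z i)) =
      (1 - q) *\<^sub>R (E - (\<Sum>j\<in>{i+1..n}. z j o\<^sub>L adj_op (z j)))"
    using rep i unfolding ball_rep_def by blast
  also have "inner x (((1 - q) *\<^sub>R (E - (\<Sum>j\<in>{i+1..n}. z j o\<^sub>L adj_op (z j)))) x) =
      (1 - q) * (inner x (E x) - (\<Sum>j\<in>{i+1..n}. inner x (z j (adj_op (z j) x))))"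
    by (simp add: minus_blinfun.rep_eq scaleR_blinfun.rep_eq blinfun.sum_left inner_diff_right inner_sum_right)
  also have "(\<Sum>j\<in>{i+1..n}. inner x (z j (adj_op (z j) x))) = (\<Sum>j\<in>{i+1..n}. (norm (adj_op (z j) x))\<^sup>2)"
    by (rule sum.cong[OF refl], rule sq) (use i in auto)
  finally show ?thesis by (simp add: projection_norm(1)[OF E])
qed

text \<open>
  Expand \<open>\<parallel>(Y\<^sub>i J - J z\<^sub>i) x\<parallel>\<^sup>2\<close>. The cross term contains \<open>Y\<^sub>i\<^sup>* J\<close>, which is close to \<open>J z\<^sub>i\<^sup>*\<close>. The term \<open>\<parallel>Y\<^sub>i J x\<parallel>\<^sup>2\<close>
  is, by the relations, a combination of \<open>\<parallel>J x\<parallel>\<^sup>2\<close> and the \<open>\<parallel>Y\<^sub>j\<^sup>* J x\<parallel>\<^sup>2\<close>, and these are close to \<open>\<parallel>z\<^sub>j\<^sup>* x\<parallel>\<^sup>2\<close>.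
\<close>
lemma hereditary_intertwining:
  fixes J :: "'i ell2 \<Rightarrow>\<^sub>L 'l ell2"
  assumes q: "0 < q" "q < 1" and z: "ball_rep q n E z" and Y: "ball_rep q n F Y"
    and iso: "\<And>x. norm (J x) = norm (E x)" and FJ: "\<And>x. F (J x) = J x"
    and K: "\<And>i. i \<in> {1..n} \<Longrightarrow> norm (z i) \<le> K" "\<And>i. i \<in> {1..n} \<Longrightarrow> norm (Y i) \<le> K"
    and d: "\<And>i. i \<in> {1..n} \<Longrightarrow> norm ((adj_op (Y i) o\<^sub>L J) - (J o\<^sub>L adj_op (z i))) \<le> d"
    and i: "i \<in> {1..n}"
  shows "(norm ((Y i o\<^sub>L J) - (J o\<^sub>L z i)))\<^sup>2 \<le> 2 * (real n + 2) * K * d"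
proof -
  have zlin: "clinear_op (z j)" and Ylin: "clinear_op (Y j)" and Ez: "E (adj_op (z j) x) = adj_op (z j) x" "E (z j x) = z j x"
    if j: "j \<in> {1..n}" for j x
  proof -
    show zl: "clinear_op (z j)" and "clinear_op (Y j)" using z Y j unfolding ball_rep_def by blast+
    have E: "clinear_op E" "adj_op E = E" "E o\<^sub>L z j = z j" "z j o\<^sub>L E = z j"
      using z j unfolding ball_rep_def is_projection_def by blast+
    have "E o\<^sub>L adj_op (z j) = adj_op (z j)" using adj_compose[OF zl E(1)] E by simp
    then show "E (adj_op (z j) x) = adj_op (z j) x" "E (z j x) = z j x"
      using E(3) by (metis blinfun_apply_blinfun_compose)+
  qed
  have E: "is_projection E" using z unfolding ball_rep_def by blast
  have K0: "K \<ge> 0" using K(1)[OF i] norm_ge_zero[of "z i"] by linarith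
  have d0: "d \<ge> 0" using d[OF i] norm_ge_zero[of "(adj_op (Y i) o\<^sub>L J) - (J o\<^sub>L adj_op (z i))"] by linarith
  have J_le: "norm (J x) \<le> norm x" for x unfolding iso by (rule projection_norm(2)[OF E])
  have err: "norm (adj_op (Y j) (J x) - J (adj_op (z j) x)) \<le> d * norm x" if j: "j \<in> {1..n}" for j x
  proof -
    have "norm (adj_op (Y j) (J x) - J (adj_op (z j) x)) = norm (((adj_op (Y j) o\<^sub>L J) - (J o\<^sub>L adj_op (z j))) x)"
      by (simp add: minus_blinfun.rep_eq)
    also have "\<dots> \<le> norm ((adj_op (Y j) o\<^sub>L J) - (J o\<^sub>L adj_op (z j))) * norm x" by (rule norm_blinfun)
    also have "\<dots> \<le> d * norm x" by (intro mult_right_mono d j) simp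
    finally show ?thesis .
  qed
  have z_le: "norm (z j x) \<le> K * norm x" "norm (adj_op (z j) x) \<le> K * norm x"
    "norm (adj_op (Y j) x') \<le> K * norm x'" if j: "j \<in> {1..n}" for j x x'
    using order.trans[OF norm_blinfun mult_right_mono[OF K(1)[OF j] norm_ge_zero], of x]
      order.trans[OF norm_blinfun[of "adj_op (z j)" x] mult_right_mono[of _ K "norm x"]]
      order.trans[OF norm_blinfun[of "adj_op (Y j)" x'] mult_right_mono[of _ K "norm x'"]]
      K[OF j] zlin[OF j] Ylin[OF j] by simp_all
  have sqs: "\<bar>(norm (adj_op (Y j) (J x)))\<^sup>2 - (norm (adj_op (z j) x))\<^sup>2\<bar> \<le> 2 * K * d * (norm x)\<^sup>2"
    if j: "j \<in> {1..n}" for j x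
  proof -
    let ?a = "norm (adj_op (Y j) (J x))" and ?b = "norm (adj_op (z j) x)"
    have b: "?b = norm (J (adj_op (z j) x))" by (simp add: iso Ez[OF j])
    have "\<bar>?a - ?b\<bar> \<le> d * norm x"
      unfolding b by (rule order.trans[OF norm_triangle_ineq3 err[OF j]])
    moreover have "?a \<le> K * norm x"
      using z_le(3)[OF j, of "J x"] mult_left_mono[OF J_le K0, of x] by linarith
    then have "?a + ?b \<le> 2 * K * norm x" using z_le(2)[OF j, of x] by linarith
    ultimately have "\<bar>?a - ?b\<bar> * (?a + ?b) \<le> (d * norm x) * (2 * K * norm x)"
      using d0 by (intro mult_mono) auto
    moreover have "?a\<^sup>2 - ?b\<^sup>2 = (?a - ?b) * (?a + ?b)" by (simp add: power2_eq_square algebra_simps)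
    ultimately show ?thesis by (simp add: abs_mult power2_eq_square mult_ac)
  qed
  have JJ: "inner (J x) (J y) = inner (E x) (E y)" for x y
    by (simp only: dot_norm blinfun.add_right[symmetric] iso)
  have main: "(norm (((Y i o\<^sub>L J) - (J o\<^sub>L z i)) x))\<^sup>2 \<le> 2 * (real n + 2) * K * d * (norm x)\<^sup>2" for x
  proof -
    let ?b = "2 * K * d * (norm x)\<^sup>2"
    have b0: "?b \<ge> 0" using K0 d0 by simp
    have cross: "(norm (z i x))\<^sup>2 - K * d * (norm x)\<^sup>2 \<le> inner (Y i (J x)) (J (z i x))"
    proof -
      have "inner (Y i (J x)) (J (z i x)) = inner (J x) (adj_op (Y i) (J (z i x)))"
        by (simp add: inner_adj_right[OF Ylin[OF i]])
      also have "\<dots> = inner (J x) (J (adj_op (z i) (z i x))) + inner (J x) (adj_op (Y i) (J (z i x)) - J (adj_op (z i) (z i x)))"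
        by (simp add: inner_diff_right)
      also have "inner (J x) (J (adj_op (z i) (z i x))) = (norm (z i x))\<^sup>2"
      proof -
        have "inner (E x) (E (adj_op (z i) (z i x))) = inner x (adj_op (z i) (z i x))"
          using E inner_adj[of E x "adj_op (z i) (z i x)"] by (simp add: Ez[OF i] is_projection_def)
        then show ?thesis by (simp add: JJ inner_adj_right[OF zlin[OF i]] power2_norm_eq_inner)
      qed
      finally have eq: "inner (Y i (J x)) (J (z i x)) = (norm (z i x))\<^sup>2 +
          inner (J x) (adj_op (Y i) (J (z i x)) - J (adj_op (z i) (z i x)))" .
      have "\<bar>inner (J x) (adj_op (Y i) (J (z i x)) - J (adj_op (z i) (z i x)))\<bar> \<le>
          norm (J x) * norm (adj_op (Y i) (J (z i x)) - J (adj_op (z i) (z i x)))"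
        by (rule Cauchy_Schwarz_ineq2)
      also have "\<dots> \<le> norm x * (d * (K * norm x))"
        by (intro mult_mono J_le order.trans[OF err[OF i] mult_left_mono[OF z_le(1)[OF i] d0]]) simp_all
      finally show ?thesis unfolding eq by (simp add: power2_eq_square mult_ac)
    qed
    have sum_le: "(norm (Y i (J x)))\<^sup>2 - (norm (z i x))\<^sup>2 \<le> (real n + 1) * ?b"
    proof -
      let ?u = "\<lambda>j. (norm (adj_op (Y j) (J x)))\<^sup>2" and ?v = "\<lambda>j. (norm (adj_op (z j) x))\<^sup>2"
      have "(norm (Y i (J x)))\<^sup>2 - (norm (z i x))\<^sup>2 = q * (?u i - ?v i) + (1 - q) * (\<Sum>j\<in>{i+1..n}. ?v j - ?u j)"
        unfolding ball_rep_norm[OF Y i] ball_rep_norm[OF z i] FJ iso sum_subtractf by (simp add: algebra_simps)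
      also have "\<dots> \<le> 1 * ?b + 1 * (real n * ?b)"
      proof (rule add_mono)
        have "q * (?u i - ?v i) \<le> q * ?b" using sqs[OF i, of x] q by (intro mult_left_mono) auto
        also have "\<dots> \<le> 1 * ?b" using b0 q by (intro mult_right_mono) auto
        finally show "q * (?u i - ?v i) \<le> 1 * ?b" .
        have "(\<Sum>j\<in>{i+1..n}. ?v j - ?u j) \<le> of_nat (card {i+1..n}) * ?b"
        proof (rule sum_bounded_above)
          fix j assume "j \<in> {i+1..n}"
          then have "j \<in> {1..n}" by auto
          from sqs[OF this, of x] show "?v j - ?u j \<le> ?b" by linarith
        qed
        also have "\<dots> \<le> real n * ?b" using b0 by (intro mult_right_mono) auto
        finally have le: "(\<Sum>j\<in>{i+1..n}. ?v j - ?u j) \<le> real n * ?b" .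
        have "(1 - q) * (\<Sum>j\<in>{i+1..n}. ?v j - ?u j) \<le> (1 - q) * (real n * ?b)"
          using q by (intro mult_left_mono le) simp
        also have "\<dots> \<le> 1 * (real n * ?b)"
          using q by (intro mult_right_mono[OF _ mult_nonneg_nonneg[OF of_nat_0_le_iff b0]]) simp
        finally show "(1 - q) * (\<Sum>j\<in>{i+1..n}. ?v j - ?u j) \<le> 1 * (real n * ?b)" .
      qed
      finally show ?thesis by (simp add: algebra_simps)
    qed
    have Jz: "norm (J (z i x)) = norm (z i x)" by (simp add: iso Ez[OF i])
    have "(norm (u - v))\<^sup>2 = (norm u)\<^sup>2 - 2 * inner u v + (norm v)\<^sup>2" for u v :: "'l ell2"
      by (simp add: power2_norm_eq_inner inner_diff_left inner_diff_right inner_commute)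
    from this[of "Y i (J x)" "J (z i x)"] have "(norm (((Y i o\<^sub>L J) - (J o\<^sub>L z i)) x))\<^sup>2 =
        (norm (Y i (J x)))\<^sup>2 - 2 * inner (Y i (J x)) (J (z i x)) + (norm (z i x))\<^sup>2"
      by (simp add: minus_blinfun.rep_eq Jz)
    also have "\<dots> \<le> (real n + 1) * ?b + ?b" using cross sum_le by (simp add: algebra_simps)
    finally show ?thesis by (simp add: algebra_simps)
  qed
  let ?C = "2 * (real n + 2) * K * d"
  have C: "?C \<ge> 0" using K0 d0 by simp
  have "norm ((Y i o\<^sub>L J) - (J o\<^sub>L z i)) \<le> sqrt ?C"
  proof (rule norm_blinfun_bound)
    fix x
    show "norm (((Y i o\<^sub>L J) - (J o\<^sub>L z i)) x) \<le> sqrt ?C * norm x"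
      by (rule power2_le_imp_le) (use main[of x] C in \<open>simp_all add: power_mult_distrib\<close>)
  qed (use C in simp)
  then have "(norm ((Y i o\<^sub>L J) - (J o\<^sub>L z i)))\<^sup>2 \<le> (sqrt ?C)\<^sup>2" by (intro power_mono) auto
  then show ?thesis using C by simp
qed

lemma restrict_UNIV: "restrict_ell2 UNIV x = x"
  by (rule ell2_eqI) (simp add: coord_simps)

text \<open>The components of a Poisson family, assembled into one operator.\<close>
lemma poisson_operator:
  fixes E :: "'i op"
  assumes q: "0 < q" "q < 1" and e: "e > 0" and rep: "ball_rep q n E z"
  obtains J :: "'i ell2 \<Rightarrow>\<^sub>L (nat list \<times> 'i) ell2" where
    "\<And>x. norm (J x) = norm (E x)" "\<And>c x. J (cscale_ell2 c x) = cscale_ell2 c (J x)"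
    "\<And>x. amp id (proj_op (words n)) (J x) = J x"
    "\<And>i. i \<in> {1..n} \<Longrightarrow> norm ((amp id (adj_op (model q n i)) o\<^sub>L J) - (J o\<^sub>L adj_op (z i))) \<le> e"
proof -
  obtain A where A: "poisson q n E z (e\<^sup>2) A" using poisson_exists[OF q _ rep, of "e\<^sup>2"] e by auto
  have E: "is_projection E" using rep unfolding ball_rep_def by blast
  define \<phi> :: "'i \<times> nat list \<Rightarrow> nat list \<times> 'i" where "\<phi> = (\<lambda>(j, a). (a, j))"
  have inj: "inj \<phi>" and surj: "range \<phi> = UNIV" by (auto simp: \<phi>_def inj_def image_def)
  have inj_id: "inj (id :: nat list \<times> 'i \<Rightarrow> nat list \<times> 'i)" by simp
  have As: "((\<lambda>a. (norm (A a x))\<^sup>2) has_sum (norm (E x))\<^sup>2) UNIV" for x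
    using A unfolding poisson_def by blast
  have A_lin: "clinear_op (A a)" and A_len: "length a \<noteq> n \<Longrightarrow> A a = 0" for a
    using A unfolding poisson_def by blast+
  note sm = has_sum_imp_summable[OF As]
  define J0 where "J0 x = join_blocks \<phi> (\<lambda>a. A a x)" for x
  have sl: "slice \<phi> a (J0 x) = A a x" for a x unfolding J0_def by (rule slice_join[OF inj sm])
  have eqI: "x = y" if "\<And>a. slice \<phi> a x = slice \<phi> a y" for x y
    by (rule ell2_eq_blocks[OF inj that]) (simp add: surj)
  have iso0: "norm (J0 x) = norm (E x)" for x
  proof -
    have "(norm (J0 x))\<^sup>2 = (norm (E x))\<^sup>2"
      unfolding J0_def norm_join[OF inj sm] using As by (rule infsumI)
    then show ?thesis by (simp add: power2_eq_iff_nonneg)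
  qed
  have "bounded_linear J0"
    by (rule bounded_linear_intro[where K=1])
      (auto intro!: eqI simp: slice_add[OF inj] slice_scaleR[OF inj] sl blinfun.bilinear_simps iso0 projection_norm(2)[OF E])
  then have app: "Blinfun J0 x = J0 x" for x by (simp add: bounded_linear_Blinfun_apply)
  define J where "J = Blinfun J0"
  note app = app[folded J_def]
  have slice_amp_id: "slice \<phi> a (amp id X (J0 x)) = u" if "\<And>j. coord (X (slice id j (J0 x))) a = coord u j"
    for a x u and X :: "nat list op"
  proof (rule ell2_eqI)
    fix j
    have "coord (slice \<phi> a (amp id X (J0 x))) j = coord (amp id X (J0 x)) (id (a, j))"
      using coord_slice[OF inj, of a _ j] by (simp only: id_apply) (simp add: \<phi>_def)
    then show "coord (slice \<phi> a (amp id X (J0 x))) j = coord u j"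
      by (simp only: coord_amp[OF inj_id] that)
  qed
  have coord_sl: "coord (slice id j (J0 x)) a = coord (A a x) j" for j x a
    using sl[of a x] coord_slice[OF inj, of a "J0 x" j] by (simp add: coord_slice[OF inj_id] \<phi>_def)
  show ?thesis
  proof (rule that[of J])
    show "norm (J x) = norm (E x)" for x unfolding app by (rule iso0)
    show "J (cscale_ell2 c x) = cscale_ell2 c (J x)" for c x
      unfolding app by (rule eqI) (simp add: slice_cscale[OF inj] sl clinear_opD[OF A_lin])
    show "amp id (proj_op (words n)) (J x) = J x" for x
      unfolding app by (rule eqI, unfold sl, rule slice_amp_id)
        (auto simp: proj_op.rep_eq coord_simps coord_sl A_len)
    fix i assume i: "i \<in> {1..n}"
    show "norm ((amp id (adj_op (model q n i)) o\<^sub>L J) - (J o\<^sub>L adj_op (z i))) \<le> e"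
    proof (rule norm_blinfun_bound)
      fix x
      let ?v = "amp id (adj_op (model q n i)) (J0 x) - J0 (adj_op (z i) x)"
      have "slice \<phi> a (amp id (adj_op (model q n i)) (J0 x)) = wt q n i a *\<^sub>R A (bump n i a) x" for a
        by (rule slice_amp_id) (simp add: coord_adj_model[OF q i] coord_sl coord_scaleR)
      then have sv: "slice \<phi> a ?v = - (A a (adj_op (z i) x) - wt q n i a *\<^sub>R A (bump n i a) x)" for a
        by (simp add: slice_diff[OF inj] sl)
      have "\<exists>s\<le>e\<^sup>2 * (norm x)\<^sup>2.
          ((\<lambda>a. (norm (A a (adj_op (z i) x) - wt q n i a *\<^sub>R A (bump n i a) x))\<^sup>2) has_sum s) UNIV"
        using A i unfolding poisson_def by blast
      then obtain s where s: "s \<le> e\<^sup>2 * (norm x)\<^sup>2"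
        "((\<lambda>a. (norm (A a (adj_op (z i) x) - wt q n i a *\<^sub>R A (bump n i a) x))\<^sup>2) has_sum s) UNIV" by blast
      have "((\<lambda>a. (norm (slice \<phi> a ?v))\<^sup>2) has_sum (norm ?v)\<^sup>2) UNIV"
        using slice_norm_has_sum[OF inj, of ?v] unfolding surj restrict_UNIV .
      then have "(norm ?v)\<^sup>2 = s"
        unfolding sv norm_minus_cancel using s(2) by (rule has_sum_unique)
      then have "(norm ?v)\<^sup>2 \<le> (e * norm x)\<^sup>2" using s(1) by (simp add: power_mult_distrib)
      then have "norm ?v \<le> e * norm x" by (rule power2_le_imp_le) (use e in simp)
      then show "norm (((amp id (adj_op (model q n i)) o\<^sub>L J) - (J o\<^sub>L adj_op (z i))) x) \<le> e * norm x"
        by (simp add: minus_blinfun.rep_eq app)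
    qed (use e in simp)
  qed
qed

text \<open>
  Along a sequence of Poisson operators with errors tending to \<open>0\<close>, the pairs \<open>(X, P)\<close> with
  \<open>X J\<^sub>m - J\<^sub>m P \<rightarrow> 0\<close> are closed under the algebraic operations, so that they include the values of every
  polynomial in the model and in the representation. As \<open>J\<^sub>m\<close> is isometric, the norm of \<open>P\<close> is at most the norm of
  \<open>X\<close>.
\<close>
theorem model_dominates:
  fixes E :: "'i op"
  assumes q: "0 < q" "q < 1" and rep: "ball_rep q n E z" and p: "p \<in> star_polys {1..n}"
  shows "norm (ev E z p) \<le> norm (ev (proj_op (words n)) (model q n) p)"
proof -
  let ?p = "proj_op (words n)"
  define ident :: "nat list \<times> 'i \<Rightarrow> nat list \<times> 'i" where "ident = id"
  have inj: "inj ident" by (simp add: ident_def)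
  have E: "is_projection E" using rep unfolding ball_rep_def by blast
  have z_lin: "clinear_op (z i)" and Ez: "E o\<^sub>L z i = z i" "z i o\<^sub>L E = z i" if "i \<in> {1..n}" for i
    using rep that unfolding ball_rep_def by blast+
  define Jp where "Jp e J \<longleftrightarrow> (\<forall>x. norm (J x) = norm (E x)) \<and> (\<forall>c x. J (cscale_ell2 c x) = cscale_ell2 c (J x)) \<and>
      (\<forall>x. amp ident ?p (J x) = J x) \<and>
      (\<forall>i\<in>{1..n}. norm ((amp ident (adj_op (model q n i)) o\<^sub>L J) - (J o\<^sub>L adj_op (z i))) \<le> e)"
    for e and J :: "'i ell2 \<Rightarrow>\<^sub>L (nat list \<times> 'i) ell2"
  have "\<exists>J. Jp (1 / real (Suc m)) J" for m
  proof -
    have "1 / real (Suc m) > 0" by simp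
    from poisson_operator[OF q this rep, folded ident_def] show ?thesis unfolding Jp_def by metis
  qed
  then obtain J where J: "\<And>m. Jp (1 / real (Suc m)) (J m)" by metis
  have iso: "norm (J m x) = norm (E x)" and J_lin: "J m (cscale_ell2 c x) = cscale_ell2 c (J m x)"
    and pJ: "amp ident ?p (J m x) = J m x" for m c x
    using J[of m] unfolding Jp_def by blast+
  have Jadj: "i \<in> {1..n} \<Longrightarrow> norm ((amp ident (adj_op (model q n i)) o\<^sub>L J m) - (J m o\<^sub>L adj_op (z i))) \<le> 1 / real (Suc m)" for i m
    using J[of m] unfolding Jp_def by blast
  have J_norm: "norm (J m) \<le> 1" for m
    by (rule norm_blinfun_bound) (simp_all add: iso projection_norm(2)[OF E])
  have lim0: "(\<lambda>m. 1 / real (Suc m)) \<longlonglongrightarrow> 0" by (rule LIMSEQ_Suc[OF lim_1_over_n])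
  define good where "good X P \<longleftrightarrow> (\<lambda>m. (X o\<^sub>L J m) - (J m o\<^sub>L P)) \<longlonglongrightarrow> 0" for X P
  have good_adj: "good (amp ident (adj_op (model q n i))) (adj_op (z i))" if i: "i \<in> {1..n}" for i
    unfolding good_def by (rule Lim_null_comparison[OF _ lim0]) (use Jadj[OF i] in simp)
  have good_gen: "good (amp ident (model q n i)) (z i)" if i: "i \<in> {1..n}" for i
  proof -
    let ?Y = "\<lambda>i. amp ident (model q n i)"
    define K where "K = (\<Sum>j\<in>{1..n}. norm (z j) + norm (?Y j))"
    have Kj: "norm (z j) + norm (?Y j) \<le> K" if "j \<in> {1..n}" for j
      unfolding K_def by (rule member_le_sum[OF that]) auto
    have K: "norm (z j) \<le> K" "norm (?Y j) \<le> K" if "j \<in> {1..n}" for j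
      using Kj[OF that] norm_ge_zero[of "z j"] norm_ge_zero[of "?Y j"] by linarith+
    have Yrep: "ball_rep q n (amp ident ?p) ?Y" by (rule ball_rep_amp[OF inj ball_rep_model[OF q]])
    have sq: "(norm ((?Y i o\<^sub>L J m) - (J m o\<^sub>L z i)))\<^sup>2 \<le> 2 * (real n + 2) * K * (1 / real (Suc m))" for m
      by (rule hereditary_intertwining[OF q rep Yrep iso pJ K _ i])
        (use Jadj in \<open>simp_all add: adj_amp[OF inj] model_lin[OF q]\<close>)
    have "(\<lambda>m. (norm ((?Y i o\<^sub>L J m) - (J m o\<^sub>L z i)))\<^sup>2) \<longlonglongrightarrow> 0"
    proof (rule Lim_null_comparison)
      show "(\<lambda>m. 2 * (real n + 2) * K * (1 / real (Suc m))) \<longlonglongrightarrow> 0"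
        by (rule tendsto_mult_right_zero[OF lim0])
      show "\<forall>\<^sub>F m in sequentially. norm ((norm ((?Y i o\<^sub>L J m) - (J m o\<^sub>L z i)))\<^sup>2) \<le> 2 * (real n + 2) * K * (1 / real (Suc m))"
        using sq by simp
    qed
    then have "(\<lambda>m. sqrt ((norm ((?Y i o\<^sub>L J m) - (J m o\<^sub>L z i)))\<^sup>2)) \<longlonglongrightarrow> sqrt 0" by (rule tendsto_real_sqrt)
    then show ?thesis unfolding good_def by (simp add: tendsto_norm_zero_iff)
  qed
  have good_one: "good (amp ident ?p) E"
  proof -
    have JE: "J m (E x) = J m x" for m x
    proof -
      have "norm (J m (E x - x)) = 0"
        unfolding iso by (simp add: blinfun.diff_right projection_norm(3)[OF E])
      then have "J m (E x) - J m x = 0" unfolding norm_eq_zero blinfun.diff_right .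
      then show ?thesis by (rule right_minus_eq[THEN iffD1])
    qed
    have "(amp ident ?p o\<^sub>L J m) - (J m o\<^sub>L E) = 0" for m
      by (rule blinfun_eqI) (simp add: minus_blinfun.rep_eq pJ JE)
    then show ?thesis by (simp add: good_def)
  qed
  have good_plus: "good (X + X') (P + P')" if "good X P" "good X' P'" for X X' P P'
    using tendsto_add[OF that[unfolded good_def]]
    by (simp add: good_def blinfun_compose_add_left blinfun_compose_add_right algebra_simps)
  have good_times: "good (X o\<^sub>L X') (P o\<^sub>L P')" if g: "good X P" "good X' P'" for X X' P P'
  proof -
    have "(\<lambda>m. (X o\<^sub>L ((X' o\<^sub>L J m) - (J m o\<^sub>L P'))) + (((X o\<^sub>L J m) - (J m o\<^sub>L P)) o\<^sub>L P')) \<longlonglongrightarrow> (X o\<^sub>L 0) + (0 o\<^sub>L P')"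
      using g unfolding good_def
      by (intro tendsto_add bounded_bilinear.tendsto[OF bounded_bilinear_blinfun_compose] tendsto_const)
    then show ?thesis
      by (simp add: good_def blinfun_compose_diff_left blinfun_compose_diff_right blinfun_compose_assoc)
  qed
  have good_scale: "good (cscale_op c X) (cscale_op c P)" if g: "good X P" for c X P
  proof -
    have "(\<lambda>m. scalar_op c o\<^sub>L ((X o\<^sub>L J m) - (J m o\<^sub>L P))) \<longlonglongrightarrow> (scalar_op c o\<^sub>L 0)"
      using g unfolding good_def
      by (intro bounded_bilinear.tendsto[OF bounded_bilinear_blinfun_compose] tendsto_const)
    moreover have "scalar_op c o\<^sub>L ((X o\<^sub>L J m) - (J m o\<^sub>L P)) = (cscale_op c X o\<^sub>L J m) - (J m o\<^sub>L cscale_op c P)" for m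
      by (rule blinfun_eqI) (simp add: minus_blinfun.rep_eq scalar_op.rep_eq cscale_op_apply cscale_diff J_lin)
    ultimately show ?thesis by (simp add: good_def)
  qed
  have Elin: "clinear_op E" "adj_op E = E" "E o\<^sub>L E = E" using E by (auto simp: is_projection_def)
  have corner: "clinear_op (ev E z p) \<and> E o\<^sub>L ev E z p = ev E z p" if "p \<in> star_polys {1..n}" for p
  proof -
    have "clinear_op (ev E z p) \<and> E o\<^sub>L ev E z p = ev E z p \<and> ev E z p o\<^sub>L E = ev E z p"
      using that
    proof (induction p)
      case (Gen i) then show ?case by (simp add: z_lin Ez)
    next
      case Unit then show ?case by (simp add: Elin)
    next
      case (Plus p r)
      then show ?case by (simp add: blinfun_compose_add_left blinfun_compose_add_right)
    next
      case (Times p r)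
      then have IH: "clinear_op (ev E z p)" "clinear_op (ev E z r)" "E o\<^sub>L ev E z p = ev E z p" "ev E z r o\<^sub>L E = ev E z r"
        by simp_all
      show ?case
        by (simp add: IH blinfun_compose_assoc) (simp add: IH blinfun_compose_assoc[symmetric])
    next
      case (Scale c p)
      then show ?case by (simp add: compose_cscale_left clinear_compose_cscale_right Elin)
    next
      case (Star p)
      then have IH: "clinear_op (ev E z p)" "E o\<^sub>L ev E z p = ev E z p" "ev E z p o\<^sub>L E = ev E z p" by simp_all
      show ?case
        using adj_compose[OF IH(1) Elin(1)] adj_compose[OF Elin(1) IH(1)] by (simp add: IH Elin)
    qed
    then show ?thesis by blast
  qed
  let ?e = "ev ?p (model q n)"
  have e_lin: "clinear_op (?e p)" if "p \<in> star_polys {1..n}" for p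
    using that by (induction p) (auto simp: model_lin[OF q])
  have good_ev: "good (amp ident (?e p)) (ev E z p) \<and> good (amp ident (adj_op (?e p))) (adj_op (ev E z p))"
    if "p \<in> star_polys {1..n}" for p
    using that
  proof (induction p)
    case (Gen i)
    then have i: "i \<in> {1..n}" by simp
    show ?case unfolding ev.simps by (rule conjI[OF good_gen[OF i] good_adj[OF i]])
  next
    case Unit then show ?case using good_one by (simp add: Elin)
  next
    case (Plus p r)
    then have pr: "p \<in> star_polys {1..n}" "r \<in> star_polys {1..n}" by auto
    then show ?case using Plus e_lin[OF pr(1)] e_lin[OF pr(2)] corner[OF pr(1)] corner[OF pr(2)]
      by (simp add: amp_plus[OF inj] good_plus)
  next
    case (Times p r)
    then have pr: "p \<in> star_polys {1..n}" "r \<in> star_polys {1..n}" by auto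
    then show ?case using Times e_lin[OF pr(1)] e_lin[OF pr(2)] corner[OF pr(1)] corner[OF pr(2)]
      by (simp add: amp_compose[OF inj] good_times)
  next
    case (Scale c p)
    then have pr: "p \<in> star_polys {1..n}" by auto
    then show ?case using Scale e_lin[OF pr] corner[OF pr]
      by (simp add: amp_cscale[OF inj] good_scale)
  next
    case (Star p)
    then have pr: "p \<in> star_polys {1..n}" by auto
    then show ?case using Star e_lin[OF pr] corner[OF pr] by simp
  qed
  let ?X = "amp ident (?e p)" and ?P = "ev E z p"
  show ?thesis
  proof (rule norm_blinfun_bound)
    fix x
    have "norm (?P x) \<le> norm (?e p) * norm x + norm ((?X o\<^sub>L J m) - (J m o\<^sub>L ?P)) * norm x" for m
    proof -
      have "norm (?P x) = norm (J m (?P x))"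
        using corner[OF p] by (metis blinfun_apply_blinfun_compose iso)
      also have "\<dots> = norm (?X (J m x) - ((?X o\<^sub>L J m) - (J m o\<^sub>L ?P)) x)" by (simp add: minus_blinfun.rep_eq)
      also have "\<dots> \<le> norm (?X (J m x)) + norm (((?X o\<^sub>L J m) - (J m o\<^sub>L ?P)) x)" by (rule norm_triangle_ineq4)
      also have "\<dots> \<le> norm (?e p) * norm x + norm ((?X o\<^sub>L J m) - (J m o\<^sub>L ?P)) * norm x"
      proof (rule add_mono[OF _ norm_blinfun])
        have "norm (?X (J m x)) \<le> norm ?X * norm (J m x)" by (rule norm_blinfun)
        also have "\<dots> \<le> norm (?e p) * norm x"
          by (intro mult_mono norm_amp_le[OF inj]) (simp_all add: iso projection_norm(2)[OF E])
        finally show "norm (?X (J m x)) \<le> norm (?e p) * norm x" .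
      qed
      finally show ?thesis .
    qed
    moreover have "(\<lambda>m. norm (?e p) * norm x + norm ((?X o\<^sub>L J m) - (J m o\<^sub>L ?P)) * norm x) \<longlonglongrightarrow> norm (?e p) * norm x + 0 * norm x"
      using good_ev[OF p] unfolding good_def by (intro tendsto_intros tendsto_norm_zero) blast
    ultimately show "norm (?P x) \<le> norm (?e p) * norm x"
      by (intro LIMSEQ_le_const[where a="norm (?P x)"]) auto
  qed simp
qed

section \<open>The model generates the algebra of the ball\<close>

text \<open>The diagonal of the matrix unit \<open>E\<^bsub>mm\<^esub>\<close>.\<close>
abbreviation "mark m \<equiv> (\<lambda>k :: nat. if k = m then 1 else 0 :: real)"

lemma mark_bound: "\<bar>mark m k\<bar> \<le> 1"
  by simp

lemma matrix_unit_diag: "matrix_unit 0 0 = diag_op (mark 0)"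
proof (rule blinfun_eqI, rule ell2_eqI)
  show "coord (matrix_unit 0 0 x) k = coord (diag_op (mark 0) x) k" for x k
    by (simp add: coord_diag[OF mark_bound] matrix_unit.rep_eq coord_simps)
qed

lemma diag_compose:
  assumes "\<And>k. \<bar>f k\<bar> \<le> M" "\<And>k. \<bar>g k\<bar> \<le> N"
  shows "diag_op f o\<^sub>L diag_op g = diag_op (\<lambda>k. f k * g k)"
proof (rule blinfun_eqI, rule ell2_eqI)
  have "\<bar>f k * g k\<bar> \<le> M * N" for k
    unfolding abs_mult using assms[of k] by (intro mult_mono) auto
  note bound = coord_diag[of "\<lambda>k. f k * g k", OF this]
  show "coord ((diag_op f o\<^sub>L diag_op g) x) k = coord (diag_op (\<lambda>k. f k * g k) x) k" for x k
    by (simp add: bound coord_diag[of f, OF assms(1)] coord_diag[of g, OF assms(2)])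
qed

lemma diag_diff:
  assumes "\<And>k. \<bar>f k\<bar> \<le> M" "\<And>k. \<bar>g k\<bar> \<le> N"
  shows "diag_op f - diag_op g = diag_op (\<lambda>k. f k - g k)"
proof (rule blinfun_eqI, rule ell2_eqI)
  have "\<bar>f k - g k\<bar> \<le> M + N" for k
    using assms[of k] by linarith
  note bound = coord_diag[of "\<lambda>k. f k - g k", OF this]
  show "coord ((diag_op f - diag_op g) x) k = coord (diag_op (\<lambda>k. f k - g k) x) k" for x k
    by (simp add: bound coord_diag[of f, OF assms(1)] coord_diag[of g, OF assms(2)] minus_blinfun.rep_eq coord_diff
        algebra_simps)
qed

lemma diag_plus_mark:
  assumes "\<And>k. \<bar>f k\<bar> \<le> M"
  shows "diag_op (\<lambda>k. if k < Suc m then f k else 0) =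
    diag_op (\<lambda>k. if k < m then f k else 0) + f m *\<^sub>R diag_op (mark m)"
proof (rule blinfun_eqI, rule ell2_eqI)
  have M: "M \<ge> 0" using assms[of 0] by linarith
  have b: "coord (diag_op (\<lambda>k. if k < j then f k else 0) x) k = complex_of_real (if k < j then f k else 0) * coord x k"
    for j k x by (rule coord_diag[where M=M]) (use assms M in simp)
  show "coord (diag_op (\<lambda>k. if k < Suc m then f k else 0) x) k =
    coord ((diag_op (\<lambda>k. if k < m then f k else 0) + f m *\<^sub>R diag_op (mark m)) x) k" for x k
    unfolding plus_blinfun.rep_eq plus_ell2.rep_eq scaleR_blinfun.rep_eq coord_scaleR b coord_diag[OF mark_bound]
    by (auto simp: less_Suc_eq)
qed

lemma tensor_limit:
  assumes "closed B" "\<And>m. tensor_op a (X m) \<in> B" "X \<longlonglongrightarrow> x" "clinear_op a" "\<And>m. clinear_op (X m)" "clinear_op x"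
  shows "tensor_op a x \<in> B"
proof (rule closed_sequentially[OF assms(1) assms(2)])
  show "(\<lambda>m. tensor_op a (X m)) \<longlonglongrightarrow> tensor_op a x"
  proof (rule LIM_zero_cancel, rule Lim_null_comparison)
    show "(\<lambda>m. norm a * norm (X m - x)) \<longlonglongrightarrow> 0"
      using LIM_zero[OF assms(3)] by (intro tendsto_mult_right_zero tendsto_norm_zero)
    show "\<forall>\<^sub>F m in sequentially. norm (tensor_op a (X m) - tensor_op a x) \<le> norm a * norm (X m - x)"
      using norm_tensor_le[of a "X _ - x"] assms by (simp add: tensor_diff_right[symmetric])
  qed
qed

text \<open>A diagonal operator whose entries tend to zero is the norm limit of its truncations, which are combinations of matrix units.\<close>

lemma null_diag:
  assumes B: "closed_star_algebra B" and a: "clinear_op a" and mark: "\<And>m. tensor_op a (diag_op (mark m)) \<in> B"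
    and f: "f \<longlonglongrightarrow> 0"
  shows "tensor_op a (diag_op f) \<in> B"
proof -
  obtain M where M: "\<And>k. \<bar>f k\<bar> \<le> M"
    using f by (metis Bseq_def convergentI convergent_imp_Bseq real_norm_def)
  have M0: "M \<ge> 0" using M[of 0] by linarith
  let ?g = "\<lambda>m k. if k < m then f k else 0"
  have g: "\<bar>?g m k\<bar> \<le> M" for m k using M M0 by simp
  have in_B: "tensor_op a (diag_op (?g m)) \<in> B" for m
  proof (induction m)
    case 0
    have "diag_op (?g 0) = 0"
      by (rule blinfun_eqI, rule ell2_eqI) (simp only: coord_diag[where f="?g 0", OF g], simp add: coord_simps)
    then show ?case using closed_star_algebraD(2)[OF B] by (simp add: tensor_zero_right a)
  next
    case (Suc m)
    have "tensor_op a (diag_op (?g (Suc m))) = tensor_op a (diag_op (?g m)) + f m *\<^sub>R tensor_op a (diag_op (mark m))"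
      unfolding diag_plus_mark[of f, OF M]
      by (simp add: tensor_plus_right tensor_scaleR_right a clinear_diag[OF g] clinear_diag[OF mark_bound])
    then show ?case using Suc mark[of m] closed_star_algebraD(3,8)[OF B] by simp
  qed
  show ?thesis
  proof (rule tensor_limit[OF closed_star_algebraD(7)[OF B] in_B _ a clinear_diag[OF g] clinear_diag[OF M]])
    show "(\<lambda>m. diag_op (?g m)) \<longlonglongrightarrow> diag_op f"
    proof (rule LIMSEQ_I)
      fix r :: real assume "r > 0"
      then obtain N where N: "\<And>k. k \<ge> N \<Longrightarrow> \<bar>f k\<bar> < r / 2"
        using LIMSEQ_D[OF f, of "r / 2"] by auto
      have "norm (diag_op (?g m) - diag_op f) < r" if "m \<ge> N" for m
      proof -
        have "norm (diag_op (?g m) - diag_op f) \<le> r / 2"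
          unfolding diag_diff[of "?g m" M f M, OF g M]
        proof (rule norm_diag_le)
          show "\<bar>?g m k - f k\<bar> \<le> r / 2" for k
            using N[of k] that \<open>r > 0\<close> by auto
        qed
        then show ?thesis using \<open>r > 0\<close> by linarith
      qed
      then show "\<exists>N. \<forall>m\<ge>N. norm (diag_op (?g m) - diag_op f) < r" by blast
    qed
  qed
qed

lemma shift_mark: "unilateral_shift o\<^sub>L diag_op (mark m) o\<^sub>L adj_op unilateral_shift = diag_op (mark (Suc m))"
proof (rule blinfun_eqI, rule ell2_eqI)
  show "coord ((unilateral_shift o\<^sub>L diag_op (mark m) o\<^sub>L adj_op unilateral_shift) x) k = coord (diag_op (mark (Suc m)) x) k" for x k
    by (simp add: coord_diag[OF mark_bound] coord_unilateral_shift coord_adj_shift split: nat.splits)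
qed

lemma shift_isometry: "adj_op unilateral_shift o\<^sub>L unilateral_shift = id_blinfun"
  by (rule blinfun_eqI, rule ell2_eqI) (simp add: coord_adj_shift coord_unilateral_shift)

context
  fixes q :: real
  assumes q: "0 < q" "q < 1"
begin

lemma shift_weight_lower: "1 - shift_weight q k \<le> q ^ k" and shift_weight_lower_pos: "shift_weight q 0 \<le> shift_weight q k"
proof -
  have s: "0 \<le> q ^ Suc k" "q ^ Suc k \<le> q ^ k" "q ^ Suc k \<le> 1" "q ^ Suc k \<le> q ^ Suc 0"
    using q by (simp_all add: mult_left_le_one_le power_le_one mult_le_one mult_left_le)
  have "1 - q ^ Suc k \<le> shift_weight q k"
    unfolding shift_weight_def[OF q]
    by (rule real_le_rsqrt) (use s in \<open>simp add: power2_eq_square mult_left_le_one_le del: power_Suc\<close>)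
  then show "1 - shift_weight q k \<le> q ^ k" using s by linarith
  show "shift_weight q 0 \<le> shift_weight q k" unfolding shift_weight_def[OF q] by (rule real_sqrt_le_mono) (use s in linarith)
qed

lemma shift_weight_complement_bound: "\<bar>1 - shift_weight q k\<bar> \<le> 1"
  using shift_weight_pos[OF q, of k] shift_weight_le[OF q, of k] by simp

lemma shift_weight_limit: "(\<lambda>k. 1 - shift_weight q k) \<longlonglongrightarrow> 0"
proof (rule Lim_null_comparison)
  show "\<forall>\<^sub>F k in sequentially. norm (1 - shift_weight q k) \<le> q ^ k"
    using shift_weight_lower shift_weight_le[OF q] by simp
  show "(\<lambda>k. q ^ k) \<longlonglongrightarrow> 0" using q by (intro LIMSEQ_power_zero) simp
qed

lemma shift_weight_quotient_limit: "(\<lambda>k. (1 - shift_weight q k) / shift_weight q k) \<longlonglongrightarrow> 0"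
  and shift_weight_quotient_bound: "\<bar>(1 - shift_weight q k) / shift_weight q k\<bar> \<le> 1 / shift_weight q 0"
proof -
  have le: "\<bar>(1 - shift_weight q k) / shift_weight q k\<bar> \<le> (1 - shift_weight q k) * (1 / shift_weight q 0)" for k
  proof -
    have "\<bar>(1 - shift_weight q k) / shift_weight q k\<bar> = (1 - shift_weight q k) * (1 / shift_weight q k)"
      using shift_weight_le[OF q, of k] shift_weight_pos[OF q, of k] by simp
    also have "\<dots> \<le> (1 - shift_weight q k) * (1 / shift_weight q 0)"
      using shift_weight_le[OF q, of k] shift_weight_pos[OF q, of k] shift_weight_pos[OF q, of 0] shift_weight_lower_pos[of k]
      by (intro mult_left_mono) (simp_all add: frac_le)
    finally show ?thesis .
  qed
  show "(\<lambda>k. (1 - shift_weight q k) / shift_weight q k) \<longlonglongrightarrow> 0"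
  proof (rule Lim_null_comparison)
    show "\<forall>\<^sub>F k in sequentially. norm ((1 - shift_weight q k) / shift_weight q k) \<le> (1 - shift_weight q k) * (1 / shift_weight q 0)"
      using le by simp
    show "(\<lambda>k. (1 - shift_weight q k) * (1 / shift_weight q 0)) \<longlonglongrightarrow> 0" by (rule tendsto_mult_left_zero[OF shift_weight_limit])
  qed
  have "(1 - shift_weight q k) * (1 / shift_weight q 0) \<le> 1 * (1 / shift_weight q 0)"
    using shift_weight_pos[OF q, of k] shift_weight_pos[OF q, of 0] by (intro mult_right_mono) auto
  then show "\<bar>(1 - shift_weight q k) / shift_weight q k\<bar> \<le> 1 / shift_weight q 0" using le[of k] by simp
qed

lemma weighted_shift_mark: "weighted_shift q o\<^sub>L diag_op (mark m) o\<^sub>L adj_op (weighted_shift q) = (shift_weight q m * shift_weight q m) *\<^sub>R diag_op (mark (Suc m))"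
proof (rule blinfun_eqI, rule ell2_eqI)
  show "coord ((weighted_shift q o\<^sub>L diag_op (mark m) o\<^sub>L adj_op (weighted_shift q)) x) k =
      coord (((shift_weight q m * shift_weight q m) *\<^sub>R diag_op (mark (Suc m))) x) k" for x k
    by (cases k) (simp_all add: coord_diag[OF mark_bound] coord_weighted_shift[OF q] coord_adj_weighted_shift[OF q] coord_scaleR_op[OF q])
qed

text \<open>
  Both \<open>1 - shift_weight\<close> and its quotient by \<open>shift_weight\<close> tend to zero. Hence the difference of the two
  shifts belongs to the norm closure of the operators of finite rank, and each shift is obtained from the other.
\<close>
lemma weighted_shift_eq_shift: "weighted_shift q = unilateral_shift - (unilateral_shift o\<^sub>L diag_op (\<lambda>k. 1 - shift_weight q k))"
proof (rule blinfun_eqI, rule ell2_eqI)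
  note c = coord_diag[of "\<lambda>k. 1 - shift_weight q k", OF shift_weight_complement_bound]
  show "coord (weighted_shift q x) k = coord ((unilateral_shift - (unilateral_shift o\<^sub>L diag_op (\<lambda>k. 1 - shift_weight q k))) x) k" for x k
    by (cases k) (simp_all add: coord_weighted_shift[OF q] coord_unilateral_shift minus_blinfun.rep_eq coord_diff c algebra_simps)
qed

lemma shift_eq_weighted_shift: "unilateral_shift = weighted_shift q + (weighted_shift q o\<^sub>L diag_op (\<lambda>k. (1 - shift_weight q k) / shift_weight q k))"
proof (rule blinfun_eqI, rule ell2_eqI)
  note c = coord_diag[of "\<lambda>k. (1 - shift_weight q k) / shift_weight q k", OF shift_weight_quotient_bound]
  have g: "complex_of_real (shift_weight q k) \<noteq> 0" for k using shift_weight_pos[OF q, of k] by simp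
  show "coord (unilateral_shift x) k = coord ((weighted_shift q + (weighted_shift q o\<^sub>L diag_op (\<lambda>k. (1 - shift_weight q k) / shift_weight q k))) x) k" for x k
    using g by (cases k) (simp_all add: coord_weighted_shift[OF q] coord_unilateral_shift plus_blinfun.rep_eq coord_simps c field_simps)
qed

lemma damping_sq: "damping q o\<^sub>L damping q = diag_op (\<lambda>k. q ^ k)"
  unfolding damping_def[OF q] diag_compose[OF sqrt_pow_bound[OF q] sqrt_pow_bound[OF q]] sqrt_pow_sq[OF q] ..

context
  fixes n :: nat and B :: "nat list op set"
  assumes B: "closed_star_algebra B"
begin

abbreviation "pn \<equiv> proj_op (words n)"

text \<open>
  Conjugating \<open>a \<otimes> E\<^sub>0\<^sub>0\<close> with powers of \<open>1 \<otimes> V\<close> yields the \<open>a \<otimes> E\<^bsub>mm\<^esub>\<close>, and hence \<open>a\<close> tensored with any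
  diagonal operator whose entries tend to zero.
\<close>
lemma model_in_suspension:
  assumes V: "tensor_op pn unilateral_shift \<in> B"
    and units: "\<And>a. a \<in> op_alg pn (model q n) {1..n} \<Longrightarrow> tensor_op a (matrix_unit 0 0) \<in> B"
  shows "proj_op (words (Suc n)) \<in> B" "i \<in> {1..Suc n} \<Longrightarrow> model q (Suc n) i \<in> B"
proof -
  have mark: "tensor_op a (diag_op (mark m)) \<in> B"
    if a: "a \<in> op_alg pn (model q n) {1..n}" "clinear_op a" "pn o\<^sub>L a = a" "a o\<^sub>L pn = a" for a m
  proof (induction m)
    case 0
    then show ?case using units[OF a(1)] by (simp add: matrix_unit_diag)
  next
    case (Suc m)
    have "tensor_op pn unilateral_shift o\<^sub>L tensor_op a (diag_op (mark m)) o\<^sub>L adj_op (tensor_op pn unilateral_shift) \<in> B"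
      by (intro closed_star_algebraD(4)[OF B] closed_star_algebraD(6)[OF B] V Suc)
    also have "tensor_op pn unilateral_shift o\<^sub>L tensor_op a (diag_op (mark m)) o\<^sub>L adj_op (tensor_op pn unilateral_shift) =
        tensor_op a (diag_op (mark (Suc m)))"
      by (simp add: adj_tensor tensor_compose clinear_shift a clinear_diag[OF mark_bound] shift_mark)
    finally show ?case .
  qed
  have gen: "pn \<in> op_alg pn (model q n) {1..n}" by (rule gen_in_closure(1))
  have "adj_op (tensor_op pn unilateral_shift) o\<^sub>L tensor_op pn unilateral_shift \<in> B"
    by (intro closed_star_algebraD(4)[OF B] closed_star_algebraD(6)[OF B] V)
  then show "proj_op (words (Suc n)) \<in> B"
    by (simp add: adj_tensor tensor_compose clinear_shift shift_isometry proj_L_Suc[OF q])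
  assume i: "i \<in> {1..Suc n}"
  show "model q (Suc n) i \<in> B"
  proof (cases "i = Suc n")
    case True
    let ?d = "diag_op (\<lambda>k. 1 - shift_weight q k)"
    have d_lin: "clinear_op ?d"
      by (rule clinear_diag[OF shift_weight_complement_bound])
    have "tensor_op pn ?d \<in> B"
      by (rule null_diag[OF B clinear_proj mark[OF gen] shift_weight_limit]) simp_all
    then have "tensor_op pn unilateral_shift - (tensor_op pn unilateral_shift o\<^sub>L tensor_op pn ?d) \<in> B"
      by (intro closed_star_algebraD(9)[OF B] closed_star_algebraD(4)[OF B] V)
    then show ?thesis
      by (simp add: True model.simps[OF q] weighted_shift_eq_shift tensor_compose tensor_diff_right clinear_shift d_lin)
  next
    case False
    then have i': "i \<in> {1..n}" using i by auto
    have "(\<lambda>k. sqrt q ^ k) \<longlonglongrightarrow> 0" using q by (intro LIMSEQ_power_zero) simp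
    then have "tensor_op (model q n i) (diag_op (\<lambda>k. sqrt q ^ k)) \<in> B"
      by (intro null_diag[OF B model_lin[OF q] mark[OF gen_in_closure(2)[OF i']]])
        (simp_all add: model_lin[OF q] model_proj[OF q i'])
    then show ?thesis using False by (simp add: model.simps[OF q] damping_def[OF q])
  qed
qed

text \<open>
  The operator \<open>1 \<otimes> E\<^sub>0\<^sub>0\<close> is the limit of the powers of \<open>1 - Z Z\<^sup>*\<close>, where \<open>Z\<close> is the last generator. It
  isolates the generators of the smaller ball: \<open>(z \<otimes> damping)(1 \<otimes> E\<^sub>0\<^sub>0) = z \<otimes> E\<^sub>0\<^sub>0\<close>.
\<close>
lemma suspension_in_model:
  assumes one: "proj_op (words (Suc n)) \<in> B" and gens: "\<And>i. i \<in> {1..Suc n} \<Longrightarrow> model q (Suc n) i \<in> B"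
  shows "tensor_op pn unilateral_shift \<in> B"
    "a \<in> op_alg pn (model q n) {1..n} \<Longrightarrow> tensor_op a (matrix_unit 0 0) \<in> B"
proof -
  note lin = weighted_shift_lin[OF q] damping_lin[OF q] model_lin[OF q] adj_weighted_shift_lin[OF q] clinear_proj clinear_id clinear_diag[OF mark_bound]
  have top_in_B: "tensor_op pn (weighted_shift q) \<in> B" using gens[of "Suc n"] by (simp add: model.simps[OF q])
  have qk: "\<bar>(q ^ k) ^ m\<bar> \<le> 1" for k m using q by (simp add: power_le_one)
  have "tensor_op pn (damping q o\<^sub>L damping q) = proj_op (words (Suc n)) - (tensor_op pn (weighted_shift q) o\<^sub>L adj_op (tensor_op pn (weighted_shift q)))"
    by (simp add: damping_damping[OF q] proj_L_Suc[OF q] adj_tensor tensor_compose tensor_diff_right lin)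
  then have DD: "tensor_op pn (diag_op (\<lambda>k. (q ^ k) ^ 1)) \<in> B"
    unfolding damping_sq power_one_right
    by (simp only:) (intro closed_star_algebraD(9)[OF B] closed_star_algebraD(4)[OF B] closed_star_algebraD(6)[OF B] one top_in_B)
  have DDm: "tensor_op pn (diag_op (\<lambda>k. (q ^ k) ^ Suc m)) \<in> B" for m
  proof (induction m)
    case 0 then show ?case using DD by simp
  next
    case (Suc m)
    have "tensor_op pn (diag_op (\<lambda>k. (q ^ k) ^ 1)) o\<^sub>L tensor_op pn (diag_op (\<lambda>k. (q ^ k) ^ Suc m)) \<in> B"
      by (intro closed_star_algebraD(4)[OF B] DD Suc)
    also have "tensor_op pn (diag_op (\<lambda>k. (q ^ k) ^ 1)) o\<^sub>L tensor_op pn (diag_op (\<lambda>k. (q ^ k) ^ Suc m)) =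
        tensor_op pn (diag_op (\<lambda>k. (q ^ k) ^ 1 * (q ^ k) ^ Suc m))"
      by (simp only: tensor_compose[OF clinear_proj clinear_diag[OF qk] clinear_proj clinear_diag[OF qk]]
          proj_proj diag_compose[OF qk qk])
    finally show ?case by simp
  qed
  have unit0: "tensor_op pn (diag_op (mark 0)) \<in> B"
  proof (rule tensor_limit[OF closed_star_algebraD(7)[OF B] DDm])
    show "(\<lambda>m. diag_op (\<lambda>k. (q ^ k) ^ Suc m)) \<longlonglongrightarrow> diag_op (mark 0)"
    proof (rule LIM_zero_cancel, rule Lim_null_comparison)
      show "(\<lambda>m. q ^ Suc m) \<longlonglongrightarrow> 0" using q by (intro LIMSEQ_Suc LIMSEQ_power_zero) simp
      have "norm (diag_op (\<lambda>k. (q ^ k) ^ Suc m) - diag_op (mark 0)) \<le> q ^ Suc m" for m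
        unfolding diag_diff[OF qk mark_bound]
      proof (rule norm_diag_le)
        fix k
        show "\<bar>(q ^ k) ^ Suc m - mark 0 k\<bar> \<le> q ^ Suc m"
        proof (cases k)
          case (Suc j)
          have "q ^ Suc j \<le> q" using q by (simp add: mult_left_le power_le_one)
          then have "(q ^ Suc j) ^ Suc m \<le> q ^ Suc m" using q by (intro power_mono) auto
          then show ?thesis using q Suc by (simp del: power_Suc)
        qed (use q in simp)
      qed
      then show "\<forall>\<^sub>F m in sequentially. norm (diag_op (\<lambda>k. (q ^ k) ^ Suc m) - diag_op (mark 0)) \<le> q ^ Suc m"
        by (intro always_eventually allI)
    qed
    show "clinear_op (diag_op (\<lambda>k. (q ^ k) ^ Suc m))" for m by (rule clinear_diag[OF qk])
  qed (simp_all add: clinear_diag[OF mark_bound])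
  have mark: "tensor_op pn (diag_op (mark m)) \<in> B" for m
  proof (induction m)
    case (Suc m)
    have g: "shift_weight q m * shift_weight q m \<noteq> 0" using shift_weight_pos[OF q, of m] by simp
    have "(1 / (shift_weight q m * shift_weight q m)) *\<^sub>R (tensor_op pn (weighted_shift q) o\<^sub>L tensor_op pn (diag_op (mark m)) o\<^sub>L adj_op (tensor_op pn (weighted_shift q))) \<in> B"
      by (intro closed_star_algebraD(4)[OF B] closed_star_algebraD(6)[OF B] closed_star_algebraD(8)[OF B] top_in_B Suc)
    also have "tensor_op pn (weighted_shift q) o\<^sub>L tensor_op pn (diag_op (mark m)) o\<^sub>L adj_op (tensor_op pn (weighted_shift q)) =
        (shift_weight q m * shift_weight q m) *\<^sub>R tensor_op pn (diag_op (mark (Suc m)))"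
      by (simp add: adj_tensor tensor_compose lin weighted_shift_mark tensor_scaleR_right)
    finally show ?case using g by simp
  qed (rule unit0)
  let ?d = "diag_op (\<lambda>k. (1 - shift_weight q k) / shift_weight q k)"
  have d_lin: "clinear_op ?d" by (rule clinear_diag[OF shift_weight_quotient_bound])
  have "tensor_op pn ?d \<in> B" by (rule null_diag[OF B clinear_proj mark shift_weight_quotient_limit])
  then have "tensor_op pn (weighted_shift q) + (tensor_op pn (weighted_shift q) o\<^sub>L tensor_op pn ?d) \<in> B"
    by (intro closed_star_algebraD(3)[OF B] closed_star_algebraD(4)[OF B] top_in_B)
  also have "tensor_op pn (weighted_shift q) + (tensor_op pn (weighted_shift q) o\<^sub>L tensor_op pn ?d) = tensor_op pn unilateral_shift"
    using arg_cong[OF shift_eq_weighted_shift, of "tensor_op pn"] by (simp add: tensor_compose tensor_plus_right lin d_lin)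
  finally show "tensor_op pn unilateral_shift \<in> B" .
  define e where "e = diag_op (mark 0)"
  have e: "clinear_op e" "e o\<^sub>L e = e" "adj_op e = e"
    unfolding e_def diag_compose[OF mark_bound mark_bound]
    by (simp_all add: clinear_diag[OF mark_bound] adj_diag[OF mark_bound] if_distrib cong: if_cong)
  define B0 where "B0 = {a. clinear_op a \<and> tensor_op a e \<in> B}"
  have "closed_star_algebra B0"
    unfolding closed_star_algebra_def
  proof (intro conjI ballI allI)
    show "B0 \<subseteq> Collect clinear_op" "0 \<in> B0"
      using closed_star_algebraD(2)[OF B] by (auto simp: B0_def tensor_zero_left e)
    fix x assume x: "x \<in> B0"
    then have x': "clinear_op x" "tensor_op x e \<in> B" by (auto simp: B0_def)
    show "cscale_op c x \<in> B0" for c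
      using x' closed_star_algebraD(5)[OF B] by (auto simp: B0_def tensor_cscale_left e)
    show "adj_op x \<in> B0"
      using x' closed_star_algebraD(6)[OF B x'(2)] by (auto simp: B0_def adj_tensor e)
    fix y assume y: "y \<in> B0"
    then have y': "clinear_op y" "tensor_op y e \<in> B" by (auto simp: B0_def)
    show "x + y \<in> B0"
      using x' y' closed_star_algebraD(3)[OF B x'(2) y'(2)] by (auto simp: B0_def tensor_plus_left e)
    show "x o\<^sub>L y \<in> B0"
      using x' y' closed_star_algebraD(4)[OF B x'(2) y'(2)] by (auto simp: B0_def tensor_compose e)
  next
    show "closed B0"
      unfolding closed_sequential_limits
    proof (intro allI impI)
      fix X x assume "(\<forall>k. X k \<in> B0) \<and> X \<longlonglongrightarrow> x"
      then have X: "\<And>k. clinear_op (X k)" "\<And>k. tensor_op (X k) e \<in> B" "X \<longlonglongrightarrow> x" by (auto simp: B0_def)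
      have x: "clinear_op x" using closed_sequentially[OF closed_clinear _ X(3)] X(1) by simp
      have "(\<lambda>k. tensor_op (X k) e) \<longlonglongrightarrow> tensor_op x e"
      proof (rule LIM_zero_cancel, rule Lim_null_comparison)
        show "(\<lambda>k. norm (X k - x) * norm e) \<longlonglongrightarrow> 0"
          using LIM_zero[OF X(3)] by (intro tendsto_mult_left_zero tendsto_norm_zero)
        show "\<forall>\<^sub>F k in sequentially. norm (tensor_op (X k) e - tensor_op x e) \<le> norm (X k - x) * norm e"
          using norm_tensor_le[of "X _ - x" e] X(1) x e(1) by (simp add: tensor_diff_left[symmetric])
      qed
      then have "tensor_op x e \<in> B" by (rule closed_sequentially[OF closed_star_algebraD(7)[OF B] X(2)])
      then show "x \<in> B0" using x by (simp add: B0_def)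
    qed
  qed
  then have "op_alg pn (model q n) {1..n} \<subseteq> B0"
  proof (rule closure_ev_least)
    show "pn \<in> B0" using unit0 by (simp add: B0_def e_def)
    have "model q n i \<in> B0" if i: "i \<in> {1..n}" for i
    proof -
      have "damping q o\<^sub>L e = e"
        by (rule blinfun_eqI, rule ell2_eqI) (simp add: e_def coord_damping[OF q] coord_diag[OF mark_bound])
      then have "tensor_op (model q n i) e = model q (Suc n) i o\<^sub>L tensor_op pn e"
        using i by (simp add: model.simps[OF q] tensor_compose lin e model_proj[OF q i])
      then have "tensor_op (model q n i) e \<in> B"
        using closed_star_algebraD(4)[OF B gens[of i] unit0] i by (simp add: e_def)
      then show ?thesis by (simp add: B0_def model_lin[OF q])
    qed
    then show "model q n ` {1..n} \<subseteq> B0" by blast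
  qed
  then show "a \<in> op_alg pn (model q n) {1..n} \<Longrightarrow> tensor_op a (matrix_unit 0 0) \<in> B"
    unfolding matrix_unit_diag e_def[symmetric] B0_def by blast
qed

end

text \<open>The algebra of the zero-dimensional ball.\<close>
lemma scalars_closed_star_algebra: "closed_star_algebra (range (\<lambda>c. cscale_op c (proj_op {[] :: nat list})))"
  unfolding closed_star_algebra_def
proof (intro conjI ballI allI)
  let ?p = "proj_op {[] :: nat list}"
  let ?B = "range (\<lambda>c. cscale_op c ?p)"
  have apply_eq: "cscale_op c ?p x = cscale_ell2 c (?p x)" for c x by (rule cscale_op_apply)
  show "?B \<subseteq> Collect clinear_op" by auto
  have "0 = cscale_op 0 ?p" by (simp add: cscale_op_zero)
  then show "0 \<in> ?B" by blast
  fix x assume "x \<in> ?B"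
  then obtain c where c: "x = cscale_op c ?p" by auto
  have "cscale_op d x = cscale_op (d * c) ?p" for d
    unfolding c by (rule blinfun_eqI) (simp add: apply_eq cscale_op_apply cscale_cscale)
  then show "cscale_op d x \<in> ?B" for d by blast
  have "adj_op x = cscale_op (cnj c) ?p" unfolding c by simp
  then show "adj_op x \<in> ?B" by blast
  fix y assume "y \<in> ?B"
  then obtain d where d: "y = cscale_op d ?p" by auto
  have "x + y = cscale_op (c + d) ?p"
    unfolding c d by (rule blinfun_eqI, rule ell2_eqI) (simp add: plus_blinfun.rep_eq apply_eq coord_simps algebra_simps)
  then show "x + y \<in> ?B" by blast
  have "x o\<^sub>L y = cscale_op (c * d) ?p"
    unfolding c d by (simp add: compose_cscale_left clinear_compose_cscale_right)
      (rule blinfun_eqI, simp add: cscale_op_apply cscale_cscale)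
  then show "x o\<^sub>L y \<in> ?B" by blast
next
  let ?p = "proj_op {[] :: nat list}"
  show "closed (range (\<lambda>c. cscale_op c ?p))"
    unfolding closed_sequential_limits
  proof (intro allI impI)
    fix X x assume "(\<forall>k. X k \<in> range (\<lambda>c. cscale_op c ?p)) \<and> X \<longlonglongrightarrow> x"
    then have "\<forall>k. \<exists>c. X k = cscale_op c ?p" and X: "X \<longlonglongrightarrow> x" by auto
    from choice[OF this(1)] obtain c where c: "\<And>k. X k = cscale_op (c k) ?p" by blast
    define d where "d = coord (x (ket [])) []"
    have ck: "c k = coord (X k (ket [])) []" for k
      by (simp add: c cscale_op_apply proj_op.rep_eq coord_simps)
    have lim: "c \<longlonglongrightarrow> d"
    proof (rule LIM_zero_cancel, rule Lim_null_comparison)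
      show "(\<lambda>k. norm (X k - x) * norm (ket [] :: nat list ell2)) \<longlonglongrightarrow> 0"
        using LIM_zero[OF X] by (intro tendsto_mult_left_zero tendsto_norm_zero)
      have "norm (c k - d) \<le> norm (X k - x) * norm (ket [] :: nat list ell2)" for k
      proof -
        have "c k - d = coord ((X k - x) (ket [])) []"
          by (simp add: ck d_def minus_blinfun.rep_eq coord_diff)
        then have "norm (c k - d) \<le> norm ((X k - x) (ket []))" by (simp add: cmod_coord_le)
        then show ?thesis using norm_blinfun order_trans by blast
      qed
      then show "\<forall>\<^sub>F k in sequentially. norm (c k - d) \<le> norm (X k - x) * norm (ket [] :: nat list ell2)"
        by (intro always_eventually allI)
    qed
    have "X \<longlonglongrightarrow> cscale_op d ?p"
    proof (rule LIM_zero_cancel, rule Lim_null_comparison)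
      show "(\<lambda>k. norm (c k - d) * norm ?p) \<longlonglongrightarrow> 0"
        using LIM_zero[OF lim] by (intro tendsto_mult_left_zero tendsto_norm_zero)
      have "X k - cscale_op d ?p = cscale_op (c k - d) ?p" for k
        unfolding c by (rule blinfun_eqI, rule ell2_eqI)
          (simp add: minus_blinfun.rep_eq cscale_op_apply coord_simps algebra_simps)
      then show "\<forall>\<^sub>F k in sequentially. norm (X k - cscale_op d ?p) \<le> norm (c k - d) * norm ?p"
        by (simp add: norm_cscale_op)
    qed
    then have "x = cscale_op d ?p" using X LIMSEQ_unique by blast
    then show "x \<in> range (\<lambda>c. cscale_op c ?p)" by blast
  qed
qed

theorem quantum_ball_model:
  "quantum_ball n = (bounded_operators (words n))
    \<lparr>carrier := op_alg (proj_op (words n)) (model q n) {1..n}\<rparr>"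
proof (induction n)
  case 0
  let ?p = "proj_op {[] :: nat list}" and ?B = "range (\<lambda>c. cscale_op c (proj_op {[] :: nat list}))"
  have L0: "words 0 = {[]}" by auto
  have "op_alg ?p (model q 0) {1..0} = ?B"
  proof
    have "?p = cscale_op 1 ?p" using cscale_op_of_real[of 1 ?p] by simp
    then have "?p \<in> ?B" by blast
    then show "op_alg ?p (model q 0) {1..0} \<subseteq> ?B"
      by (intro closure_ev_least scalars_closed_star_algebra) auto
    have "cscale_op c ?p \<in> ev ?p (model q 0) ` star_polys {1..0}" for c
      by (rule image_eqI[of _ _ "Scale c Unit"]) auto
    then show "?B \<subseteq> op_alg ?p (model q 0) {1..0}"
      using closure_subset by blast
  qed
  then show ?case unfolding L0 by simp
next
  case (Suc n)
  let ?p = "proj_op (words n)"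
  let ?C = "op_alg ?p (model q n) {1..n}"
  let ?p' = "proj_op (words (Suc n))"
  let ?S = "insert (tensor_op ?p unilateral_shift) ((\<lambda>a. tensor_op a (matrix_unit 0 0)) ` ?C)"
  have "proj_op (UNIV :: nat list set) = id_blinfun" by (rule blinfun_eqI) (simp add: proj_op.rep_eq restrict_UNIV)
  then have opsU: "ops (UNIV :: nat list set) = Collect clinear_op" by simp
  have C_lin: "clinear_op a" if "a \<in> ?C" for a
    using closed_star_algebraD(1)[OF closed_star_algebra_ev that] by (simp add: model_lin[OF q])
  have "?S \<subseteq> Collect clinear_op"
    using C_lin by (auto simp: clinear_shift matrix_unit_diag clinear_diag[OF mark_bound])
  then have "cstar_generated (bounded_operators UNIV) ?S = \<Inter>{B. closed_star_algebra B \<and> ?S \<subseteq> B}"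
    by (intro generated_ops) (simp only: opsU)
  also have "\<dots> = \<Inter>{B. closed_star_algebra B \<and> insert ?p' (model q (Suc n) ` {1..Suc n}) \<subseteq> B}"
  proof -
    have "?S \<subseteq> B \<longleftrightarrow> insert ?p' (model q (Suc n) ` {1..Suc n}) \<subseteq> B" if B: "closed_star_algebra B" for B
    proof
      assume S: "?S \<subseteq> B"
      have "tensor_op ?p unilateral_shift \<in> B" "\<And>a. a \<in> ?C \<Longrightarrow> tensor_op a (matrix_unit 0 0) \<in> B"
        using S by blast+
      from model_in_suspension[OF B this] show "insert ?p' (model q (Suc n) ` {1..Suc n}) \<subseteq> B" by blast
    next
      assume S: "insert ?p' (model q (Suc n) ` {1..Suc n}) \<subseteq> B"
      have "?p' \<in> B" "\<And>i. i \<in> {1..Suc n} \<Longrightarrow> model q (Suc n) i \<in> B" using S by blast+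
      from suspension_in_model[OF B this] show "?S \<subseteq> B" by blast
    qed
    then show ?thesis by (intro arg_cong[where f=Inter]) blast
  qed
  also have "\<dots> = op_alg ?p' (model q (Suc n)) {1..Suc n}"
    by (rule generated_ev) (simp_all add: model_lin[OF q] del: model.simps)
  finally have "cstar_generated (bounded_operators UNIV) ?S = op_alg ?p' (model q (Suc n)) {1..Suc n}" .
  then show ?case
    unfolding quantum_ball.simps Suc quantum_double_suspension_def
    by (simp add: proj_L_Suc[OF q] bounded_operators_def del: model.simps atLeastAtMost_iff)
qed

end

section \<open>The universal property of the ball algebra\<close>

lemma sum_in:
  assumes "0 \<in> A" "\<And>x y. x \<in> A \<Longrightarrow> y \<in> A \<Longrightarrow> x + y \<in> A" "\<And>j. j \<in> S \<Longrightarrow> f j \<in> A"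
  shows "sum f S \<in> A"
  using assms(3) by (induction S rule: infinite_finite_induct) (auto simp: assms(1,2))

text \<open>The relations in the record notation of an abstract *-algebra, for the algebra of operators on \<open>\<ell>\<^sup>2(I)\<close>.\<close>
lemma ball_relations_iff:
  assumes q: "0 < q" and T: "\<And>i. i \<in> {1..n} \<Longrightarrow> T i \<in> ops I"
  shows "ball_relations q n (bounded_operators I) T \<longleftrightarrow> ball_rep q n (proj_op I) T"
proof -
  note A = closed_star_algebraD[OF closed_star_algebra_ops[of I]]
  have pow: "q powr (1/2) = sqrt q" "q powr (- 1/2) = inverse (sqrt q)"
    using q powr_minus[of q "1/2"] by (simp_all add: powr_half_sqrt)
  have T': "clinear_op (T i) \<and> proj_op I o\<^sub>L T i = T i \<and> T i o\<^sub>L proj_op I = T i" if "i \<in> {1..n}" for i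
    using T[OF that] by simp
  have sum: "(\<Oplus>\<^bsub>bounded_operators I\<^esub>j\<in>{i+1..n}. T j \<otimes>\<^bsub>bounded_operators I\<^esub> star (bounded_operators I) (T j)) =
      (\<Sum>j\<in>{i+1..n}. T j o\<^sub>L adj_op (T j))" if i: "i \<in> {1..n}" for i
    unfolding bounded_operators_simps
  proof (rule finsum_ops)
    fix j assume "j \<in> {i+1..n}"
    then have "j \<in> {1..n}" by auto
    from A(4)[OF T[OF this] A(6)[OF T[OF this]]] show "T j o\<^sub>L adj_op (T j) \<in> ops I" .
  qed
  have sum_ops: "(\<Sum>j\<in>{i+1..n}. T j o\<^sub>L adj_op (T j)) \<in> ops I" if i: "i \<in> {1..n}" for i
  proof (rule sum_in)
    show "0 \<in> ops I" by (rule A(2))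
    show "x + y \<in> ops I" if "x \<in> ops I" "y \<in> ops I" for x y by (rule A(3)[OF that])
    fix j assume "j \<in> {i+1..n}"
    then have "j \<in> {1..n}" by auto
    from A(4)[OF T[OF this] A(6)[OF T[OF this]]] show "T j o\<^sub>L adj_op (T j) \<in> ops I" .
  qed
  have third: "(star (bounded_operators I) (T i) \<otimes>\<^bsub>bounded_operators I\<^esub> T i \<ominus>\<^bsub>bounded_operators I\<^esub>
        cscale (bounded_operators I) (complex_of_real q) (T i \<otimes>\<^bsub>bounded_operators I\<^esub> star (bounded_operators I) (T i)) =
      cscale (bounded_operators I) (complex_of_real (1 - q)) (\<one>\<^bsub>bounded_operators I\<^esub> \<ominus>\<^bsub>bounded_operators I\<^esub>
        (\<Oplus>\<^bsub>bounded_operators I\<^esub>j\<in>{i+1..n}. T j \<otimes>\<^bsub>bounded_operators I\<^esub> star (bounded_operators I) (T j)))) \<longleftrightarrow>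
    ((adj_op (T i) o\<^sub>L T i) - q *\<^sub>R (T i o\<^sub>L adj_op (T i)) =
        (1 - q) *\<^sub>R (proj_op I - (\<Sum>j\<in>{i+1..n}. T j o\<^sub>L adj_op (T j))))" if i: "i \<in> {1..n}" for i
    unfolding sum[OF i] unfolding bounded_operators_simps cscale_op_of_real
    using minus_ops[OF A(4)[OF A(6)[OF T[OF i]] T[OF i]] A(8)[OF A(4)[OF T[OF i] A(6)[OF T[OF i]]], of q]]
      minus_ops[OF proj_in_ops sum_ops[OF i]]
    by (simp only:)
  show ?thesis
    unfolding ball_relations_def ball_rep_def
    unfolding bounded_operators_simps(2,6,7) pow cscale_op_of_real
    using third[unfolded bounded_operators_simps(2,6,7) cscale_op_of_real] T' is_projection_proj[of I]
    by (simp only: ball_conj_distrib simp_thms) blast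
qed

lemma ball_rep_cong:
  assumes "\<And>i. i \<in> {1..n} \<Longrightarrow> T i = T' i" "ball_rep q n E T'"
  shows "ball_rep q n E T"
proof -
  have "(\<Sum>j\<in>{i+1..n}. T j o\<^sub>L adj_op (T j)) = (\<Sum>j\<in>{i+1..n}. T' j o\<^sub>L adj_op (T' j))" if "i \<in> {1..n}" for i
    by (rule sum.cong) (use assms(1) that in auto)
  then show ?thesis using assms(2) unfolding ball_rep_def by (simp only: assms(1) simp_thms cong: ball_cong) blast
qed

theorem theorem3p1:
  fixes q :: real and n :: nat
  assumes "0 < q" and "q < 1" and "n \<ge> 1"
    and "infinite (UNIV :: 'i set)"
  shows "cstar_isomorphic (quantum_ball n)
           (universal_cstar_alg TYPE('i) n (ball_relations q n))"
proof -
  note q = assms(1,2)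
  let ?L = "words n"
  obtain g :: "nat \<Rightarrow> 'i" where g: "inj g"
    using assms(4) infinite_countable_subset by blast
  \<comment> \<open>An injection of the words into \<open>'i\<close> transports the model to a representation on some \<open>\<ell>\<^sup>2(I0)\<close>.\<close>
  define \<phi> :: "nat list \<times> unit \<Rightarrow> 'i" where "\<phi> = (\<lambda>(xs, _). g (to_nat xs))"
  have inj: "inj \<phi>"
    unfolding \<phi>_def by (auto intro!: injI dest!: injD[OF g])
  define I0 where "I0 = \<phi> ` (?L \<times> UNIV)"
  define T0 where "T0 = (\<lambda>i\<in>{1..n}. amp \<phi> (model q n i))"
  have p0: "proj_op I0 = amp \<phi> (proj_op ?L)" by (simp add: I0_def amp_proj[OF inj])
  have T0: "T0 i = amp \<phi> (model q n i)" if "i \<in> {1..n}" for i using that by (simp add: T0_def)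
  have model_ops: "model q n i \<in> ops ?L" if "i \<in> {1..n}" for i
    using model_lin[OF q] model_proj[OF q that] by simp
  have T0_ops: "T0 i \<in> ops I0" if i: "i \<in> {1..n}" for i
    using model_lin[OF q, of n i] model_proj[OF q i]
    by (simp add: T0[OF i] p0 clinear_amp[OF inj] amp_compose[OF inj, symmetric])
  have rep: "(I0, T0) \<in> representations TYPE('i) n (ball_relations q n)"
  proof -
    have "ball_rep q n (proj_op I0) T0"
      unfolding p0 by (rule ball_rep_cong[OF T0 ball_rep_amp[OF inj ball_rep_model[OF q]]])
    then have "ball_relations q n (bounded_operators I0) T0"
      using ball_relations_iff[where T=T0 and n=n, OF q(1) T0_ops] by blast
    moreover have "T0 \<in> (\<Pi>\<^sub>E i\<in>{1..n}. ops I0)"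
      by (rule PiE_I[OF T0_ops]) (auto simp: T0_def)
    ultimately show ?thesis
      unfolding representations_def bounded_operators_simps by blast
  qed
  have ev0: "ev (proj_op I0) T0 p = amp \<phi> (ev (proj_op ?L) (model q n) p)" if "p \<in> star_polys {1..n}" for p
    using that
  proof (induction p)
    case (Star p)
    have "clinear_op (ev (proj_op ?L) (model q n) p)"
      by (rule closed_star_algebraD(1)[OF closed_star_algebra_ops ev_in[OF closed_star_algebra_ops proj_in_ops]])
        (use model_ops Star.prems in auto)
    then show ?case using Star by (simp add: adj_amp[OF inj])
  qed (simp_all add: T0 p0 amp_plus[OF inj] amp_compose[OF inj] amp_cscale[OF inj])
  show ?thesis
    unfolding quantum_ball_model[OF q]
  proof (rule universal_algebra_isomorphic[OF model_ops _ rep])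
    fix I and T :: "nat \<Rightarrow> 'i op" and p
    assume IT: "(I, T) \<in> representations TYPE('i) n (ball_relations q n)" and p: "p \<in> star_polys {1..n}"
    have T_PiE: "T \<in> (\<Pi>\<^sub>E i\<in>{1..n}. ops I)" and rel: "ball_relations q n (bounded_operators I) T"
      using IT unfolding representations_def bounded_operators_simps by blast+
    have T: "T i \<in> ops I" if "i \<in> {1..n}" for i using T_PiE that by (rule PiE_mem)
    have "ball_rep q n (proj_op I) T" using rel ball_relations_iff[where T=T and n=n, OF q(1) T] by blast
    then show "norm (ev (proj_op I) T p) \<le> norm (ev (proj_op ?L) (model q n) p)"
      by (rule model_dominates[OF q _ p])
  next
    fix p :: "nat star_poly" assume p: "p \<in> star_polys {1..n}"
    show "norm (ev (proj_op ?L) (model q n) p) \<le> norm (ev (proj_op I0) T0 p)"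
      unfolding ev0[OF p] norm_amp[OF inj] ..
  qed
qed

end
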